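(* Let $F_1,\dots,F_r$ be $r$ general forms of degree $d$ in $R=k[x_1,\dots,x_n]$, where $r>n$. Set $A=R/(F_1,\dots,F_r)$. Assume \[ \binom{d+t_0+2}{d+t_0}-(r-1)\binom{t_0+2}{t_0}\ \ge\ 0 . \] Then \[ \dim_k A_{d+t}=\binom{n+d+t-1}{d+t}-r\binom{t+n-1}{t}\qquad\text{for all } t\le t_0 , \] i.e., $\{R_tF_j\}_{j=1,\dots,r}$ spans a vector space of maximal dimension.
   Context: $k$ is an infinite field and $R=k[x_1,\dots,x_n]$ has the standard grading; $R_t$ is the vector space of forms of degree $t$ in $R$, $A_s$ is the degree-$s$ graded component of $A$, and $R_tF_j$ is the set of products of forms of degree $t$ with $F_j$. "General forms of degree $d$" means that the statement holds for all $(F_1,\dots,F_r)$ in some nonempty Zariski open subset of $(R_d)^r$.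
   Formalization: For n ≤ 3 the displayed value of dim A_{d+t} can be negative (n=3, t_0=0, r=binom(d+2,2)+1 gives −1), so it is replaced by its maximum with 0, as "maximal dimension" means; for n ≥ 4 the formula is kept as printed. t and t_0 are nonnegative integers. *)

theory Defs
  imports
    "HOL-Library.Poly_Mapping"
    "HOL-Library.FuncSet"
    "HOL-Algebra.Embedded_Algebras"
    "HOL-Algebra.QuotRing"
    "HOL-Algebra.Algebraic_Closure_Type"
begin

text \<open>
  Polynomials over \<open>'k\<close> with variables indexed by \<open>'v\<close>: finitely supported maps from exponent
  vectors to coefficients. For a finite type \<open>'n\<close> this is
  \<open>k[x\<^sub>1,\<dots>,x\<^sub>n]\<close> with \<open>n = CARD('n)\<close>.
\<close>

type_synonym ('v, 'k) mpoly = "('v \<Rightarrow>\<^sub>0 nat) \<Rightarrow>\<^sub>0 'k"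

definition const :: "'k::field \<Rightarrow> ('v, 'k) mpoly" where
  "const c = Poly_Mapping.single 0 c"

definition eval_mpoly :: "('v \<Rightarrow> 'k::field) \<Rightarrow> ('v, 'k) mpoly \<Rightarrow> 'k" where
  "eval_mpoly a p =
     (\<Sum>m\<in>Poly_Mapping.keys p. Poly_Mapping.lookup p m *
        (\<Prod>v\<in>Poly_Mapping.keys m. a v ^ Poly_Mapping.lookup m v))"

definition forms :: "nat \<Rightarrow> ('n::finite, 'k::field) mpoly set" where
  "forms s = {f. \<forall>m\<in>Poly_Mapping.keys f. (\<Sum>i\<in>UNIV. Poly_Mapping.lookup m i) = s}"

interpretation mpoly: vector_space "\<lambda>(c::'k::field) (f::('v, 'k) mpoly). const c * f"
  by unfold_locales
    (simp_all add: const_def algebra_simps single_add mult_single flip: mult.assoc)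


subsection \<open>The graded algebra \<open>A = R/(F\<^sub>1,\<dots>,F\<^sub>r)\<close>\<close>

definition form_ideal :: "nat \<Rightarrow> (nat \<Rightarrow> ('n::finite, 'k::field) mpoly) \<Rightarrow> ('n, 'k) mpoly set" where
  "form_ideal r F = genideal ring_of_type_algebra (F ` {..<r})"

definition quot_alg ::
  "nat \<Rightarrow> (nat \<Rightarrow> ('n::finite, 'k::field) mpoly) \<Rightarrow> ('n, 'k) mpoly set ring" where
  "quot_alg r F = ring_of_type_algebra Quot (form_ideal r F)"

definition residue_class ::
  "nat \<Rightarrow> (nat \<Rightarrow> ('n::finite, 'k::field) mpoly) \<Rightarrow> ('n, 'k) mpoly \<Rightarrow> ('n, 'k) mpoly set" where
  "residue_class r F f = a_r_coset ring_of_type_algebra (form_ideal r F) f"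

definition quot_component ::
  "nat \<Rightarrow> (nat \<Rightarrow> ('n::finite, 'k::field) mpoly) \<Rightarrow> nat \<Rightarrow> ('n, 'k) mpoly set set" where
  "quot_component r F s = residue_class r F ` forms s"

text \<open>
  \<open>dim\<^sub>k A\<^sub>s = m\<close>. The field \<open>k\<close> acts on \<open>A\<close> through its image, the residue classes of the
  constants. Also when \<open>A\<close> is the zero ring (and this image is not a field) the zero space
  has dimension 0.
\<close>

definition quot_component_dim ::
  "nat \<Rightarrow> (nat \<Rightarrow> ('n::finite, 'k::field) mpoly) \<Rightarrow> nat \<Rightarrow> nat \<Rightarrow> bool" where
  "quot_component_dim r F s m \<longleftrightarrow>
     ring.dimension (quot_alg r F) m (residue_class r F ` (const ` UNIV)) (quot_component r F s)"


subsection \<open>General forms\<close>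

definition form_tuples :: "nat \<Rightarrow> nat \<Rightarrow> (nat \<Rightarrow> ('n::finite, 'k::field) mpoly) set" where
  "form_tuples r d = {..<r} \<rightarrow>\<^sub>E forms d"

text \<open>
  The coefficients of the forms are the coordinates of the affine space \<open>(R\<^sub>d)\<^sup>r\<close>; coordinates
  \<open>(j, m)\<close> with \<open>j \<ge> r\<close> or \<open>m\<close> of degree other than \<open>d\<close> vanish identically on it.
\<close>

definition coeff_coords ::
  "nat \<Rightarrow> (nat \<Rightarrow> ('n::finite, 'k::field) mpoly) \<Rightarrow> nat \<times> ('n \<Rightarrow>\<^sub>0 nat) \<Rightarrow> 'k" where
  "coeff_coords r F = (\<lambda>(j, m). if j < r then Poly_Mapping.lookup (F j) m else 0)"

definition zariski_open ::
  "nat \<Rightarrow> nat \<Rightarrow> (nat \<Rightarrow> ('n::finite, 'k::field) mpoly) set \<Rightarrow> bool" where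
  "zariski_open r d U \<longleftrightarrow>
     (\<exists>S :: (nat \<times> ('n \<Rightarrow>\<^sub>0 nat), 'k) mpoly set.
        U = {F \<in> form_tuples r d. \<exists>p\<in>S. eval_mpoly (coeff_coords r F) p \<noteq> 0})"

definition for_general_forms ::
  "nat \<Rightarrow> nat \<Rightarrow> ((nat \<Rightarrow> ('n::finite, 'k::field) mpoly) \<Rightarrow> bool) \<Rightarrow> bool" where
  "for_general_forms r d P \<longleftrightarrow> (\<exists>U. zariski_open r d U \<and> U \<noteq> {} \<and> (\<forall>F\<in>U. P F))"


text \<open>
  The integer \<open>dim R\<^sub>d\<^sub>+\<^sub>t - r dim R\<^sub>t\<close> for \<open>n \<ge> 1\<close> variables, which may be negative.
\<close>

definition expected_dim :: "nat \<Rightarrow> nat \<Rightarrow> nat \<Rightarrow> nat \<Rightarrow> int" where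
  "expected_dim n r d t =
     int ((n + d + t - 1) choose (d + t)) - int r * int ((t + n - 1) choose t)"

end

(*
  Independence of the products of monomials and forms is an open condition, and a line through two tuples of
  forms meets an open condition that holds at one of its points in all but finitely many points. So it is enough to
  find, for each t separately, one tuple of forms whose products are as independent as possible.

  For n >= 4 take r - 1 forms in k[x, y, z] and the power w^d of a further variable: the degree t of the
  multipliers is less than d, so w^d is in no relation and the problem is reduced to r - 1 ternary forms. This is
  where the hypothesis on r - 1 forms in three variables comes from. For n <= 2 monomials suffice.

  The ternary case uses Hirschowitz' Horace method. Restrict a relation to a line: if some of the forms are
  divisible by the equation of the line, and the multiples of the others are independent on the line, then the
  relation is divisible by that equation, and the degrees of the products and of some of the multipliers drop by one.
  To lose nothing, the monomials on the line have to be used up exactly. This forces one to split the multiples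
  of one form between the line and the residual problem, which is done by a deformation argument of first order.
*)
theory Submission
  imports Defs "HOL-Computational_Algebra.Polynomial"
begin

text \<open>"As independent as possible" is expressed by an independent subset of the products, of
  size the minimum of the number of products and the number of monomials. Injectivity and
  surjectivity are thus one statement. For n >= 4 the hypothesis at t0 passes down to all t \<le> t0
  and, as r - 1 >= 4, forces t < d; all products are then independent. For n = 3 there are r ternary
  forms but the hypothesis counts r - 1, so the products may outnumber the monomials; with r = 4
  even t >= d occurs and has its own induction.

  The price of splitting a form is that the absorbing form must have zero trace in the residual
  problem, so it cannot be used on the next line. The order in which forms are used keeps at most
  one form frozen, and always among the last in line. With four forms besides the partly used one,
  the greedy process stops when a line has 2t + 1 monomials, t being the degree of the multipliers:
  from there an alternating pattern of four forms fills every line exactly. With only three others,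
  the number of products has to be at most the number of monomials; this bound survives each
  step.\<close>

abbreviation "lookup \<equiv> Poly_Mapping.lookup"
abbreviation "single \<equiv> Poly_Mapping.single"
abbreviation "keys \<equiv> Poly_Mapping.keys"


subsection \<open>Linear independence along a line of deformations\<close>

text \<open>Independence of an indexed family rather than of a set: equal vectors at different
  indices are dependent, so \<open>card B\<close> is really a rank.\<close>

definition lin_indep :: "'b set \<Rightarrow> ('b \<Rightarrow> 's \<Rightarrow> 'k::field) \<Rightarrow> bool" where
  "lin_indep B w \<longleftrightarrow> (\<forall>c. (\<forall>s. (\<Sum>\<beta>\<in>B. c \<beta> * w \<beta> s) = 0) \<longrightarrow> (\<forall>\<beta>\<in>B. c \<beta> = 0))"

lemma lin_indepI:
  assumes "\<And>c \<beta>. (\<And>s. (\<Sum>\<beta>\<in>B. c \<beta> * w \<beta> s) = 0) \<Longrightarrow> \<beta> \<in> B \<Longrightarrow> c \<beta> = 0"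
  shows "lin_indep B w"
  using assms unfolding lin_indep_def by blast

lemma lin_indepD:
  assumes "lin_indep B w" "\<And>s. (\<Sum>\<beta>\<in>B. c \<beta> * w \<beta> s) = 0" "\<beta> \<in> B"
  shows "c \<beta> = 0"
  using assms unfolding lin_indep_def by blast

lemma lin_indep_cong:
  assumes "\<And>\<beta> s. \<beta> \<in> B \<Longrightarrow> w \<beta> s = w' \<beta> s"
  shows "lin_indep B w \<longleftrightarrow> lin_indep B w'"
  unfolding lin_indep_def using assms by (simp cong: sum.cong)

text \<open>Stated over a commutative ring because the same elimination is carried out over k and
  over k[e].\<close>

lemma elimination_sum:
  fixes w :: "'b \<Rightarrow> 's \<Rightarrow> 'r::comm_ring"
  shows "(\<Sum>\<beta>\<in>B. c \<beta> * (p * w \<beta> s - w \<beta> s0 * q)) =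
    p * (\<Sum>\<beta>\<in>B. c \<beta> * w \<beta> s) - (\<Sum>\<beta>\<in>B. c \<beta> * w \<beta> s0) * q"
  by (simp add: sum_distrib_left sum_distrib_right sum_subtractf right_diff_distrib algebra_simps)

text \<open>One step of Gaussian elimination with pivot \<open>w b s0\<close>. It avoids division,
  so entries that depend polynomially on a parameter remain polynomials. The coefficient of
  \<open>b\<close> in a relation is recovered from the coordinate \<open>s0\<close>.\<close>

lemma lin_indep_insert_pivot:
  fixes w :: "'b \<Rightarrow> 's \<Rightarrow> 'k::field"
  assumes "finite B" "b \<notin> B" "w b s0 \<noteq> 0"
  shows "lin_indep (insert b B) w \<longleftrightarrow> lin_indep B (\<lambda>\<beta> s. w b s0 * w \<beta> s - w \<beta> s0 * w b s)"
    (is "_ \<longleftrightarrow> lin_indep B ?w'")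
proof
  assume L: "lin_indep (insert b B) w"
  show "lin_indep B ?w'"
  proof (rule lin_indepI)
    fix c \<beta> assume h: "\<And>s. (\<Sum>\<beta>\<in>B. c \<beta> * ?w' \<beta> s) = 0" and \<beta>: "\<beta> \<in> B"
    define c' where "c' = (\<lambda>\<beta>. if \<beta> = b then - (\<Sum>\<beta>\<in>B. c \<beta> * w \<beta> s0) else w b s0 * c \<beta>)"
    have "(\<Sum>\<beta>\<in>insert b B. c' \<beta> * w \<beta> s) = 0" for s
    proof -
      have "(\<Sum>\<beta>\<in>B. c' \<beta> * w \<beta> s) = w b s0 * (\<Sum>\<beta>\<in>B. c \<beta> * w \<beta> s)"
        unfolding sum_distrib_left using assms(2) by (intro sum.cong) (auto simp: c'_def)
      then show ?thesis using h[of s] assms(1,2) by (simp add: elimination_sum c'_def)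
    qed
    from lin_indepD[OF L this, of \<beta>] \<beta> assms(2,3) show "c \<beta> = 0"
      by (auto simp: c'_def split: if_splits)
  qed
next
  assume L: "lin_indep B ?w'"
  show "lin_indep (insert b B) w"
  proof (rule lin_indepI)
    fix c \<beta> assume h: "\<And>s. (\<Sum>\<beta>\<in>insert b B. c \<beta> * w \<beta> s) = 0" and \<beta>: "\<beta> \<in> insert b B"
    have e: "(\<Sum>\<beta>\<in>B. c \<beta> * w \<beta> s) = - (c b * w b s)" for s
      using h[of s] assms(1,2) by (simp add: eq_neg_iff_add_eq_0 add.commute)
    have "(\<Sum>\<beta>\<in>B. c \<beta> * ?w' \<beta> s) = 0" for s
      unfolding elimination_sum e by simp
    from lin_indepD[OF L this] have B: "c \<beta> = 0" if "\<beta> \<in> B" for \<beta> using that by blast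
    then have "c b * w b s0 = 0" using e[of s0] by simp
    with B \<beta> assms(3) show "c \<beta> = 0" by auto
  qed
qed

text \<open>Elimination over k[e]: either it finds a zero row and hence a relation with polynomial
  coefficients, or every pivot is a nonzero polynomial and independence can fail only at the
  finitely many roots of the pivots.\<close>

lemma kernel_dichotomy:
  fixes w :: "'b \<Rightarrow> 's \<Rightarrow> 'k::field poly"
  assumes "finite B"
  shows "(\<exists>c. (\<exists>\<beta>\<in>B. c \<beta> \<noteq> 0) \<and> (\<forall>s. (\<Sum>\<beta>\<in>B. c \<beta> * w \<beta> s) = 0)) \<or>
         finite {e. \<not> lin_indep B (\<lambda>\<beta> s. poly (w \<beta> s) e)}"
  using assms
proof (induction B arbitrary: w)
  case empty
  then show ?case by (simp add: lin_indep_def)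
next
  case (insert b B)
  show ?case
  proof (cases "\<forall>s. w b s = 0")
    case True
    have "(\<Sum>\<beta>\<in>insert b B. (if \<beta> = b then 1 else 0) * w \<beta> s) = 0" for s
      using True by (intro sum.neutral) auto
    then show ?thesis by (intro disjI1 exI[of _ "\<lambda>\<beta>. if \<beta> = b then 1 else 0"]) auto
  next
    case False
    then obtain s0 where s0: "w b s0 \<noteq> 0" by blast
    define w' where "w' = (\<lambda>\<beta> s. w b s0 * w \<beta> s - w \<beta> s0 * w b s)"
    from insert.IH[of w'] show ?thesis
    proof
      assume "\<exists>c. (\<exists>\<beta>\<in>B. c \<beta> \<noteq> 0) \<and> (\<forall>s. (\<Sum>\<beta>\<in>B. c \<beta> * w' \<beta> s) = 0)"
      then obtain c where c: "\<exists>\<beta>\<in>B. c \<beta> \<noteq> 0" "\<And>s. (\<Sum>\<beta>\<in>B. c \<beta> * w' \<beta> s) = 0" by blast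
      define c' where "c' = (\<lambda>\<beta>. if \<beta> = b then - (\<Sum>\<beta>\<in>B. c \<beta> * w \<beta> s0) else w b s0 * c \<beta>)"
      have "(\<Sum>\<beta>\<in>insert b B. c' \<beta> * w \<beta> s) = 0" for s
      proof -
        have "(\<Sum>\<beta>\<in>B. c' \<beta> * w \<beta> s) = w b s0 * (\<Sum>\<beta>\<in>B. c \<beta> * w \<beta> s)"
          unfolding sum_distrib_left using insert.hyps by (intro sum.cong) (auto simp: c'_def)
        then show ?thesis using c(2)[of s] insert.hyps unfolding w'_def
          by (simp add: elimination_sum c'_def)
      qed
      moreover have "\<exists>\<beta>\<in>insert b B. c' \<beta> \<noteq> 0"
        using c(1) s0 insert.hyps by (auto simp: c'_def)
      ultimately show ?thesis by blast
    next
      assume f: "finite {e. \<not> lin_indep B (\<lambda>\<beta> s. poly (w' \<beta> s) e)}"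
      have "{e. \<not> lin_indep (insert b B) (\<lambda>\<beta> s. poly (w \<beta> s) e)} \<subseteq>
        {e. \<not> lin_indep B (\<lambda>\<beta> s. poly (w' \<beta> s) e)} \<union> {e. poly (w b s0) e = 0}"
        using lin_indep_insert_pivot[OF insert.hyps, where w = "\<lambda>\<beta> s. poly (w \<beta> s) e" for e]
        by (auto simp: w'_def)
      with f poly_roots_finite[OF s0] show ?thesis
        by (meson finite_Un finite_subset)
    qed
  qed
qed

text \<open>
  If \<open>v(e) = v\<^sub>0 + e v\<^sub>1 + \<dots>\<close> with \<open>v\<^sub>0 \<noteq> 0\<close> is a kernel vector of \<open>L\<^sub>0 + e L\<^sub>1\<close>, then \<open>L\<^sub>0 v\<^sub>0 = 0\<close> and
  \<open>L\<^sub>1 v\<^sub>0 + L\<^sub>0 v\<^sub>1 = 0\<close>.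
\<close>
lemma finite_deform:
  fixes p q :: "'b \<Rightarrow> 's \<Rightarrow> 'k::field"
  assumes B: "finite B"
    and inj: "\<And>c d \<beta>. (\<And>s. (\<Sum>\<beta>\<in>B. c \<beta> * p \<beta> s) = 0) \<Longrightarrow>
      (\<And>s. (\<Sum>\<beta>\<in>B. d \<beta> * p \<beta> s + c \<beta> * q \<beta> s) = 0) \<Longrightarrow> \<beta> \<in> B \<Longrightarrow> c \<beta> = 0"
  shows "finite {e. \<not> lin_indep B (\<lambda>\<beta> s. p \<beta> s + e * q \<beta> s)}"
proof -
  define w where "w = (\<lambda>\<beta> s. [:p \<beta> s, q \<beta> s:])"
  have "\<not> (\<exists>c. (\<exists>\<beta>\<in>B. c \<beta> \<noteq> 0) \<and> (\<forall>s. (\<Sum>\<beta>\<in>B. c \<beta> * w \<beta> s) = 0))"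
  proof
    assume "\<exists>c. (\<exists>\<beta>\<in>B. c \<beta> \<noteq> 0) \<and> (\<forall>s. (\<Sum>\<beta>\<in>B. c \<beta> * w \<beta> s) = 0)"
    then obtain c where c: "\<exists>\<beta>\<in>B. c \<beta> \<noteq> 0" "\<And>s. (\<Sum>\<beta>\<in>B. c \<beta> * w \<beta> s) = 0" by blast
    \<comment> \<open>The least \<open>v\<close> with \<open>P v\<close> is the order in e of the
      kernel vector. Its coefficients of e^v and e^(v+1) serve as \<open>v\<^sub>0\<close> and
      \<open>v\<^sub>1\<close>; those below e^v vanish, so the equations at these two orders have
      the required shape.\<close>
    define P where "P = (\<lambda>v. \<exists>\<beta>\<in>B. poly.coeff (c \<beta>) v \<noteq> 0)"
    have "\<exists>v. P v" using c(1) unfolding P_def by (metis leading_coeff_neq_0)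
    then have P: "P (LEAST v. P v)" by (rule LeastI_ex)
    define v where "v = (LEAST v. P v)"
    have low: "poly.coeff (c \<beta>) i = 0" if "i < v" "\<beta> \<in> B" for i \<beta>
      using not_less_Least[of i P] that unfolding v_def P_def by blast
    have cf: "poly.coeff (c \<beta> * w \<beta> s) (Suc i) = poly.coeff (c \<beta>) (Suc i) * p \<beta> s + poly.coeff (c \<beta>) i * q \<beta> s"
      "poly.coeff (c \<beta> * w \<beta> s) 0 = poly.coeff (c \<beta>) 0 * p \<beta> s" for \<beta> s i
      by (simp_all add: w_def mult.commute coeff_pCons)
    have z: "(\<Sum>\<beta>\<in>B. poly.coeff (c \<beta> * w \<beta> s) i) = 0" for s i
      using arg_cong[OF c(2)[of s], of "\<lambda>p. poly.coeff p i"] by (simp add: coeff_sum)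
    have 1: "(\<Sum>\<beta>\<in>B. poly.coeff (c \<beta>) v * p \<beta> s) = 0" for s
    proof (cases v)
      case 0
      then show ?thesis using z[of s 0] by (simp add: cf)
    next
      case (Suc i)
      have "(\<Sum>\<beta>\<in>B. poly.coeff (c \<beta> * w \<beta> s) v) = (\<Sum>\<beta>\<in>B. poly.coeff (c \<beta>) v * p \<beta> s)"
        unfolding Suc cf using low[of i] Suc by (intro sum.cong) auto
      then show ?thesis using z by simp
    qed
    have 2: "(\<Sum>\<beta>\<in>B. poly.coeff (c \<beta>) (Suc v) * p \<beta> s + poly.coeff (c \<beta>) v * q \<beta> s) = 0" for s
      using z[of s "Suc v"] unfolding cf by simp
    have "poly.coeff (c \<beta>) v = 0" if "\<beta> \<in> B" for \<beta> using inj[OF 1 2 that] .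
    then show False using P unfolding v_def P_def by blast
  qed
  with kernel_dichotomy[OF B, of w]
  have "finite {e. \<not> lin_indep B (\<lambda>\<beta> s. poly (w \<beta> s) e)}" by blast
  then show ?thesis by (simp add: w_def)
qed

corollary finite_deform_at_0:
  assumes "finite B" "lin_indep B p"
  shows "finite {e. \<not> lin_indep B (\<lambda>\<beta> s. p \<beta> s + e * q \<beta> s)}"
  using assms(1) by (rule finite_deform) (rule lin_indepD[OF assms(2)])

lemma lin_indep_scale:
  assumes "e \<noteq> 0"
  shows "lin_indep B (\<lambda>\<beta> s. e * w \<beta> s) \<longleftrightarrow> lin_indep B w"
proof -
  have "(\<Sum>\<beta>\<in>B. c \<beta> * (e * w \<beta> s)) = e * (\<Sum>\<beta>\<in>B. c \<beta> * w \<beta> s)" for c s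
    by (simp add: sum_distrib_left mult.left_commute)
  then show ?thesis using assms unfolding lin_indep_def by simp
qed

text \<open>For e \<noteq> 0 the family is e times q + e^(-1) p, a deformation of q at 0 with
  parameter e^(-1).\<close>

corollary finite_deform_at_infinity:
  assumes "finite B" "lin_indep B q"
  shows "finite {e. \<not> lin_indep B (\<lambda>\<beta> s. p \<beta> s + e * q \<beta> s)}"
proof -
  define bad where "bad = {e. \<not> lin_indep B (\<lambda>\<beta> s. q \<beta> s + e * p \<beta> s)}"
  have "finite bad" unfolding bad_def using assms by (rule finite_deform_at_0)
  moreover have "{e. \<not> lin_indep B (\<lambda>\<beta> s. p \<beta> s + e * q \<beta> s)} \<subseteq> insert 0 (inverse ` bad)"
  proof
    fix e assume e: "e \<in> {e. \<not> lin_indep B (\<lambda>\<beta> s. p \<beta> s + e * q \<beta> s)}"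
    show "e \<in> insert 0 (inverse ` bad)"
    proof (cases "e = 0")
      case False
      have "(\<lambda>\<beta> s. p \<beta> s + e * q \<beta> s) = (\<lambda>\<beta> s. e * (q \<beta> s + inverse e * p \<beta> s))"
        using False by (simp add: distrib_left flip: mult.assoc) (simp add: add.commute)
      then have "inverse e \<in> bad" using e False lin_indep_scale[OF False, of B "\<lambda>\<beta> s. q \<beta> s + inverse e * p \<beta> s"] unfolding bad_def by auto
      then show ?thesis by (metis imageI inverse_inverse_eq insertCI)
    qed simp
  qed
  ultimately show ?thesis by (meson finite_imageI finite_insert finite_subset)
qed

text \<open>The product of the pivots of a division-free elimination at \<open>x0\<close> is a
  function whose nonvanishing gives independence. Building it takes only 1, products and
  differences, so the polynomial functions can be any set closed under these.\<close>

lemma lin_indep_open: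
  fixes w :: "'b \<Rightarrow> 's \<Rightarrow> 'x \<Rightarrow> 'k::field"
  assumes "finite B"
    and one: "(\<lambda>_. 1) \<in> \<P>"
    and mult: "\<And>f g. f \<in> \<P> \<Longrightarrow> g \<in> \<P> \<Longrightarrow> (\<lambda>x. f x * g x) \<in> \<P>"
    and diff: "\<And>f g. f \<in> \<P> \<Longrightarrow> g \<in> \<P> \<Longrightarrow> (\<lambda>x. f x - g x) \<in> \<P>"
    and "\<And>\<beta> s. \<beta> \<in> B \<Longrightarrow> w \<beta> s \<in> \<P>"
    and "lin_indep B (\<lambda>\<beta> s. w \<beta> s x0)"
  shows "\<exists>D\<in>\<P>. D x0 \<noteq> 0 \<and> (\<forall>x. D x \<noteq> 0 \<longrightarrow> lin_indep B (\<lambda>\<beta> s. w \<beta> s x))"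
  using assms(1,5,6)
proof (induction B arbitrary: w)
  case empty
  then show ?case using one by (intro bexI[of _ "\<lambda>_. 1"]) (auto simp: lin_indep_def)
next
  case (insert b B)
  have "\<exists>s0. w b s0 x0 \<noteq> 0"
  proof (rule ccontr)
    assume n: "\<nexists>s0. w b s0 x0 \<noteq> 0"
    have "(\<Sum>\<beta>\<in>insert b B. (if \<beta> = b then 1 else 0) * w \<beta> s x0) = 0" for s
      using n by (intro sum.neutral) auto
    from lin_indepD[OF insert.prems(2) this, of b] show False by simp
  qed
  then obtain s0 where s0: "w b s0 x0 \<noteq> 0" by blast
  define w' where "w' = (\<lambda>\<beta> s x. w b s0 x * w \<beta> s x - w \<beta> s0 x * w b s x)"
  have "\<exists>D\<in>\<P>. D x0 \<noteq> 0 \<and> (\<forall>x. D x \<noteq> 0 \<longrightarrow> lin_indep B (\<lambda>\<beta> s. w' \<beta> s x))"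
  proof (rule insert.IH)
    show "\<And>\<beta> s. \<beta> \<in> B \<Longrightarrow> w' \<beta> s \<in> \<P>"
      unfolding w'_def using insert.prems(1) by (intro diff mult) auto
    show "lin_indep B (\<lambda>\<beta> s. w' \<beta> s x0)"
      using lin_indep_insert_pivot[OF insert.hyps, where w = "\<lambda>\<beta> s. w \<beta> s x0" and ?s0.0 = s0] s0 insert.prems(2)
      unfolding w'_def by simp
  qed
  then obtain D where D: "D \<in> \<P>" "D x0 \<noteq> 0" "\<And>x. D x \<noteq> 0 \<Longrightarrow> lin_indep B (\<lambda>\<beta> s. w' \<beta> s x)"
    by blast
  show ?case
  proof (intro bexI conjI allI impI)
    show "(\<lambda>x. D x * w b s0 x) \<in> \<P>" using D(1) insert.prems(1) by (intro mult) auto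
    show "D x0 * w b s0 x0 \<noteq> 0" using D(2) s0 by simp
    fix x assume "D x * w b s0 x \<noteq> 0"
    then show "lin_indep (insert b B) (\<lambda>\<beta> s. w \<beta> s x)"
      using lin_indep_insert_pivot[OF insert.hyps, where w = "\<lambda>\<beta> s. w \<beta> s x" and ?s0.0 = s0] D(3)[of x]
      unfolding w'_def by simp
  qed
qed


subsection \<open>Restriction to a line\<close>

text \<open>
  Ternary forms are dehomogenized: \<open>F j a i\<close> is the coefficient of \<open>x\<^sup>a y\<^sup>i\<close> in the form \<open>F\<^sub>j\<close>, and the triple
  \<open>(j, a, i)\<close> stands for the product \<open>x\<^sup>a y\<^sup>i F\<^sub>j\<close>. In \<open>good\<close> the products have degree \<open>m - 1\<close>, and the multipliers of
  \<open>F\<^sub>j\<close> have degree \<open>s j - 1\<close>, so that \<open>m\<close> and \<open>s j\<close> count the monomials on the line \<open>y = 0\<close>. The trace on this line of the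
  forms with index in \<open>Z\<close> is required to vanish.
\<close>
definition shift :: "(nat \<Rightarrow> nat \<Rightarrow> nat \<Rightarrow> 'k::zero) \<Rightarrow> nat \<times> nat \<times> nat \<Rightarrow> nat \<times> nat \<Rightarrow> 'k" where
  "shift F = (\<lambda>(j, a, i) (u, v). if a \<le> u \<and> i \<le> v then F j (u - a) (v - i) else 0)"

definition good ::
  "'k::field itself \<Rightarrow> nat \<Rightarrow> (nat \<Rightarrow> nat) \<Rightarrow> nat set \<Rightarrow> (nat \<times> nat \<times> nat) set \<Rightarrow> bool" where
  "good TYPE('k) m s Z B \<longleftrightarrow> (\<exists>F :: nat \<Rightarrow> nat \<Rightarrow> nat \<Rightarrow> 'k.
     (\<forall>j\<in>fst ` B. \<forall>x y. F j x y \<noteq> 0 \<longrightarrow> x + y + s j \<le> m) \<and>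
     (\<forall>j\<in>Z. \<forall>x. F j x 0 = 0) \<and> lin_indep B (shift F))"

text \<open>Multipliers after division by y. For j in \<open>J\<close> the multipliers have to be
  divisible by y, and dividing lowers i. For other j the form itself is divided, so the multipliers
  stay, except those with a < \<alpha> of \<open>b\<close>, which are spent on the line.\<close>

definition residue ::
  "nat set \<Rightarrow> nat \<Rightarrow> nat \<Rightarrow> (nat \<times> nat \<times> nat) set \<Rightarrow> (nat \<times> nat \<times> nat) set" where
  "residue J b \<alpha> B = {(j, a, i). if j \<in> J then (j, a, Suc i) \<in> B
     else (j, a, i) \<in> B \<and> \<not> (j = b \<and> i = 0 \<and> a < \<alpha>)}"

definition trace_part ::
  "nat set \<Rightarrow> nat \<Rightarrow> nat \<Rightarrow> (nat \<times> nat \<times> nat) set \<Rightarrow> (nat \<times> nat \<times> nat) set" where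
  "trace_part J b \<alpha> B = {(j, a, i) \<in> B. i = 0 \<and> (j \<in> J \<or> (j = b \<and> a < \<alpha>))}"

definition lift :: "nat set \<Rightarrow> nat \<times> nat \<times> nat \<Rightarrow> nat \<times> nat \<times> nat" where
  "lift J = (\<lambda>(j, a, i). if j \<in> J then (j, a, Suc i) else (j, a, i))"

lemma inj_lift: "inj_on (lift J) A"
  by (auto simp: inj_on_def lift_def split: if_splits)

lemma lift_residue:
  assumes "b \<notin> J"
  shows "lift J ` residue J b \<alpha> B = B - trace_part J b \<alpha> B"
proof (intro equalityI subsetI)
  fix \<beta> assume "\<beta> \<in> lift J ` residue J b \<alpha> B"
  then show "\<beta> \<in> B - trace_part J b \<alpha> B"
    using assms by (auto simp: lift_def residue_def trace_part_def split: if_splits)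
next
  fix \<beta> assume "\<beta> \<in> B - trace_part J b \<alpha> B"
  moreover obtain j a i where "\<beta> = (j, a, i)" by (cases \<beta>)
  ultimately have \<beta>: "\<beta> = (j, a, i)" "(j, a, i) \<in> B" "i = 0 \<Longrightarrow> j \<notin> J \<and> \<not> (j = b \<and> a < \<alpha>)"
    by (auto simp: trace_part_def)
  show "\<beta> \<in> lift J ` residue J b \<alpha> B"
  proof (cases "j \<in> J")
    case True
    with \<beta> obtain i' where "i = Suc i'" by (cases i) auto
    with \<beta> True have "(j, a, i') \<in> residue J b \<alpha> B" "\<beta> = lift J (j, a, i')"
      by (auto simp: residue_def lift_def)
    then show ?thesis by blast
  next
    case False
    with \<beta> have "(j, a, i) \<in> residue J b \<alpha> B" "\<beta> = lift J (j, a, i)"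
      by (auto simp: residue_def lift_def)
    then show ?thesis by blast
  qed
qed

lemma finite_residue:
  assumes "finite B" "b \<notin> J"
  shows "finite (residue J b \<alpha> B)"
  using lift_residue[OF assms(2), of \<alpha> B] assms(1) finite_imageD[OF _ inj_lift, of J "residue J b \<alpha> B"]
  by simp

lemma card_residue:
  assumes "finite B" "b \<notin> J"
  shows "card B = card (trace_part J b \<alpha> B) + card (residue J b \<alpha> B)"
proof -
  have "card (residue J b \<alpha> B) = card (B - trace_part J b \<alpha> B)"
    using lift_residue[OF assms(2), of \<alpha> B] card_image[OF inj_lift, of J "residue J b \<alpha> B"] by simp
  moreover have "trace_part J b \<alpha> B \<subseteq> B" by (auto simp: trace_part_def)
  ultimately show ?thesis using assms(1) 
    by (metis card_Diff_subset card_mono finite_subset le_add_diff_inverse)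
qed

text \<open>
  The forms with index in \<open>J\<close> get a nonzero trace on the line \<open>y = 0\<close>, all others are divisible
  by \<open>y\<close>. Filling the trace exactly may need a part of the row of one more form \<open>F\<^sub>b\<close>: put
  \<open>F\<^sub>b = y G + \<delta>\<close> with \<open>\<delta> \<rightarrow> 0\<close>. A relation that holds for \<open>\<delta> = 0\<close> must then satisfy a condition of first
  order on the line. It involves also the rest \<open>a \<ge> \<alpha>\<close> of the row of \<open>F\<^sub>b\<close>, which is harmless because it is
  absorbed by the multiples of \<open>F\<^sub>c\<close>, whose trace is the monomial of degree \<open>\<alpha>\<close>. This restricts \<open>F\<^sub>c\<close> in the
  residual system: there its trace must vanish.
\<close>
lemma horace:
  assumes inf: "infinite (UNIV :: 'k::field set)" and fin: "finite B"
    and p: "\<And>j a. j \<in> J \<Longrightarrow> (j, a, 0) \<in> B \<Longrightarrow> p j + s j \<le> Suc M"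
    and inj: "inj_on (\<lambda>(j, a). p j + a) {(j, a). j \<in> J \<and> (j, a, 0) \<in> B}"
    and ge: "\<And>j a. j \<in> J \<Longrightarrow> (j, a, 0) \<in> B \<Longrightarrow> \<alpha> \<le> p j + a"
    and b: "b \<notin> J" "\<alpha> > 0 \<Longrightarrow> s b \<le> Suc M" "\<alpha> > 0 \<Longrightarrow> b \<notin> Z"
    and absorb: "\<And>a. (b, a, 0) \<in> B \<Longrightarrow> 0 < \<alpha> \<Longrightarrow> \<alpha> \<le> a \<Longrightarrow>
      c \<in> J \<and> c \<in> Z1 \<and> (\<exists>a'. (c, a', 0) \<in> B \<and> a = p c + a')"
    and Z: "Z \<inter> J = {}"
    and s1: "\<And>j. j \<in> fst ` B \<Longrightarrow> j \<in> J \<Longrightarrow> s j \<le> Suc (s1 j)"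
      "\<And>j. j \<in> fst ` B \<Longrightarrow> j \<notin> J \<Longrightarrow> s j \<le> s1 j"
    and res: "good TYPE('k) M s1 Z1 (residue J b \<alpha> B)"
  shows "good TYPE('k) (Suc M) s Z B"
proof -
  define B1 where "B1 = residue J b \<alpha> B"
  have fin1: "finite B1" unfolding B1_def using fin b(1) by (rule finite_residue)
  obtain F1 :: "nat \<Rightarrow> nat \<Rightarrow> nat \<Rightarrow> 'k" where F1:
    "\<And>j x y. j \<in> fst ` B1 \<Longrightarrow> F1 j x y \<noteq> 0 \<Longrightarrow> x + y + s1 j \<le> M"
    "\<And>j x. j \<in> Z1 \<Longrightarrow> F1 j x 0 = 0" "lin_indep B1 (shift F1)"
    using res unfolding good_def B1_def by blast
  \<comment> \<open>\<open>good\<close> bounds the degree only for forms that occur in the residual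
    system; the others are replaced by 0.\<close>
  define G where "G = (\<lambda>j x y. if j \<in> fst ` B1 then F1 j x y else 0)"
  have G: "x + y + s1 j \<le> M" if "G j x y \<noteq> 0" for j x y
    using that F1(1) by (auto simp: G_def split: if_splits)
  have GZ: "G j x 0 = 0" if "j \<in> Z1" for j x using that F1(2) by (simp add: G_def)
  have Gli: "lin_indep B1 (shift G)"
    using F1(3) by (subst lin_indep_cong[where w' = "shift F1"]) (force simp: shift_def G_def)+
  \<comment> \<open>The monomial trace x^(p j). The guard keeps the degree bound for forms in
    \<open>J\<close> without products in the row y = 0, about which the assumption on
    \<open>p\<close> is silent.\<close>
  define f :: "nat \<Rightarrow> nat \<Rightarrow> 'k" where
    "f = (\<lambda>j x. if x = p j \<and> p j + s j \<le> Suc M then 1 else 0)"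
  \<comment> \<open>One parameter serves two purposes. At e = 0 the residual system is the given
    independent one; as e tends to infinity the traces of the forms in \<open>J\<close> become the
    monomials x^(p j). Each condition excludes finitely many e.\<close>
  define H where "H = (\<lambda>e j x y. G j x y + e * (if j \<in> J \<and> y = 0 then f j x else 0))"

  have "finite {e. \<not> lin_indep B1 (\<lambda>\<beta> t. shift G \<beta> t +
      e * shift (\<lambda>j x y. if j \<in> J \<and> y = 0 then f j x else 0) \<beta> t)}"
    using fin1 Gli by (rule finite_deform_at_0)
  moreover have "(\<lambda>\<beta> t. shift G \<beta> t + e * shift (\<lambda>j x y. if j \<in> J \<and> y = 0 then f j x else 0) \<beta> t)
      = shift (H e)" for e
    by (intro ext) (auto simp: shift_def H_def)
  ultimately have fin_res: "finite {e. \<not> lin_indep B1 (shift (H e))}" by simp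

  define RJ where "RJ = {(j, a). j \<in> J \<and> (j, a, 0) \<in> B}"
  \<comment> \<open>The line carries the rows of the forms in \<open>J\<close> and, at the positions
    below \<alpha>, the monomials contributed by the first-order term of F_b.\<close>
  define Rw where "Rw = RJ \<union> {b} \<times> {..<\<alpha>}"
  have finRJ: "finite RJ"
  proof -
    have "(\<lambda>(j, a). (j, a, 0)) ` RJ \<subseteq> B" by (auto simp: RJ_def)
    moreover have "inj_on (\<lambda>(j, a). (j, a, 0)) RJ" by (auto simp: inj_on_def)
    ultimately show ?thesis using fin finite_subset finite_imageD by blast
  qed
  then have finRw: "finite Rw" by (simp add: Rw_def)
  define pos where "pos = (\<lambda>(j, a). if j = b then a else p j + a)"
  define rq where "rq = (\<lambda>(j, a) u. if j \<noteq> b \<and> a \<le> u then G j (u - a) 0 else 0)"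
  define rf :: "nat \<times> nat \<Rightarrow> nat \<Rightarrow> 'k" where "rf = (\<lambda>r u. if u = pos r then 1 else 0)"
  have inj_pos: "inj_on pos Rw"
  proof (rule inj_onI)
    fix r r' assume r: "r \<in> Rw" "r' \<in> Rw" "pos r = pos r'"
    obtain j a j' a' where [simp]: "r = (j, a)" "r' = (j', a')" by (cases r; cases r') auto
    show "r = r'"
    proof (cases "j = b \<longleftrightarrow> j' = b")
      case True
      then show ?thesis using r b(1) inj_onD[OF inj, of r r']
        by (auto simp: Rw_def RJ_def pos_def split: if_splits)
    next
      case False
      then show ?thesis using r b(1) ge[of j a] ge[of j' a']
        by (auto simp: Rw_def RJ_def pos_def split: if_splits)
    qed
  qed
  have "lin_indep Rw rf"
  proof (rule lin_indepI)
    fix c r assume h: "\<And>u. (\<Sum>r\<in>Rw. c r * rf r u) = 0" and r: "r \<in> Rw"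
    have "(\<Sum>r'\<in>Rw. c r' * rf r' (pos r)) = (\<Sum>r'\<in>Rw. if r' = r then c r else 0)"
      using inj_onD[OF inj_pos] r by (intro sum.cong) (auto simp: rf_def)
    with h[of "pos r"] r finRw show "c r = 0" by simp
  qed
  with finRw have fin_row: "finite {e. \<not> lin_indep Rw (\<lambda>r u. rq r u + e * rf r u)}"
    by (rule finite_deform_at_infinity)
  obtain e where e: "e \<noteq> 0" "lin_indep B1 (shift (H e))" "lin_indep Rw (\<lambda>r u. rq r u + e * rf r u)"
    using ex_new_if_finite[OF inf, of "insert 0 ({e. \<not> lin_indep B1 (shift (H e))} \<union>
      {e. \<not> lin_indep Rw (\<lambda>r u. rq r u + e * rf r u)})"] fin_res fin_row by auto

  define F0 where "F0 = (\<lambda>j x y. if j \<in> J then H e j x y else if y = 0 then 0 else G j x (y - 1))"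
  \<comment> \<open>Dehomogenized, 1 is a power of the third variable, so x^a times this form has
    the trace x^a.\<close>
  define Q :: "nat \<Rightarrow> nat \<Rightarrow> nat \<Rightarrow> 'k" where
    "Q = (\<lambda>j x y. if j = b \<and> 0 < \<alpha> \<and> x = 0 \<and> y = 0 then 1 else 0)"
  have trace: "shift F0 (j, a, 0) (u, 0) = rq (j, a) u + e * rf (j, a) u" if "(j, a) \<in> RJ" for j a u
  proof -
    from that b(1) have j: "j \<in> J" "j \<noteq> b" and "(j, a, 0) \<in> B" by (auto simp: RJ_def)
    then have f: "f j x = (if x = p j then 1 else 0)" for x using p by (simp add: f_def)
    show ?thesis
    proof (cases "a \<le> u")
      case True
      then obtain x where "u = a + x" by (auto simp: le_iff_add)
      then show ?thesis using j by (simp add: shift_def F0_def H_def rq_def rf_def pos_def f add.commute)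
    qed (use j in \<open>auto simp: shift_def rq_def rf_def pos_def\<close>)
  qed
  have row: "(\<Sum>\<beta>\<in>B. k \<beta> * shift F0 \<beta> (u, 0)) = (\<Sum>(j, a)\<in>RJ. k (j, a, 0) * (rq (j, a) u + e * rf (j, a) u))"
    for k u
  proof -
    have "(\<Sum>(j, a)\<in>RJ. k (j, a, 0) * (rq (j, a) u + e * rf (j, a) u)) =
        (\<Sum>(j, a)\<in>RJ. k (j, a, 0) * shift F0 (j, a, 0) (u, 0))"
      using trace by (intro sum.cong) auto
    also have "\<dots> = (\<Sum>\<beta>\<in>(\<lambda>(j, a). (j, a, 0)) ` RJ. k \<beta> * shift F0 \<beta> (u, 0))"
      by (subst sum.reindex) (auto simp: inj_on_def case_prod_unfold)
    also have "\<dots> = (\<Sum>\<beta>\<in>B. k \<beta> * shift F0 \<beta> (u, 0))"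
    proof (rule sum.mono_neutral_left[OF fin])
      show "\<forall>\<beta>\<in>B - (\<lambda>(j, a). (j, a, 0)) ` RJ. k \<beta> * shift F0 \<beta> (u, 0) = 0"
        by (force simp: RJ_def shift_def F0_def)
    qed (auto simp: RJ_def)
    finally show ?thesis by simp
  qed
  have "finite {\<delta>. \<not> lin_indep B (\<lambda>\<beta> t. shift F0 \<beta> t + \<delta> * shift Q \<beta> t)}"
    using fin
  proof (rule finite_deform)
    fix k d \<beta>0
    assume k: "\<And>t. (\<Sum>\<beta>\<in>B. k \<beta> * shift F0 \<beta> t) = 0"
      and d: "\<And>t. (\<Sum>\<beta>\<in>B. d \<beta> * shift F0 \<beta> t + k \<beta> * shift Q \<beta> t) = 0"
      and \<beta>0: "\<beta>0 \<in> B"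
    \<comment> \<open>Order zero on the line: the forms outside \<open>J\<close> vanish there, and
      the rows of \<open>J\<close> are independent.\<close>
    have kJ: "k (j, a, 0) = 0" if "j \<in> J" "(j, a, 0) \<in> B" for j a
    proof -
      define k' where "k' = (\<lambda>(j, a). if j = b then 0 else k (j, a, 0))"
      have "(\<Sum>r\<in>Rw. k' r * (rq r u + e * rf r u)) = 0" for u
      proof -
        have "(\<Sum>r\<in>Rw. k' r * (rq r u + e * rf r u)) = (\<Sum>r\<in>RJ. k' r * (rq r u + e * rf r u))"
          using finRw by (intro sum.mono_neutral_right) (auto simp: Rw_def k'_def)
        also have "\<dots> = (\<Sum>(j, a)\<in>RJ. k (j, a, 0) * (rq (j, a) u + e * rf (j, a) u))"
          using b(1) by (intro sum.cong) (auto simp: k'_def RJ_def)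
        finally show ?thesis using k[of "(u, 0)"] row by simp
      qed
      from lin_indepD[OF e(3) this, of "(j, a)"] that b(1) show ?thesis
        by (auto simp: k'_def Rw_def RJ_def split: if_splits)
    qed
    have kb: "k (b, a, 0) = 0" if "a < \<alpha>" "(b, a, 0) \<in> B" for a
    proof -
      have \<alpha>: "0 < \<alpha>" using that by simp
      define A where "A = {a. (b, a, 0) \<in> B}"
      have finA: "finite A"
        using finite_imageD[of "\<lambda>a. (b, a, 0::nat)" A] finite_subset[OF _ fin, of "(\<lambda>a. (b, a, 0)) ` A"]
        by (auto simp: A_def inj_on_def)
      \<comment> \<open>Since \<open>c\<close> is in \<open>Z1\<close>, the trace of F_c is exactly
        e x^(p c). Hence each term x^a of F_b with a >= \<alpha> is 1/e times the trace of a
        multiple of F_c, and its coefficient is added to that of this multiple. The terms with a <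
        \<alpha> get the factor 1/e because \<open>Rw\<close> carries e x^a.\<close>
      define k' where "k' = (\<lambda>(j, a). if j = b then (if a \<in> A then k (b, a, 0) / e else 0) else
        d (j, a, 0) + (if j = c \<and> p c + a \<in> A \<and> \<alpha> \<le> p c + a then k (b, p c + a, 0) / e else 0))"
      have "(\<Sum>r\<in>Rw. k' r * (rq r u + e * rf r u)) = 0" for u
      proof -
        have eu: "(\<Sum>\<beta>\<in>B. k \<beta> * shift Q \<beta> (u, 0)) = (if u \<in> A then k (b, u, 0) else 0)"
        proof -
          have "(\<Sum>\<beta>\<in>B. k \<beta> * shift Q \<beta> (u, 0)) = (\<Sum>\<beta>\<in>B. if \<beta> = (b, u, 0) then k (b, u, 0) else 0)"
            using \<alpha> by (intro sum.cong) (auto simp: shift_def Q_def split: if_splits)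
          then show ?thesis using fin by (simp add: A_def)
        qed
        have 1: "(\<Sum>r\<in>{b} \<times> {..<\<alpha>}. k' r * (rq r u + e * rf r u)) = (if u \<in> A \<and> u < \<alpha> then k (b, u, 0) else 0)"
        proof -
          have "(\<Sum>r\<in>{b} \<times> {..<\<alpha>}. k' r * (rq r u + e * rf r u)) =
              (\<Sum>r\<in>{b} \<times> {..<\<alpha>}. if r = (b, u) then (if u \<in> A then k (b, u, 0) else 0) else 0)"
            using e(1) by (intro sum.cong) (auto simp: k'_def rq_def rf_def pos_def)
          then show ?thesis by simp
        qed
        have 2: "(\<Sum>r\<in>RJ. (k' r - d (fst r, snd r, 0)) * (rq r u + e * rf r u)) =
            (if u \<in> A \<and> \<alpha> \<le> u then k (b, u, 0) else 0)"
        proof (cases "\<exists>a\<in>A. \<alpha> \<le> a")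
          case False
          then show ?thesis using b(1) by (auto intro!: sum.neutral simp: k'_def RJ_def)
        next
          case True
          with absorb \<alpha> have c: "c \<in> J" "c \<in> Z1" by (auto simp: A_def)
          have "(\<Sum>r\<in>RJ. (k' r - d (fst r, snd r, 0)) * (rq r u + e * rf r u)) =
            (\<Sum>r\<in>RJ. if r = (c, u - p c) then (if u \<in> A \<and> \<alpha> \<le> u \<and> p c \<le> u then k (b, u, 0) else 0) else 0)"
          proof (rule sum.cong[OF refl])
            fix r assume r: "r \<in> RJ"
            obtain j a where ja: "r = (j, a)" by (cases r)
            with r b(1) have jb: "j \<noteq> b" by (auto simp: RJ_def)
            show "(k' r - d (fst r, snd r, 0)) * (rq r u + e * rf r u) =
              (if r = (c, u - p c) then (if u \<in> A \<and> \<alpha> \<le> u \<and> p c \<le> u then k (b, u, 0) else 0) else 0)"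
            proof (cases "j = c \<and> u = p c + a")
              case True
              then show ?thesis using jb e(1) GZ[OF c(2)] by (simp add: ja k'_def rq_def rf_def pos_def)
            next
              case False
              then have "\<not> (r = (c, u - p c) \<and> p c \<le> u)" by (auto simp: ja)
              moreover have "(k' r - d (fst r, snd r, 0)) * (rq r u + e * rf r u) = 0"
              proof (cases "j = c")
                case True
                with False have "rf r u = 0" "rq r u = 0"
                  using GZ[OF c(2)] jb by (auto simp: ja rf_def rq_def pos_def)
                then show ?thesis by simp
              qed (use jb in \<open>simp add: ja k'_def\<close>)
              ultimately show ?thesis by auto
            qed
          qed
          also have "\<dots> = (if u \<in> A \<and> \<alpha> \<le> u then k (b, u, 0) else 0)"
            using finRJ absorb[of u] \<alpha> by (auto simp: RJ_def A_def)
          finally show ?thesis .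
        qed
        have "(\<Sum>r\<in>Rw. k' r * (rq r u + e * rf r u)) =
            (\<Sum>r\<in>RJ. k' r * (rq r u + e * rf r u)) + (\<Sum>r\<in>{b} \<times> {..<\<alpha>}. k' r * (rq r u + e * rf r u))"
          unfolding Rw_def using finRJ b(1) by (intro sum.union_disjoint) (auto simp: RJ_def)
        also have "(\<Sum>r\<in>RJ. k' r * (rq r u + e * rf r u)) =
            (\<Sum>r\<in>RJ. (k' r - d (fst r, snd r, 0)) * (rq r u + e * rf r u)) +
            (\<Sum>(j, a)\<in>RJ. d (j, a, 0) * (rq (j, a) u + e * rf (j, a) u))"
          unfolding sum.distrib[symmetric] by (intro sum.cong) (auto simp: algebra_simps)
        also have "(\<Sum>(j, a)\<in>RJ. d (j, a, 0) * (rq (j, a) u + e * rf (j, a) u)) =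
            - (\<Sum>\<beta>\<in>B. k \<beta> * shift Q \<beta> (u, 0))"
          using d[of "(u, 0)"] unfolding row[symmetric] sum.distrib by (simp add: eq_neg_iff_add_eq_0)
        finally show ?thesis unfolding 1 2 eu by auto
      qed
      from lin_indepD[OF e(3) this, of "(b, a)"] that e(1) show ?thesis
        by (auto simp: k'_def Rw_def A_def)
    qed
    have kT: "k \<beta> = 0" if "\<beta> \<in> trace_part J b \<alpha> B" for \<beta>
      using that kJ kb by (auto simp: trace_part_def)
    \<comment> \<open>Off the line: the coefficients of y^(v+1) in the relation are those of y^v in
      the residual relation.\<close>
    have kB1: "k (lift J \<beta>) = 0" if "\<beta> \<in> B1" for \<beta>
    proof (rule lin_indepD[OF e(2) _ that])
      fix t :: "nat \<times> nat"
      obtain u v where t: "t = (u, v)" by (cases t)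
      have "(\<Sum>\<beta>\<in>B1. k (lift J \<beta>) * shift (H e) \<beta> (u, v)) =
          (\<Sum>\<beta>\<in>B1. k (lift J \<beta>) * shift F0 (lift J \<beta>) (u, Suc v))"
        by (intro sum.cong) (auto simp: lift_def shift_def F0_def H_def Suc_diff_le split: if_splits)
      also have "\<dots> = (\<Sum>\<beta>\<in>B - trace_part J b \<alpha> B. k \<beta> * shift F0 \<beta> (u, Suc v))"
        unfolding lift_residue[OF b(1), symmetric] B1_def by (subst sum.reindex[OF inj_lift]) simp
      also have "\<dots> = (\<Sum>\<beta>\<in>B. k \<beta> * shift F0 \<beta> (u, Suc v))"
        using fin kT by (intro sum.mono_neutral_left) auto
      finally show "(\<Sum>\<beta>\<in>B1. k (lift J \<beta>) * shift (H e) \<beta> t) = 0" using k t by simp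
    qed
    show "k \<beta>0 = 0"
    proof (cases "\<beta>0 \<in> trace_part J b \<alpha> B")
      case False
      with \<beta>0 have "\<beta>0 \<in> lift J ` B1" using lift_residue[OF b(1), of \<alpha> B] by (simp add: B1_def)
      with kB1 show ?thesis by auto
    qed (rule kT)
  qed
  then obtain \<delta> where \<delta>: "lin_indep B (\<lambda>\<beta> t. shift F0 \<beta> t + \<delta> * shift Q \<beta> t)"
    using ex_new_if_finite[OF inf] by blast
  define F where "F = (\<lambda>j x y. F0 j x y + \<delta> * Q j x y)"
  have sF: "(\<lambda>\<beta> t. shift F0 \<beta> t + \<delta> * shift Q \<beta> t) = shift F"
    by (intro ext) (auto simp: shift_def F_def)
  show ?thesis unfolding good_def
  proof (intro exI[of _ F] conjI ballI allI impI)
    show "lin_indep B (shift F)" using \<delta> unfolding sF .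
    fix j assume j: "j \<in> fst ` B"
    fix x y assume "F j x y \<noteq> 0"
    then have "F0 j x y \<noteq> 0 \<or> Q j x y \<noteq> 0" by (auto simp: F_def)
    then show "x + y + s j \<le> Suc M"
    proof
      assume q: "Q j x y \<noteq> 0"
      then show ?thesis using b(2) by (auto simp: Q_def split: if_splits)
    next
      assume h: "F0 j x y \<noteq> 0"
      show ?thesis
      proof (cases "j \<in> J")
        case True
        then have "G j x y \<noteq> 0 \<or> (y = 0 \<and> f j x \<noteq> 0)" using h by (auto simp: F0_def H_def split: if_splits)
        then show ?thesis using G[of j x y] s1(1)[OF j True] by (auto simp: f_def split: if_splits)
      next
        case False
        then have "y \<noteq> 0" "G j x (y - 1) \<noteq> 0" using h by (auto simp: F0_def split: if_splits)
        then show ?thesis using G[of j x "y - 1"] s1(2)[OF j False] by simp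
      qed
    qed
  next
    fix j x assume "j \<in> Z"
    then show "F j x 0 = 0" using Z b(3) by (auto simp: F_def F0_def Q_def)
  qed
qed

section \<open>Placing the rows of several forms on one line\<close>

lemma pack_intervals:
  fixes s :: "nat \<Rightarrow> nat"
  assumes "finite K"
  shows "\<exists>p. (\<forall>j\<in>K. l \<le> p j \<and> p j + s j \<le> l + sum s K) \<and>
    (\<forall>j\<in>K. \<forall>j'\<in>K. j \<noteq> j' \<longrightarrow> p j + s j \<le> p j' \<or> p j' + s j' \<le> p j)"
  using assms
proof (induction K)
  case (insert x K)
  then obtain p where p: "\<forall>j\<in>K. l \<le> p j \<and> p j + s j \<le> l + sum s K"
    "\<forall>j\<in>K. \<forall>j'\<in>K. j \<noteq> j' \<longrightarrow> p j + s j \<le> p j' \<or> p j' + s j' \<le> p j" by blast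
  show ?case
  proof (intro exI[of _ "p(x := l + sum s K)"] conjI ballI impI)
    fix j assume "j \<in> insert x K"
    then show "l \<le> (p(x := l + sum s K)) j" "(p(x := l + sum s K)) j + s j \<le> l + sum s (insert x K)"
      using p(1) insert.hyps by (auto simp: trans_le_add1 trans_le_add2 add.assoc)
    fix j' assume "j' \<in> insert x K" "j \<noteq> j'"
    then show "(p(x := l + sum s K)) j + s j \<le> (p(x := l + sum s K)) j' \<or>
        (p(x := l + sum s K)) j' + s j' \<le> (p(x := l + sum s K)) j"
      using p \<open>j \<in> insert x K\<close> by auto
  qed
qed simp

text \<open>The row of F_j will occupy the exponents from \<open>p j\<close> up to
  \<open>p j + s j\<close>. The absorbing form \<open>c\<close> comes directly after the first
  \<alpha> places, where the rest of the split row would continue.\<close>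

lemma pack_intervals_first:
  fixes s :: "nat \<Rightarrow> nat"
  assumes "finite K" "0 < \<alpha> \<Longrightarrow> c \<in> K"
  shows "\<exists>p. (0 < \<alpha> \<longrightarrow> p c = \<alpha>) \<and> (\<forall>j\<in>K. \<alpha> \<le> p j \<and> p j + s j \<le> \<alpha> + sum s K) \<and>
    (\<forall>j\<in>K. \<forall>j'\<in>K. j \<noteq> j' \<longrightarrow> p j + s j \<le> p j' \<or> p j' + s j' \<le> p j)"
proof (cases "0 < \<alpha>")
  case False
  then show ?thesis using pack_intervals[OF assms(1), of \<alpha> s] by blast
next
  case True
  obtain p where p: "\<forall>j\<in>K - {c}. \<alpha> + s c \<le> p j \<and> p j + s j \<le> \<alpha> + s c + sum s (K - {c})"
    "\<forall>j\<in>K - {c}. \<forall>j'\<in>K - {c}. j \<noteq> j' \<longrightarrow> p j + s j \<le> p j' \<or> p j' + s j' \<le> p j"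
    using pack_intervals[of "K - {c}" "\<alpha> + s c" s] assms(1) by auto
  have "sum s K = s c + sum s (K - {c})" using assms True by (simp add: sum.remove)
  then have q: "\<alpha> \<le> (p(c := \<alpha>)) j" "(p(c := \<alpha>)) j + s j \<le> \<alpha> + sum s K" if "j \<in> K" for j
    using p(1) that by (cases "j = c"; force)+
  have "(p(c := \<alpha>)) j + s j \<le> (p(c := \<alpha>)) j' \<or> (p(c := \<alpha>)) j' + s j' \<le> (p(c := \<alpha>)) j"
    if "j \<in> K" "j' \<in> K" "j \<noteq> j'" for j j'
    using p that by (cases "j = c"; cases "j' = c") auto
  with q show ?thesis by (intro exI[of _ "p(c := \<alpha>)"]) auto
qed

lemma card_trace_part:
  fixes s :: "nat \<Rightarrow> nat"
  assumes "finite K" "b \<notin> K" "b1 \<notin> insert b (K \<union> E)"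
    and "\<And>j a. j \<in> K \<Longrightarrow> (j, a, 0) \<in> B \<longleftrightarrow> a < s j"
    and "\<And>a. (b, a, 0) \<in> B \<longleftrightarrow> \<kappa> \<le> a \<and> a < s b"
    and "\<And>j a. j \<in> E \<Longrightarrow> (j, a, 0) \<notin> B"
    and "\<And>a. a < \<alpha> \<Longrightarrow> (b1, a, 0) \<in> B"
  shows "card (trace_part (insert b (K \<union> E)) b1 \<alpha> B) = \<alpha> + sum s K + (s b - \<kappa>)"
proof -
  define R where "R = (\<lambda>j. if j = b1 then {..<\<alpha>} else if j = b then {\<kappa>..<s b} else {..<s j})"
  have "trace_part (insert b (K \<union> E)) b1 \<alpha> B = (\<lambda>(j, a). (j, a, 0)) ` Sigma (insert b1 (insert b K)) R"
  proof -
    have "(j, a, i) \<in> trace_part (insert b (K \<union> E)) b1 \<alpha> B \<longleftrightarrow>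
        i = 0 \<and> j \<in> insert b1 (insert b K) \<and> a \<in> R j" for j a i
    proof (cases "i = 0")
      case [simp]: True
      consider "j = b1" | "j = b" | "j \<in> K" | "j \<in> E" "j \<noteq> b" "j \<notin> K" | "j \<notin> insert b1 (insert b (K \<union> E))"
        by blast
      then show ?thesis
      proof cases
        case 1
        then show ?thesis using assms(3) assms(7)[of a] by (auto simp: trace_part_def R_def)
      next
        case 2
        then show ?thesis using assms(3) assms(5)[of a] by (auto simp: trace_part_def R_def)
      next
        case 3
        then have "j \<noteq> b" "j \<noteq> b1" using assms(2,3) by auto
        then show ?thesis using assms(4)[OF 3, of a] 3 by (simp add: trace_part_def R_def)
      next
        case 4
        then have "j \<noteq> b1" using assms(3) by auto
        then show ?thesis using assms(6)[of j a] 4 by (simp add: trace_part_def)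
      qed (simp add: trace_part_def)
    qed (simp add: trace_part_def)
    then show ?thesis by (auto simp: image_iff)
  qed
  then have "card (trace_part (insert b (K \<union> E)) b1 \<alpha> B) = card (Sigma (insert b1 (insert b K)) R)"
    by (simp add: card_image inj_on_def)
  also have "\<dots> = (\<Sum>j\<in>insert b1 (insert b K). card (R j))"
    using assms(1) by (intro card_SigmaI) (auto simp: R_def)
  also have "\<dots> = \<alpha> + ((s b - \<kappa>) + (\<Sum>j\<in>K. card (R j)))"
    using assms(1-3) by (simp add: R_def)
  also have "(\<Sum>j\<in>K. card (R j)) = sum s K"
    using assms(2,3) by (intro sum.cong) (auto simp: R_def)
  finally show ?thesis by simp
qed

text \<open>Here \<open>b\<close> was split on an earlier line and has the multipliers \<kappa>
  \<le> a < \<open>s b\<close> left, while \<open>b1\<close> is the form split now. The forms in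
  \<open>E\<close> have nothing left in the row y = 0; putting them into the set with nonzero trace
  lets their multipliers drop. An independent part \<open>B1\<close> of the residual system is
  enough, because the trace part together with the lift of \<open>B1\<close> has exactly
  \<open>B1\<close> as its residue.\<close>

lemma fill:
  fixes K E :: "nat set"
  assumes inf: "infinite (UNIV :: 'k::field set)" and fin: "finite B" "finite K"
    and b: "b \<notin> K" "b1 \<notin> insert b (K \<union> E)"
    and rows: "\<And>j a. j \<in> K \<Longrightarrow> (j, a, 0) \<in> B \<longleftrightarrow> a < s j"
      "\<And>a. (b, a, 0) \<in> B \<longleftrightarrow> \<kappa> \<le> a \<and> a < s b" "\<And>j a. j \<in> E \<Longrightarrow> (j, a, 0) \<notin> B"
    and \<kappa>: "\<kappa> \<le> s b" "s b \<le> Suc m"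
    and brk: "0 < \<alpha> \<Longrightarrow> b1 \<notin> Z \<and> s b1 \<le> Suc m \<and> c \<in> K \<and> c \<in> Z1 \<and>
      (\<forall>a. (b1, a, 0) \<in> B \<longleftrightarrow> a < s b1) \<and> \<alpha> \<le> s b1 \<and> s b1 \<le> \<alpha> + s c"
    and Z: "Z \<inter> insert b (K \<union> E) = {}"
    and s1: "\<And>j a i. (j, a, i) \<in> B \<Longrightarrow> j \<in> insert b (K \<union> E) \<Longrightarrow> s j \<le> Suc (s1 j)"
      "\<And>j a i. (j, a, i) \<in> B \<Longrightarrow> j \<notin> insert b (K \<union> E) \<Longrightarrow> s j \<le> s1 j"
    and total: "\<alpha> + sum s K + (s b - \<kappa>) \<le> Suc m"
    and B1: "B1 \<subseteq> residue (insert b (K \<union> E)) b1 \<alpha> B" "good TYPE('k) m s1 Z1 B1"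
  shows "\<exists>B'\<subseteq>B. good TYPE('k) (Suc m) s Z B' \<and> card B' = \<alpha> + sum s K + (s b - \<kappa>) + card B1"
proof -
  define J where "J b = insert b (K \<union> E)" for b
  note b = b[folded J_def] and Z = Z[folded J_def] and s1 = s1[folded J_def] and B1 = B1[folded J_def]
  have T: "card (trace_part (J b) b1 \<alpha> B) = \<alpha> + sum s K + (s b - \<kappa>)"
    unfolding J_def
  proof (rule card_trace_part[OF fin(2) b[unfolded J_def] rows])
    show "\<And>a. a < \<alpha> \<Longrightarrow> (b1, a, 0) \<in> B" using brk by auto
  qed auto
  define B' where "B' = trace_part (J b) b1 \<alpha> B \<union> lift (J b) ` B1"
  have sub: "trace_part (J b) b1 \<alpha> B \<subseteq> B" by (auto simp: trace_part_def)
  have lB1: "lift (J b) ` B1 \<subseteq> B - trace_part (J b) b1 \<alpha> B"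
    using B1(1) lift_residue[OF b(2), of \<alpha> B] by blast
  with sub have B': "B' \<subseteq> B" by (auto simp: B'_def)
  then have fin': "finite B'" using fin(1) finite_subset by blast
  have "card B' = card (trace_part (J b) b1 \<alpha> B) + card (lift (J b) ` B1)"
    unfolding B'_def using lB1 sub fin(1)
    by (intro card_Un_disjoint) (auto intro: finite_subset)
  then have card: "card B' = card (trace_part (J b) b1 \<alpha> B) + card B1"
    by (simp add: card_image[OF inj_lift])
  have tr: "trace_part (J b) b1 \<alpha> B' = trace_part (J b) b1 \<alpha> B"
    using lB1 sub by (auto simp: B'_def trace_part_def)
  have "lift (J b) ` residue (J b) b1 \<alpha> B' = lift (J b) ` B1"
    unfolding lift_residue[OF b(2)] tr using lB1 by (auto simp: B'_def)
  then have res': "residue (J b) b1 \<alpha> B' = B1"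
    using inj_lift[of "J b" UNIV] by (simp add: inj_image_eq_iff)
  have mem: "(j, a, 0) \<in> B' \<longleftrightarrow> (j, a, 0) \<in> B" if "j \<in> J b" for j a
  proof
    assume "(j, a, 0) \<in> B"
    with that show "(j, a, 0) \<in> B'" by (auto simp: B'_def trace_part_def)
  qed (use B' in blast)
  have "0 < \<alpha> \<Longrightarrow> c \<in> K" using brk by blast
  from pack_intervals_first[OF fin(2) this, where s = s] obtain p0 where
    p0': "(0 < \<alpha> \<longrightarrow> p0 c = \<alpha>) \<and> (\<forall>j\<in>K. \<alpha> \<le> p0 j \<and> p0 j + s j \<le> \<alpha> + sum s K) \<and>
    (\<forall>j\<in>K. \<forall>j'\<in>K. j \<noteq> j' \<longrightarrow> p0 j + s j \<le> p0 j' \<or> p0 j' + s j' \<le> p0 j)" ..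
  have p0: "0 < \<alpha> \<Longrightarrow> p0 c = \<alpha>" "\<And>j. j \<in> K \<Longrightarrow> \<alpha> \<le> p0 j \<and> p0 j + s j \<le> \<alpha> + sum s K"
    "\<And>j j'. j \<in> K \<Longrightarrow> j' \<in> K \<Longrightarrow> j \<noteq> j' \<Longrightarrow> p0 j + s j \<le> p0 j' \<or> p0 j' + s j' \<le> p0 j"
    using p0' by auto
  \<comment> \<open>The remaining row of \<open>b\<close> is pushed to the right end of the line:
    its last multiplier, \<open>s b - 1\<close>, goes to the exponent m.\<close>
  define p where "p = p0(b := Suc m - s b)"
  have JK: "j = b \<or> j \<in> K" if "j \<in> J b" "(j, a, 0) \<in> B" for j a
    using that rows(3)[of j a] by (auto simp: J_def)
  have pb: "\<alpha> + sum s K \<le> p b + a \<and> p b + s b = Suc m" if "(b, a, 0) \<in> B" for a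
    using that[unfolded rows(2)] \<kappa> total unfolding p_def fun_upd_same by arith
  have pK: "p j = p0 j" if "j \<in> K" for j using that b(1) by (auto simp: p_def)
  have "good TYPE('k) (Suc m) s Z B'"
  proof (rule horace[OF inf fin', where J = "J b" and b = b1 and p = p and \<alpha> = \<alpha> and c = c and ?Z1.0 = Z1 and ?s1.0 = s1])
    show "p j + s j \<le> Suc m" if "j \<in> J b" "(j, a, 0) \<in> B'" for j a
    proof -
      from that mem have m: "(j, a, 0) \<in> B" by blast
      from JK[OF that(1) m] show ?thesis
      proof
        assume "j = b"
        then show ?thesis using pb[of a] m by simp
      next
        assume "j \<in> K"
        then show ?thesis using p0(2)[of j] pK[of j] total by simp
      qed
    qed
    show "inj_on (\<lambda>(j, a). p j + a) {(j, a). j \<in> J b \<and> (j, a, 0) \<in> B'}"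
    proof (rule inj_onI)
      fix r r' assume r: "r \<in> {(j, a). j \<in> J b \<and> (j, a, 0) \<in> B'}" "r' \<in> {(j, a). j \<in> J b \<and> (j, a, 0) \<in> B'}"
        "(\<lambda>(j, a). p j + a) r = (\<lambda>(j, a). p j + a) r'"
      obtain j a j' a' where [simp]: "r = (j, a)" "r' = (j', a')" by (cases r; cases r') auto
      have m: "(j, a, 0) \<in> B" "(j', a', 0) \<in> B" and jj: "j = b \<or> j \<in> K" "j' = b \<or> j' \<in> K"
        and e: "p j + a = p j' + a'"
        using r mem JK by auto
      have K: "p i + x < \<alpha> + sum s K \<and> p i + x < p i + s i" if "i \<in> K" "(i, x, 0) \<in> B" for i x
        using that(2)[unfolded rows(1)[OF that(1)]] p0(2)[OF that(1)] pK[OF that(1)] by auto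
      have "j = j'"
      proof (rule ccontr)
        assume ne: "j \<noteq> j'"
        consider "j \<in> K" "j' \<in> K" | "j = b" "j' \<in> K" | "j \<in> K" "j' = b" using jj ne by blast
        then show False
        proof cases
          case 1
          then show False using p0(3)[OF 1 ne] e K[OF 1(1) m(1)] K[OF 1(2) m(2)] pK[OF 1(1)] pK[OF 1(2)]
            by linarith
        next
          case 2
          then show False using e K[OF 2(2) m(2)] pb[of a] m(1) by simp
        next
          case 3
          then show False using e K[OF 3(1) m(1)] pb[of a'] m(2) by simp
        qed
      qed
      with e show "r = r'" by simp
    qed
    show "\<alpha> \<le> p j + a" if "j \<in> J b" "(j, a, 0) \<in> B'" for j a
    proof -
      from that mem have m: "(j, a, 0) \<in> B" by blast
      from JK[OF that(1) m] show ?thesis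
      proof
        assume "j = b"
        then show ?thesis using pb[of a] m by simp
      next
        assume "j \<in> K"
        then show ?thesis using p0(2)[of j] pK[of j] by simp
      qed
    qed
    show "c \<in> J b \<and> c \<in> Z1 \<and> (\<exists>a'. (c, a', 0) \<in> B' \<and> a = p c + a')"
      if "(b1, a, 0) \<in> B'" "0 < \<alpha>" "\<alpha> \<le> a" for a
    proof -
      have c: "c \<in> K" "c \<in> J b" "c \<in> Z1" "\<forall>a<s c. (c, a, 0) \<in> B" "a < \<alpha> + s c"
        using brk[OF that(2)] rows(1) B' that(1) by (auto simp: J_def)
      moreover have "p c = \<alpha>" using pK[OF c(1)] p0(1)[OF that(2)] by simp
      moreover have "(c, a - \<alpha>, 0) \<in> B'" using c mem[OF c(2)] that(3) by auto
      ultimately show ?thesis using that(3) by (auto intro!: exI[of _ "a - \<alpha>"])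
    qed
    show "s j \<le> Suc (s1 j)" if "j \<in> fst ` B'" "j \<in> J b" for j using s1(1)[of j] that B' by force
    show "s j \<le> s1 j" if "j \<in> fst ` B'" "j \<notin> J b" for j using s1(2)[of j] that B' by force
    show "good TYPE('k) m s1 Z1 (residue (J b) b1 \<alpha> B')" unfolding res' by (rule B1(2))
  next
    show "b1 \<notin> J b" by (rule b(2))
    show "0 < \<alpha> \<Longrightarrow> s b1 \<le> Suc m" "0 < \<alpha> \<Longrightarrow> b1 \<notin> Z" using brk by blast+
    show "Z \<inter> J b = {}" by (rule Z)
  qed
  with B' card T show ?thesis by auto
qed

subsection \<open>Four forms\<close>

definition tri :: "nat \<Rightarrow> nat \<Rightarrow> (nat \<times> nat \<times> nat) set" where
  "tri j s = {(j', a, i). j' = j \<and> a + i < s}"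

lemma triangle_Suc: "Suc (Suc m) choose 2 = Suc m + (Suc m choose 2)"
  by (simp add: numeral_2_eq_2)

lemma twice_triangle: "2 * (Suc m choose 2) = m * Suc m"
  by (induction m) (simp_all add: triangle_Suc)

lemma card_tri_region: "finite {(a, i). a + i < (s::nat)} \<and> card {(a, i). a + i < s} = Suc s choose 2"
proof (induction s)
  case (Suc s)
  have "{(a, i). a + i < Suc s} = {(a, i). a + i < s} \<union> (\<lambda>a. (a, s - a)) ` {..s}"
    by (auto simp: image_iff)
  moreover have "{(a, i). a + i < s} \<inter> (\<lambda>a. (a, s - a)) ` {..s} = {}" by auto
  moreover have "card ((\<lambda>a. (a, s - a)) ` {..s}) = Suc s" by (simp add: card_image inj_on_def)
  ultimately show ?case using Suc by (simp add: card_Un_disjoint triangle_Suc)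
qed simp

lemma tri_eq: "tri j s = Pair j ` {(a, i). a + i < s}"
  by (auto simp: tri_def)

lemma finite_tri [simp]: "finite (tri j s)"
  unfolding tri_eq using card_tri_region by blast

text \<open>\<open>Suc m choose 2\<close> is the number of ternary monomials of degree m - 1, the
  degree of the products.\<close>

definition maxrank ::
  "'k::field itself \<Rightarrow> nat \<Rightarrow> (nat \<Rightarrow> nat) \<Rightarrow> nat set \<Rightarrow> (nat \<times> nat \<times> nat) set \<Rightarrow> bool" where
  "maxrank TYPE('k) m s Z B \<longleftrightarrow>
     (\<exists>B'\<subseteq>B. good TYPE('k) m s Z B' \<and> min (card B) (Suc m choose 2) \<le> card B')"

definition covers ::
  "'k::field itself \<Rightarrow> nat \<Rightarrow> (nat \<Rightarrow> nat) \<Rightarrow> nat set \<Rightarrow> (nat \<times> nat \<times> nat) set \<Rightarrow> bool" where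
  "covers TYPE('k) m s Z B \<longleftrightarrow>
     (\<exists>B'\<subseteq>B. good TYPE('k) m s Z B' \<and> Suc m choose 2 \<le> card B')"

lemma covers_mono: "covers TYPE('k::field) m s Z A \<Longrightarrow> A \<subseteq> B \<Longrightarrow> covers TYPE('k) m s Z B"
  unfolding covers_def by blast

lemma covers_imp_maxrank: "covers TYPE('k::field) m s Z B \<Longrightarrow> maxrank TYPE('k) m s Z B"
  unfolding covers_def maxrank_def by (meson min.coboundedI2)

lemma good_empty: "good TYPE('k::field) m s Z {}"
  unfolding good_def by (intro exI[of _ "\<lambda>_ _ _. 0"]) (auto simp: lin_indep_def)

lemma step_covers:
  fixes K E :: "nat set"
  assumes inf: "infinite (UNIV :: 'k::field set)" and fin: "finite B" "finite K"
    and b: "b \<notin> K" "b1 \<notin> insert b (K \<union> E)"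
    and rows: "\<And>j a. j \<in> K \<Longrightarrow> (j, a, 0) \<in> B \<longleftrightarrow> a < s j"
      "\<And>a. (b, a, 0) \<in> B \<longleftrightarrow> \<kappa> \<le> a \<and> a < s b" "\<And>j a. j \<in> E \<Longrightarrow> (j, a, 0) \<notin> B"
    and \<kappa>: "\<kappa> \<le> s b" "s b \<le> Suc m"
    and brk: "0 < \<alpha> \<Longrightarrow> b1 \<notin> Z \<and> s b1 \<le> Suc m \<and> c \<in> K \<and> c \<in> Z1 \<and>
      (\<forall>a. (b1, a, 0) \<in> B \<longleftrightarrow> a < s b1) \<and> \<alpha> \<le> s b1 \<and> s b1 \<le> \<alpha> + s c"
    and Z: "Z \<inter> insert b (K \<union> E) = {}"
    and s1: "\<And>j a i. (j, a, i) \<in> B \<Longrightarrow> j \<in> insert b (K \<union> E) \<Longrightarrow> s j \<le> Suc (s1 j)"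
      "\<And>j a i. (j, a, i) \<in> B \<Longrightarrow> j \<notin> insert b (K \<union> E) \<Longrightarrow> s j \<le> s1 j"
    and res: "covers TYPE('k) m s1 Z1 (residue (insert b (K \<union> E)) b1 \<alpha> B)"
    and total: "\<alpha> + sum s K + (s b - \<kappa>) = Suc m"
  shows "covers TYPE('k) (Suc m) s Z B"
proof -
  obtain B1 where B1: "B1 \<subseteq> residue (insert b (K \<union> E)) b1 \<alpha> B" "good TYPE('k) m s1 Z1 B1"
    "Suc m choose 2 \<le> card B1"
    using res unfolding covers_def by blast
  have le: "\<alpha> + sum s K + (s b - \<kappa>) \<le> Suc m" using total by simp
  have "\<exists>B'\<subseteq>B. good TYPE('k) (Suc m) s Z B' \<and> card B' = \<alpha> + sum s K + (s b - \<kappa>) + card B1"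
    by (rule fill[OF inf fin b, where c = c and ?Z1.0 = Z1 and ?s1.0 = s1]; fact)
  then obtain B' where "B' \<subseteq> B" "good TYPE('k) (Suc m) s Z B'"
    "card B' = \<alpha> + sum s K + (s b - \<kappa>) + card B1" by blast
  with B1(3) total have "Suc (Suc m) choose 2 \<le> card B'" unfolding triangle_Suc by linarith
  with \<open>B' \<subseteq> B\<close> \<open>good TYPE('k) (Suc m) s Z B'\<close> show ?thesis unfolding covers_def by blast
qed

lemma ex_fresh:
  fixes A :: "nat set"
  assumes "finite A"
  shows "\<exists>x. x \<notin> A"
  using assms ex_new_if_finite infinite_UNIV_nat by blast

text \<open>
  Two of the forms at a time fill a row exactly: the sizes \<open>T, T, T, T - 1\<close> on \<open>2T\<close> rows become
  \<open>T, T - 1, T - 1, T - 1\<close> on \<open>2T - 1\<close> rows, and these become \<open>T - 1, T - 1, T - 1, T - 2\<close>.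
\<close>
lemma covers_four:
  assumes inf: "infinite (UNIV :: 'k::field set)"
  shows "\<And>x1 x2 x3 x4 s V. \<lbrakk>distinct [x1, x2, x3, x4]; s x1 = T; s x2 = T; s x3 = T;
      s x4 = T - 1 \<and> V = tri x4 (T - 1) \<or> s x4 = T \<and> V = {(j, a, i) \<in> tri x4 T. 0 < i}\<rbrakk> \<Longrightarrow>
      covers TYPE('k) (2 * T) s {} (tri x1 T \<union> tri x2 T \<union> tri x3 T \<union> V)"
proof (induction T)
  case 0
  then have "tri x1 0 \<union> tri x2 0 \<union> tri x3 0 \<union> V = {}" by (auto simp: tri_def)
  moreover have "covers TYPE('k) 0 s {} {}" using good_empty unfolding covers_def by auto
  ultimately show ?case by simp
next
  case (Suc T)
  have mid: "covers TYPE('k) (Suc (2 * T)) s {} (tri y1 (Suc T) \<union> tri y2 T \<union> tri y3 T \<union> tri y4 T)"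
    if d: "distinct [y1, y2, y3, y4]" and s: "s y1 = Suc T" "s y2 = T" "s y3 = T" "s y4 = T" for y1 y2 y3 y4 s
  proof -
    \<comment> \<open>A fresh index in the place of the form to be split; with \<alpha> = 0 no form
      is split.\<close>
    obtain f where f: "f \<notin> {y1, y2, y3, y4}" using ex_fresh[of "{y1, y2, y3, y4}"] by auto
    define B where "B = tri y1 (Suc T) \<union> tri y2 T \<union> tri y3 T \<union> tri y4 T"
    have r: "residue (insert y1 ({y2} \<union> {})) f 0 B = tri y1 T \<union> tri y3 T \<union> tri y4 T \<union> tri y2 (T - 1)"
      using d f by (auto simp: residue_def B_def tri_def less_diff_conv split: if_splits)
    show ?thesis
      unfolding B_def[symmetric]
    proof (rule step_covers[OF inf, where b = y1 and K = "{y2}" and E = "{}" and ?b1.0 = f and \<kappa> = 0 and \<alpha> = 0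
          and ?Z1.0 = "{}" and ?s1.0 = "s(y1 := T, y2 := T - 1)"])
      show "covers TYPE('k) (2 * T) (s(y1 := T, y2 := T - 1)) {} (residue (insert y1 ({y2} \<union> {})) f 0 B)"
        unfolding r by (rule Suc.IH) (use d s in auto)
    next
      show "finite B" by (simp add: B_def)
      show "\<And>j a. j \<in> {y2} \<Longrightarrow> (j, a, 0) \<in> B \<longleftrightarrow> a < s j"
        "\<And>a. (y1, a, 0) \<in> B \<longleftrightarrow> 0 \<le> a \<and> a < s y1"
        using d s by (auto simp: B_def tri_def)
      fix j a i assume "(j, a, i) \<in> B"
      then have "j = y1 \<or> j = y2 \<or> j = y3 \<or> j = y4" by (auto simp: B_def tri_def)
      then show "j \<in> insert y1 ({y2} \<union> {}) \<Longrightarrow> s j \<le> Suc ((s(y1 := T, y2 := T - 1)) j)"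
        "j \<notin> insert y1 ({y2} \<union> {}) \<Longrightarrow> s j \<le> (s(y1 := T, y2 := T - 1)) j"
        using d s by auto
    qed (use d s f in auto)
  qed
  obtain f where f: "f \<notin> {x1, x2, x3, x4}" using ex_fresh[of "{x1, x2, x3, x4}"] by auto
  define B where "B = tri x1 (Suc T) \<union> tri x2 (Suc T) \<union> tri x3 (Suc T) \<union> V"
  \<comment> \<open>In the second alternative \<open>x4\<close> has an emptied row at the nominal
    size Suc T; membership in \<open>E\<close> brings it down to T. In the first alternative it
    already has the size T.\<close>
  define E where "E = (if s x4 = Suc T then {x4} else {})"
  have "V \<subseteq> tri x4 (Suc T)" using Suc.prems(5) by (elim disjE) (auto simp: tri_def)
  then have V: "finite V" by (rule finite_subset) simp
  have r: "residue (insert x1 ({x2} \<union> E)) f 0 B = tri x3 (Suc T) \<union> tri x1 T \<union> tri x2 T \<union> tri x4 T"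
    using Suc.prems(5)
  proof
    assume V4: "s x4 = Suc T - 1 \<and> V = tri x4 (Suc T - 1)"
    then have "E = {}" "V = tri x4 T" by (auto simp: E_def)
    then show ?thesis using Suc.prems(1) by (auto simp: residue_def B_def tri_def split: if_splits)
  next
    assume V4: "s x4 = Suc T \<and> V = {(j, a, i) \<in> tri x4 (Suc T). 0 < i}"
    then have "E = {x4}" by (auto simp: E_def)
    then show ?thesis using Suc.prems(1) V4 by (auto simp: residue_def B_def tri_def split: if_splits)
  qed
  have "covers TYPE('k) (Suc (Suc (2 * T))) s {} B"
  proof (rule step_covers[OF inf, where b = x1 and K = "{x2}" and E = E and ?b1.0 = f and \<kappa> = 0 and \<alpha> = 0
        and ?Z1.0 = "{}" and ?s1.0 = "s(x1 := T, x2 := T, x4 := T)"])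
    show "covers TYPE('k) (Suc (2 * T)) (s(x1 := T, x2 := T, x4 := T)) {} (residue (insert x1 ({x2} \<union> E)) f 0 B)"
      unfolding r by (rule mid) (use Suc.prems in auto)
  next
    show "finite B" using V by (simp add: B_def)
    show "\<And>j a. j \<in> {x2} \<Longrightarrow> (j, a, 0) \<in> B \<longleftrightarrow> a < s j"
      "\<And>a. (x1, a, 0) \<in> B \<longleftrightarrow> 0 \<le> a \<and> a < s x1"
      "\<And>j a. j \<in> E \<Longrightarrow> (j, a, 0) \<notin> B"
      using Suc.prems by (auto simp: B_def E_def tri_def split: if_splits)
    fix j a i assume "(j, a, i) \<in> B"
    then have "j = x1 \<or> j = x2 \<or> j = x3 \<or> j = x4" using Suc.prems(5) by (auto simp: B_def tri_def)
    then show "j \<in> insert x1 ({x2} \<union> E) \<Longrightarrow> s j \<le> Suc ((s(x1 := T, x2 := T, x4 := T)) j)"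
      "j \<notin> insert x1 ({x2} \<union> E) \<Longrightarrow> s j \<le> (s(x1 := T, x2 := T, x4 := T)) j"
      using Suc.prems by (auto simp: E_def)
  next
    show "x1 \<notin> {x2}" using Suc.prems(1) by simp
    show "f \<notin> insert x1 ({x2} \<union> E)" using f by (auto simp: E_def)
    show "s x1 \<le> Suc (Suc (2 * T))" "0 + sum s {x2} + (s x1 - 0) = Suc (Suc (2 * T))"
      using Suc.prems(2,3) by auto
  qed simp_all
  then show ?case by (simp add: B_def)
qed

text \<open>A final line of 2t + 1 monomials takes t + 1 from \<open>x\<close> and the last t from
  \<open>y1\<close>. Those of \<open>y2\<close>, \<open>y3\<close> that have size t + 1 drop to t
  without being used, so that the rest is the pattern of \<open>covers_four\<close>.\<close>

lemma covers_four_mixed: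
  assumes inf: "infinite (UNIV :: 'k::field set)"
    and d: "distinct [x, y1, y2, y3]" and s: "s x = Suc t" "\<And>y. y \<in> {y1, y2, y3} \<Longrightarrow> s y = t \<or> s y = Suc t"
    and Z: "Z \<inter> {x, y1, y2, y3} = {}"
    and B: "tri x (Suc t) \<subseteq> B" "\<And>a i. a + i < s y1 \<Longrightarrow> (i = 0 \<Longrightarrow> s y1 \<le> t + a) \<Longrightarrow> (y1, a, i) \<in> B"
      "\<And>y a i. y \<in> {y2, y3} \<Longrightarrow> a + i < s y \<Longrightarrow> (s y = Suc t \<Longrightarrow> 0 < i) \<Longrightarrow> (y, a, i) \<in> B"
  shows "covers TYPE('k) (Suc (2 * t)) s Z B"
proof -
  define C where "C = tri x (Suc t) \<union> {(j, a, i). j = y1 \<and> a + i < s y1 \<and> (i = 0 \<longrightarrow> s y1 \<le> t + a)} \<union>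
    {(j, a, i). j \<in> {y2, y3} \<and> a + i < s j \<and> (s j = Suc t \<longrightarrow> 0 < i)}"
  have CB: "C \<subseteq> B" using B by (auto simp: C_def)
  have "C \<subseteq> tri x (s x) \<union> tri y1 (s y1) \<union> tri y2 (s y2) \<union> tri y3 (s y3)" using s(1) by (auto simp: C_def tri_def)
  then have fin: "finite C" by (rule finite_subset) simp
  define E where "E = {y \<in> {y2, y3}. s y = Suc t}"
  obtain f where f: "f \<notin> {x, y1, y2, y3}" using ex_fresh[of "{x, y1, y2, y3}"] by auto
  define V where "V = (if s y1 = t then tri y1 (t - 1) else {(j, a, i) \<in> tri y1 t. 0 < i})"
  define s1 where "s1 = s(x := t, y2 := t, y3 := t, y1 := (if s y1 = t then t - 1 else t))"
  have "covers TYPE('k) (2 * t) s1 {} (tri x t \<union> tri y2 t \<union> tri y3 t \<union> V)"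
    by (rule covers_four[OF inf]) (use d s in \<open>auto simp: s1_def V_def\<close>)
  moreover have "tri x t \<union> tri y2 t \<union> tri y3 t \<union> V \<subseteq> residue (insert y1 ({x} \<union> E)) f 0 C"
  proof -
    have "tri x t \<subseteq> residue (insert y1 ({x} \<union> E)) f 0 C" using d by (auto simp: residue_def C_def tri_def)
    moreover have "V \<subseteq> residue (insert y1 ({x} \<union> E)) f 0 C"
      using d s(2)[of y1] by (auto simp: residue_def C_def tri_def V_def split: if_splits)
    moreover have "tri y t \<subseteq> residue (insert y1 ({x} \<union> E)) f 0 C" if "y \<in> {y2, y3}" for y
    proof -
      have "y \<noteq> x" "y \<noteq> y1" using d that by auto
      then show ?thesis using s(2)[of y] that
        by (cases "s y = t") (auto simp: residue_def C_def tri_def E_def)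
    qed
    ultimately show ?thesis by blast
  qed
  ultimately have res: "covers TYPE('k) (2 * t) s1 {} (residue (insert y1 ({x} \<union> E)) f 0 C)"
    by (rule covers_mono)
  have "covers TYPE('k) (Suc (2 * t)) s Z C"
  proof (rule step_covers[OF inf fin _ _ _ _ _ _ _ _ _ _ _ _ res, where \<kappa> = "s y1 - t"])
    show "\<And>j a. j \<in> {x} \<Longrightarrow> (j, a, 0) \<in> C \<longleftrightarrow> a < s j" using d s(1) by (auto simp: C_def tri_def)
    show "\<And>a. (y1, a, 0) \<in> C \<longleftrightarrow> s y1 - t \<le> a \<and> a < s y1" using d by (auto simp: C_def tri_def)
    show "\<And>j a. j \<in> E \<Longrightarrow> (j, a, 0) \<notin> C" using d by (auto simp: C_def tri_def E_def)
    show "Z \<inter> insert y1 ({x} \<union> E) = {}" using Z by (auto simp: E_def)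
    show "f \<notin> insert y1 ({x} \<union> E)" using f by (auto simp: E_def)
    show "0 + sum s {x} + (s y1 - (s y1 - t)) = Suc (2 * t)" using s(1) s(2)[of y1] by auto
    show "s y1 \<le> Suc (2 * t)" using s(2)[of y1] by auto
    fix j a i assume "(j, a, i) \<in> C"
    then have j: "j \<in> {x, y1, y2, y3}" by (auto simp: C_def tri_def)
    show "s j \<le> Suc (s1 j)" using j s(1) s(2)[of j] by (auto simp: s1_def)
    show "s j \<le> s1 j" if "j \<notin> insert y1 ({x} \<union> E)" using j that d s(2)[of j] by (auto simp: s1_def E_def)
  qed (use d in auto)
  then show ?thesis using CB by (rule covers_mono)
qed

text \<open>The extreme case in which the partly used form may have a single multiplier left in its
  row: 1 + t + t = 2t + 1. Then \<open>b\<close>, \<open>y3\<close>, \<open>y4\<close> of size t and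
  \<open>y1\<close> of size t - 1 start the pattern of \<open>covers_four\<close>.\<close>

lemma covers_short_row:
  assumes inf: "infinite (UNIV :: 'k::field set)"
    and d: "distinct [b, y1, y2, y3, y4]" and s: "s b = Suc t" "\<And>y. y \<in> {y1, y2, y3, y4} \<Longrightarrow> s y = t"
    and t: "0 < t" and Z: "Z \<inter> {b, y1, y2} = {}"
    and B: "\<And>a i. a + i \<le> t \<Longrightarrow> (i = 0 \<Longrightarrow> a = t) \<Longrightarrow> (b, a, i) \<in> B"
      "\<And>y a i. y \<in> {y1, y2, y3, y4} \<Longrightarrow> a + i < t \<Longrightarrow> (y, a, i) \<in> B"
  shows "covers TYPE('k) (Suc (2 * t)) s Z B"
proof -
  define C where "C = {(j, a, i). j = b \<and> a + i \<le> t \<and> (i = 0 \<longrightarrow> a = t)} \<union>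
    {(j, a, i). j \<in> {y1, y2, y3, y4} \<and> a + i < t}"
  have CB: "C \<subseteq> B" using B by (auto simp: C_def)
  have "C \<subseteq> tri b (Suc t) \<union> tri y1 t \<union> tri y2 t \<union> tri y3 t \<union> tri y4 t" by (auto simp: C_def tri_def)
  then have fin: "finite C" by (rule finite_subset) simp
  obtain f where f: "f \<notin> {b, y1, y2}" using ex_fresh[of "{b, y1, y2}"] by auto
  define s1 where "s1 = s(b := t, y1 := t - 1, y2 := t - 1)"
  have "covers TYPE('k) (2 * t) s1 {} (tri b t \<union> tri y3 t \<union> tri y4 t \<union> tri y1 (t - 1))"
    by (rule covers_four[OF inf]) (use d s in \<open>auto simp: s1_def\<close>)
  moreover have "tri b t \<union> tri y3 t \<union> tri y4 t \<union> tri y1 (t - 1) \<subseteq> residue (insert b ({y1, y2} \<union> {})) f 0 C"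
    using d by (auto simp: residue_def C_def tri_def less_diff_conv)
  ultimately have res: "covers TYPE('k) (2 * t) s1 {} (residue (insert b ({y1, y2} \<union> {})) f 0 C)"
    by (rule covers_mono)
  have "covers TYPE('k) (Suc (2 * t)) s Z C"
  proof (rule step_covers[OF inf fin _ _ _ _ _ _ _ _ _ _ _ _ res, where \<kappa> = t])
    show "\<And>j a. j \<in> {y1, y2} \<Longrightarrow> (j, a, 0) \<in> C \<longleftrightarrow> a < s j" using d s(2) by (auto simp: C_def)
    show "\<And>a. (b, a, 0) \<in> C \<longleftrightarrow> t \<le> a \<and> a < s b" using d s(1) by (auto simp: C_def less_Suc_eq)
    show "0 + sum s {y1, y2} + (s b - t) = Suc (2 * t)" using d s t by simp
    show "s b \<le> Suc (2 * t)" using s(1) by simp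
    fix j a i assume "(j, a, i) \<in> C"
    then have j: "j \<in> {b, y1, y2, y3, y4}" by (auto simp: C_def)
    show "s j \<le> Suc (s1 j)" using j s(1) s(2)[of j] by (auto simp: s1_def)
    show "s j \<le> s1 j" if "j \<notin> insert b ({y1, y2} \<union> {})" using that by (auto simp: s1_def)
  qed (use d f s Z in auto)
  then show ?thesis using CB by (rule covers_mono)
qed

text \<open>Induction on T from T = d, where \<open>covers_four\<close> applies. On a line of d + T
  + 1 monomials a full row of length T + 1 and the last d entries of a second row fit exactly, and
  all four sizes drop by one.\<close>

lemma covers_four_large:
  assumes inf: "infinite (UNIV :: 'k::field set)" and "d \<le> T"
  shows "\<And>s. distinct [x1, x2, x3, x4] \<Longrightarrow> (\<And>x. x \<in> {x1, x2, x3, x4} \<Longrightarrow> s x = T) \<Longrightarrow>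
    covers TYPE('k) (d + T) s {} {(j, a, i). j \<in> {x1, x2, x3, x4} \<and> a + i < T}"
  using assms(2)
proof (induction T rule: dec_induct)
  case base
  have "covers TYPE('k) (2 * d) s {} (tri x1 d \<union> tri x2 d \<union> tri x3 d \<union> {(j, a, i) \<in> tri x4 d. 0 < i})"
  proof (rule covers_four[OF inf])
    show "s x1 = d" "s x2 = d" "s x3 = d" using base(2) by auto
    show "s x4 = d - 1 \<and> {(j, a, i) \<in> tri x4 d. 0 < i} = tri x4 (d - 1) \<or>
        s x4 = d \<and> {(j, a, i) \<in> tri x4 d. 0 < i} = {(j, a, i) \<in> tri x4 d. 0 < i}"
      using base(2) by auto
  qed (rule base(1))
  then have "covers TYPE('k) (2 * d) s {} {(j, a, i). j \<in> {x1, x2, x3, x4} \<and> a + i < d}"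
    by (rule covers_mono) (auto simp: tri_def)
  then show ?case by (simp add: mult_2)
next
  case (step T)
  define C where "C = tri x1 (Suc T) \<union> {(j, a, i). j \<in> {x2, x3, x4} \<and> a + i < Suc T \<and>
    (i = 0 \<longrightarrow> j = x2 \<and> Suc T - d \<le> a)}"
  note dx = step.prems(1) and s = step.prems(2)
  have "C \<subseteq> tri x1 (Suc T) \<union> tri x2 (Suc T) \<union> tri x3 (Suc T) \<union> tri x4 (Suc T)" by (auto simp: C_def tri_def)
  then have fin: "finite C" by (rule finite_subset) simp
  obtain f where f: "f \<notin> {x1, x2, x3, x4}" using ex_fresh[of "{x1, x2, x3, x4}"] by auto
  have "covers TYPE('k) (d + T) (\<lambda>_. T) {} {(j, a, i). j \<in> {x1, x2, x3, x4} \<and> a + i < T}"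
    by (rule step.IH) (use dx in auto)
  moreover have "{(j, a, i). j \<in> {x1, x2, x3, x4} \<and> a + i < T} \<subseteq> residue (insert x2 ({x1} \<union> {x3, x4})) f 0 C"
    using dx by (auto simp: residue_def C_def tri_def)
  ultimately have res: "covers TYPE('k) (d + T) (\<lambda>_. T) {} (residue (insert x2 ({x1} \<union> {x3, x4})) f 0 C)"
    by (rule covers_mono)
  have "covers TYPE('k) (Suc (d + T)) s {} C"
  proof (rule step_covers[OF inf fin _ _ _ _ _ _ _ _ _ _ _ _ res, where \<kappa> = "Suc T - d"])
    show "\<And>j a. j \<in> {x1} \<Longrightarrow> (j, a, 0) \<in> C \<longleftrightarrow> a < s j" using dx s by (auto simp: C_def tri_def)
    show "\<And>a. (x2, a, 0) \<in> C \<longleftrightarrow> Suc T - d \<le> a \<and> a < s x2" using dx s by (auto simp: C_def tri_def)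
    show "\<And>j a. j \<in> {x3, x4} \<Longrightarrow> (j, a, 0) \<notin> C" using dx by (auto simp: C_def tri_def)
    show "0 + sum s {x1} + (s x2 - (Suc T - d)) = Suc (d + T)" using s step.hyps by simp
    fix j a i assume "(j, a, i) \<in> C"
    then have j: "j \<in> {x1, x2, x3, x4}" by (auto simp: C_def tri_def)
    show "s j \<le> Suc T" using j s by auto
    show "j \<notin> insert x2 ({x1} \<union> {x3, x4}) \<Longrightarrow> s j \<le> T" using j by auto
  qed (use dx f s in auto)
  moreover have "C \<subseteq> {(j, a, i). j \<in> {x1, x2, x3, x4} \<and> a + i < Suc T}" by (auto simp: C_def tri_def)
  ultimately show ?case using covers_mono by simp
qed


subsection \<open>Greedy filling of a triangle\<close>

text \<open>
  The state of the greedy process: multipliers of degree at most \<open>t\<close> for the forms in \<open>P\<close>, less than \<open>t\<close> for those in \<open>Q\<close>,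
  and one form \<open>b\<close> whose first \<open>\<kappa>\<close> multipliers in the row \<open>y = 0\<close> have been used before.
\<close>
definition cfg :: "nat \<Rightarrow> nat \<Rightarrow> nat \<Rightarrow> nat set \<Rightarrow> nat set \<Rightarrow> (nat \<times> nat \<times> nat) set" where
  "cfg t b \<kappa> P Q = {(j, a, i). if j = b then a + i \<le> t \<and> (i = 0 \<longrightarrow> \<kappa> \<le> a)
     else if j \<in> P then a + i \<le> t else j \<in> Q \<and> a + i < t}"

definition sz :: "nat \<Rightarrow> nat set \<Rightarrow> nat \<Rightarrow> nat" where
  "sz t Q j = (if j \<in> Q then t else Suc t)"

text \<open>The count is doubled so that comparisons with triangular numbers become polynomial
  inequalities.\<close>

lemma cfg_Sigma:
  assumes "finite P" "finite Q" "P \<inter> Q = {}" "b \<notin> P \<union> Q" "\<kappa> \<le> t"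
  shows "finite (cfg t b \<kappa> P Q)"
    and "2 * card (cfg t b \<kappa> P Q) = 2 * (Suc t - \<kappa>) + t * Suc t + card P * (Suc t * (t + 2)) + card Q * (t * Suc t)"
proof -
  define reg where "reg = (\<lambda>s. {(a, i). a + i < (s::nat)})"
  have reg: "finite (reg s)" "card (reg s) = Suc s choose 2" for s
    using card_tri_region by (auto simp: reg_def)
  define Rb where "Rb = {(a, i). a + i \<le> t \<and> (i = 0 \<longrightarrow> \<kappa> \<le> a)}"
  have Rb: "Rb = (\<lambda>a. (a, 0)) ` {\<kappa>..t} \<union> (\<lambda>(a, i). (a, Suc i)) ` reg t"
  proof (intro equalityI subsetI)
    fix r assume "r \<in> Rb"
    then show "r \<in> (\<lambda>a. (a, 0)) ` {\<kappa>..t} \<union> (\<lambda>(a, i). (a, Suc i)) ` reg t"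
      by (cases r; cases "snd r") (auto simp: Rb_def reg_def image_iff)
  qed (auto simp: Rb_def reg_def)
  have "card Rb = card ((\<lambda>a. (a, 0::nat)) ` {\<kappa>..t}) + card ((\<lambda>(a, i). (a, Suc i)) ` reg t)"
    unfolding Rb using reg by (intro card_Un_disjoint) auto
  also have "\<dots> = (Suc t - \<kappa>) + (Suc t choose 2)"
  proof -
    have "inj_on (\<lambda>(a, i). (a, Suc i)) (reg t)" by (auto simp: inj_on_def)
    then show ?thesis using reg by (simp add: card_image inj_on_def)
  qed
  finally have cRb: "card Rb = (Suc t - \<kappa>) + (Suc t choose 2)" .
  have fRb: "finite Rb" unfolding Rb using reg by auto
  define R where "R = (\<lambda>j. if j = b then Rb else if j \<in> P then reg (Suc t) else reg t)"
  have eq: "cfg t b \<kappa> P Q = Sigma (insert b (P \<union> Q)) R"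
    using assms(4) by (auto simp: cfg_def R_def Rb_def reg_def split: if_splits)
  have fR: "finite (R j)" for j using reg fRb by (simp add: R_def)
  show "finite (cfg t b \<kappa> P Q)" unfolding eq using assms(1,2) fR by auto
  have "card (cfg t b \<kappa> P Q) = (\<Sum>j\<in>insert b (P \<union> Q). card (R j))"
    unfolding eq using assms(1,2) fR by (intro card_SigmaI) auto
  also have "\<dots> = card Rb + ((\<Sum>j\<in>P. card (R j)) + (\<Sum>j\<in>Q. card (R j)))"
    using assms by (simp add: sum.union_disjoint R_def)
  also have "(\<Sum>j\<in>P. card (R j)) = (\<Sum>j\<in>P. Suc (Suc t) choose 2)"
    using assms(4) reg by (intro sum.cong) (auto simp: R_def)
  also have "(\<Sum>j\<in>Q. card (R j)) = (\<Sum>j\<in>Q. Suc t choose 2)"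
    using assms(3,4) reg by (intro sum.cong) (auto simp: R_def)
  finally have "2 * card (cfg t b \<kappa> P Q) = 2 * (Suc t - \<kappa>) + 2 * (Suc t choose 2) +
      card P * (2 * (Suc (Suc t) choose 2)) + card Q * (2 * (Suc t choose 2))"
    unfolding cRb by (simp add: algebra_simps)
  then show "2 * card (cfg t b \<kappa> P Q) = 2 * (Suc t - \<kappa>) + t * Suc t + card P * (Suc t * (t + 2)) + card Q * (t * Suc t)"
    unfolding twice_triangle by simp
qed

text \<open>The forms in \<open>P'\<close> and \<open>Q'\<close> put their full rows on the line,
  next to the rest of \<open>b\<close>; \<open>f\<close> is split after \<alpha> monomials if
  \<alpha> > 0. Rank stays maximal in two situations: the line is full, so products and monomials
  decrease by the same number, or there is a gap but the residual products do not outnumber the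
  residual monomials, so that all products are to be independent. The count equation in
  \<open>IH\<close> passes a bound on the number of products to the residual system.\<close>

lemma cfg_step:
  fixes P Q P' Q' :: "nat set"
  defines "J b \<equiv> insert b (P' \<union> Q')"
  assumes inf: "infinite (UNIV :: 'k::field set)"
    and cf: "finite P" "finite Q" "P \<inter> Q = {}" "b \<notin> P \<union> Q" "\<kappa> \<le> t" "t \<le> m"
    and sub: "P' \<subseteq> P" "Q' \<subseteq> Q" and f: "f \<notin> J b" and Z: "Z \<inter> J b = {}"
    and brk: "0 < \<alpha> \<Longrightarrow> f \<notin> Z \<and> f \<in> P \<union> Q \<and> c \<in> P' \<union> Q' \<and> c \<in> Z1 \<and>
      \<alpha> \<le> sz t Q f \<and> sz t Q f \<le> \<alpha> + sz t Q c"
    and s1: "\<And>j. j \<in> J b \<Longrightarrow> sz t Q j \<le> Suc (s1 j)" "\<And>j. j \<in> P \<union> Q - J b \<Longrightarrow> sz t Q j \<le> s1 j"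
    and res: "residue (J b) f \<alpha> (cfg t b \<kappa> P Q) = B1"
    and X: "\<alpha> + card P' * Suc t + card Q' * t + (Suc t - \<kappa>) = n"
    and total: "n = Suc m \<or> n \<le> Suc m \<and> card B1 \<le> Suc m choose 2"
    and IH: "card (cfg t b \<kappa> P Q) = n + card B1 \<Longrightarrow> maxrank TYPE('k) m s1 Z1 B1"
  shows "maxrank TYPE('k) (Suc m) (sz t Q) Z (cfg t b \<kappa> P Q)"
proof -
  let ?B = "cfg t b \<kappa> P Q"
  have fin: "finite ?B" using cf by (intro cfg_Sigma)
  have finK: "finite (P' \<union> Q')" using cf(1,2) sub finite_subset by blast
  have dj: "P' \<inter> Q' = {}" "P' \<inter> Q = {}" "b \<notin> P'" "b \<notin> Q'" "b \<notin> Q" using cf sub by auto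
  have bK: "b \<notin> P' \<union> Q'" using dj by auto
  have fJ: "f \<notin> insert b (P' \<union> Q' \<union> {})" using f by (simp add: J_def)
  have rK: "(j, a, 0) \<in> ?B \<longleftrightarrow> a < sz t Q j" if "j \<in> P' \<union> Q'" for j a
  proof -
    from that sub cf have "j \<noteq> b" "j \<in> P \<and> j \<notin> Q \<or> j \<in> Q \<and> j \<notin> P" by auto
    then show ?thesis by (auto simp: cfg_def sz_def)
  qed
  have rb: "(b, a, 0) \<in> ?B \<longleftrightarrow> \<kappa> \<le> a \<and> a < sz t Q b" for a
    using dj by (auto simp: cfg_def sz_def)
  have szb: "sz t Q b = Suc t" using dj by (simp add: sz_def)
  have "sum (sz t Q) (P' \<union> Q') = sum (sz t Q) P' + sum (sz t Q) Q'"
    using finK dj by (intro sum.union_disjoint) auto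
  also have "sum (sz t Q) P' = (\<Sum>j\<in>P'. Suc t)" using dj by (intro sum.cong) (auto simp: sz_def)
  also have "sum (sz t Q) Q' = (\<Sum>j\<in>Q'. t)" using sub by (intro sum.cong) (auto simp: sz_def)
  finally have n: "\<alpha> + sum (sz t Q) (P' \<union> Q') + (sz t Q b - \<kappa>) = n" using X szb by simp
  have rf: "(f, a, 0) \<in> ?B \<longleftrightarrow> a < sz t Q f" if "0 < \<alpha>" for a
  proof -
    have "f \<in> P \<union> Q" "f \<noteq> b" using brk[OF that] f by (auto simp: J_def)
    then have "f \<in> P \<and> f \<notin> Q \<or> f \<in> Q \<and> f \<notin> P" using cf(3) by auto
    then show ?thesis using \<open>f \<noteq> b\<close> by (auto simp: cfg_def sz_def)
  qed
  have Jb: "insert b (P' \<union> Q' \<union> {}) = J b" by (simp add: J_def)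
  have "card (trace_part (insert b (P' \<union> Q' \<union> {})) f \<alpha> ?B) =
      \<alpha> + sum (sz t Q) (P' \<union> Q') + (sz t Q b - \<kappa>)"
  proof (rule card_trace_part[OF finK bK fJ rK rb])
    show "(f, a, 0) \<in> ?B" if "a < \<alpha>" for a using rf[of a] brk that by auto
  qed auto
  with n card_residue[OF fin, of f "J b" \<alpha>] f res have cB: "card ?B = n + card B1"
    unfolding Jb by simp
  have mr: "maxrank TYPE('k) m s1 Z1 B1" using cB by (rule IH)
  obtain B' where B': "B' \<subseteq> residue (insert b (P' \<union> Q' \<union> {})) f \<alpha> ?B" "good TYPE('k) m s1 Z1 B'"
    "min (card B1) (Suc m choose 2) \<le> card B'"
    using mr unfolding Jb res maxrank_def by blast
  have "\<exists>B2\<subseteq>?B. good TYPE('k) (Suc m) (sz t Q) Z B2 \<and>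
      card B2 = \<alpha> + sum (sz t Q) (P' \<union> Q') + (sz t Q b - \<kappa>) + card B'"
  proof (rule fill[OF inf fin finK bK fJ rK rb _ _ _ _ _ _ _ _ B'(1,2), where c = c])
    show "f \<notin> Z \<and> sz t Q f \<le> Suc m \<and> c \<in> P' \<union> Q' \<and> c \<in> Z1 \<and> (\<forall>a. (f, a, 0) \<in> ?B \<longleftrightarrow> a < sz t Q f) \<and>
        \<alpha> \<le> sz t Q f \<and> sz t Q f \<le> \<alpha> + sz t Q c" if "0 < \<alpha>"
      using brk[OF that] rf[OF that] cf(6) by (auto simp: sz_def)
    show "Z \<inter> insert b (P' \<union> Q' \<union> {}) = {}" using Z unfolding Jb .
    show "\<alpha> + sum (sz t Q) (P' \<union> Q') + (sz t Q b - \<kappa>) \<le> Suc m" unfolding n using total by auto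
    show "\<kappa> \<le> sz t Q b" "sz t Q b \<le> Suc m" using szb cf by auto
    fix j a i assume j: "(j, a, i) \<in> ?B"
    show "sz t Q j \<le> Suc (s1 j)" if "j \<in> insert b (P' \<union> Q' \<union> {})" using s1(1) that unfolding Jb .
    have "j \<in> insert b (P \<union> Q)" using j by (auto simp: cfg_def split: if_splits)
    moreover have "b \<in> J b" by (simp add: J_def)
    ultimately show "sz t Q j \<le> s1 j" if "j \<notin> insert b (P' \<union> Q' \<union> {})"
      using s1(2)[of j] that unfolding Jb by auto
  qed auto
  then obtain B2 where B2: "B2 \<subseteq> ?B" "good TYPE('k) (Suc m) (sz t Q) Z B2" "card B2 = n + card B'"
    unfolding n by blast
  with cB B'(3) total have "min (card ?B) (Suc (Suc m) choose 2) \<le> card B2"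
    unfolding triangle_Suc by linarith
  with B2(1,2) show ?thesis unfolding maxrank_def by blast
qed

lemma three_distinct:
  assumes "finite A" "3 \<le> card A"
  shows "\<exists>x y z. {x, y, z} \<subseteq> A \<and> distinct [x, y, z]"
proof -
  obtain A' where "A' \<subseteq> A" "card A' = 3" using obtain_subset_with_card_n[OF assms(2)] by blast
  then show ?thesis unfolding card_3_iff by fastforce
qed

text \<open>The form whose trace must vanish is the absorbing form of the line before. Since
  \<open>P\<close> is used up before \<open>Q\<close>, this condition says that it comes last in the
  order of use and can be skipped.\<close>

definition frozen_ok :: "nat set \<Rightarrow> nat set \<Rightarrow> nat set \<Rightarrow> bool" where
  "frozen_ok P Q Z \<longleftrightarrow> Z = {} \<or> (\<exists>c. Z = {c} \<and> (c \<in> Q \<or> c \<in> P \<and> Q = {}))"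

lemma covers_cfg_short:
  assumes inf: "infinite (UNIV :: 'k::field set)"
    and cf: "finite P" "finite Q" "P \<inter> Q = {}" "b \<notin> P \<union> Q" "\<kappa> \<le> t"
    and Z: "frozen_ok P Q Z" and four: "4 \<le> card P + card Q"
  shows "covers TYPE('k) (Suc (2 * t)) (sz t Q) Z (cfg t b \<kappa> P Q)"
proof -
  have cPQ: "card (P \<union> Q) = card P + card Q" using cf by (simp add: card_Un_disjoint)
  have Zf: "finite Z" "card Z \<le> 1" and bZ: "b \<notin> Z" using Z cf(4) by (auto simp: frozen_ok_def)
  have szs: "sz t Q y = t \<or> sz t Q y = Suc t" for y by (simp add: sz_def)
  have cfgI: "(y, a, i) \<in> cfg t b \<kappa> P Q" if "y \<in> P \<union> Q" "a + i < sz t Q y" for y a i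
  proof -
    from that(1) cf have "y \<noteq> b" "y \<in> P \<and> y \<notin> Q \<or> y \<in> Q \<and> y \<notin> P" by auto
    then show ?thesis using that(2) by (auto simp: cfg_def sz_def)
  qed
  have szb: "sz t Q b = Suc t" using cf(4) by (simp add: sz_def)
  consider "\<kappa> = 0" | "0 < \<kappa>" "P - Z \<noteq> {}" | "0 < \<kappa>" "P - Z = {}" by auto
  then show ?thesis
  proof cases
    case 1
    have "card (P \<union> Q) - card Z \<le> card (P \<union> Q - Z)" using Zf by (intro diff_card_le_card_Diff)
    then have "3 \<le> card (P \<union> Q - Z)" using cPQ four Zf by linarith
    from three_distinct[OF _ this] cf(1,2)
    obtain x y z where "{x, y, z} \<subseteq> P \<union> Q - Z \<and> distinct [x, y, z]" by (auto simp del: insert_subset)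
    then have xyz: "{x, y, z} \<subseteq> P \<union> Q - Z" "distinct [x, y, z]" by blast+
    show ?thesis
    proof (rule covers_four_mixed[OF inf, where x = b and ?y1.0 = x and ?y2.0 = y and ?y3.0 = z])
      show "tri b (Suc t) \<subseteq> cfg t b \<kappa> P Q" using 1 by (auto simp: tri_def cfg_def)
    qed (use xyz cf(4) bZ szs szb cfgI in \<open>auto split: if_splits\<close>)
  next
    case 2
    then obtain x where x: "x \<in> P - Z" by blast
    have "card (P \<union> Q) - card (insert x Z) \<le> card (P \<union> Q - insert x Z)"
      using Zf by (intro diff_card_le_card_Diff) auto
    then have "2 \<le> card (P \<union> Q - insert x Z)"
      using cPQ four Zf card_insert_le_m1[of 2 Z x] by simp
    then obtain A where "A \<subseteq> P \<union> Q - insert x Z" "card A = 2"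
      by (rule obtain_subset_with_card_n)
    moreover from \<open>card A = 2\<close> obtain y z where "A = {y, z}" "y \<noteq> z" unfolding card_2_iff by (elim exE conjE)
    ultimately have yz: "{y, z} \<subseteq> P \<union> Q - insert x Z" "y \<noteq> z" by simp_all
    have xQ: "x \<notin> Q" "x \<noteq> b" using x cf by auto
    show ?thesis
    proof (rule covers_four_mixed[OF inf, where x = x and ?y1.0 = y and ?y2.0 = z and ?y3.0 = b])
      show "tri x (Suc t) \<subseteq> cfg t b \<kappa> P Q" using x xQ by (auto simp: tri_def cfg_def)
      show "sz t Q x = Suc t" using xQ by (simp add: sz_def)
      show "distinct [x, y, z, b]" using yz xQ cf(4) by auto
      show "Z \<inter> {x, y, z, b} = {}" using x yz bZ by auto
      show "(y, a, i) \<in> cfg t b \<kappa> P Q" if "a + i < sz t Q y" for a i using cfgI yz that by auto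
      show "(w, a, i) \<in> cfg t b \<kappa> P Q" if "w \<in> {z, b}" "a + i < sz t Q w" "sz t Q w = Suc t \<Longrightarrow> 0 < i" for w a i
        using that cfgI[of z] yz szb by (cases "w = b") (auto simp: cfg_def)
    qed (rule szs)
  next
    case 3
    have "P = {}"
    proof (rule ccontr)
      assume "P \<noteq> {}"
      then have "Z \<noteq> {}" "\<not> (\<exists>c. Z = {c} \<and> c \<in> Q)" using 3(2) cf(3) by auto
      then obtain c where "Z = {c}" "Q = {}" using Z by (auto simp: frozen_ok_def)
      then have "card P \<le> 1" using 3(2) card_mono[of "{c}" P] by auto
      with four \<open>Q = {}\<close> show False by simp
    qed
    then have Q4: "4 \<le> card Q" using four by simp
    then have "Q \<noteq> {}" by auto
    then obtain c where c: "c \<in> Q" "Z \<subseteq> {c}" using Z \<open>P = {}\<close> by (auto simp: frozen_ok_def)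
    have "3 \<le> card (Q - {c})" using Q4 c(1) by simp
    from three_distinct[OF _ this] cf(2)
    obtain x y z where "{x, y, z} \<subseteq> Q - {c} \<and> distinct [x, y, z]" by (auto simp del: insert_subset)
    then have xyz: "{x, y, z} \<subseteq> Q - {c}" "distinct [x, y, z]" by blast+
    show ?thesis
    proof (rule covers_short_row[OF inf, where b = b and ?y1.0 = x and ?y2.0 = y and ?y3.0 = z and ?y4.0 = c])
      show "(b, a, i) \<in> cfg t b \<kappa> P Q" if "a + i \<le> t" "i = 0 \<Longrightarrow> a = t" for a i
        using that cf(5) by (auto simp: cfg_def)
      show "0 < t" using 3(1) cf(5) by simp
      show "Z \<inter> {b, x, y} = {}" using c(2) xyz bZ by auto
      show "distinct [b, x, y, z, c]" using xyz c(1) cf(4) by auto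
      show "sz t Q w = t" if "w \<in> {x, y, z, c}" for w using that xyz c(1) by (auto simp: sz_def)
      show "(w, a, i) \<in> cfg t b \<kappa> P Q" if "w \<in> {x, y, z, c}" "a + i < t" for w a i
        using that xyz c(1) by (intro cfgI) (auto simp: sz_def)
    qed (rule szb)
  qed
qed

lemma quadratic_short:
  fixes m t p q r :: nat
  assumes "r + p * Suc t + q * t \<le> m" "0 < r" "2 * t \<le> m" "z \<le> 1"
  shows "t * Suc t * Suc z + p * (t * Suc t) + q * ((t - 1) * t) \<le> m * Suc m"
proof (cases t)
  case (Suc t')
  obtain e where m: "m = 2 * t + e" using assms(3) le_Suc_ex by blast
  have "q * ((t - 1) * t) \<le> q * (t * t)" by simp
  then have "p * (t * Suc t) + q * ((t - 1) * t) \<le> t * (p * Suc t + q * t)" by (simp add: algebra_simps)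
  also have "\<dots> \<le> t * (m - 1)" using assms(1,2) by (intro mult_left_mono) auto
  finally have 1: "p * (t * Suc t) + q * ((t - 1) * t) \<le> t * (m - 1)" .
  have "t * Suc t * Suc z \<le> t * Suc t * 2" using assms(4) by (intro mult_left_mono) auto
  then have 2: "t * Suc t * Suc z \<le> 2 * (t * Suc t)" by (simp only: mult.commute)
  have "2 * (t * Suc t) + t * (m - 1) \<le> m * Suc m"
    unfolding m by (simp add: Suc algebra_simps)
  with 1 2 show ?thesis by linarith
qed simp

lemma quadratic_short':
  fixes m t p r :: nat
  assumes "r + p * Suc t \<le> m" "0 < r" "2 * t < m"
  shows "Suc t * (t + 2) + Suc p * (t * Suc t) \<le> m * Suc m"
proof -
  obtain e where m: "m = Suc (2 * t + e)" using assms(3) less_iff_Suc_add by blast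
  have "p * (t * Suc t) = t * (p * Suc t)" by (simp add: algebra_simps)
  also have "\<dots> \<le> t * (m - 1)" using assms(1,2) by (intro mult_left_mono) auto
  finally have 1: "p * (t * Suc t) \<le> t * (m - 1)" .
  have "Suc t * (t + 2) + t * Suc t + t * (m - 1) \<le> m * Suc m"
    unfolding m by (simp add: algebra_simps)
  with 1 show ?thesis by simp
qed

lemma card_cfg_full:
  assumes "finite P" "finite Q" "P \<inter> Q = {}" "b \<notin> P \<union> Q"
  shows "2 * card (cfg t b 0 P Q) = Suc (card P) * (Suc t * (t + 2)) + card Q * (t * Suc t)"
  using cfg_Sigma(2)[OF assms, of 0 t] by (simp add: algebra_simps)

lemma maxrank_empty: "maxrank TYPE('k::field) m s Z {}"
  using good_empty unfolding maxrank_def by auto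

text \<open>The split form takes over the role of \<open>b\<close>, which joins the others, so the
  number of the others is invariant.\<close>

lemma card_exchange:
  assumes "finite P" "finite Q" "P \<inter> Q = {}" "b \<notin> P \<union> Q" "b1 \<in> P \<union> Q"
    and "A1 \<inter> A2 = {}" "A1 \<union> A2 = insert b (P \<union> Q) - {b1}"
  shows "card A1 + card A2 = card P + card Q"
proof -
  have "finite (A1 \<union> A2)" unfolding assms(7) using assms by simp
  then have "card A1 + card A2 = card (insert b (P \<union> Q) - {b1})"
    using assms(6) by (simp add: card_Un_disjoint flip: assms(7))
  also have "\<dots> = card (P \<union> Q)" using assms(1,2,4,5) by (simp add: card_Diff_singleton)
  finally show ?thesis using assms by (simp add: card_Un_disjoint)
qed

text \<open>
  Each row is filled with the rest of \<open>b\<close>, then with forms in \<open>P\<close>, then with forms in \<open>Q\<close>, avoiding the form whose trace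
  has to vanish. If they do not fit, the last form is split and becomes the new \<open>b\<close>.
\<close>
theorem maxrank_cfg:
  assumes inf: "infinite (UNIV :: 'k::field set)"
  shows "\<lbrakk>finite P; finite Q; P \<inter> Q = {}; b \<notin> P \<union> Q; \<kappa> \<le> t; 2 * t < m; frozen_ok P Q Z;
      4 \<le> card P + card Q \<or> 3 \<le> card P + card Q \<and> card (cfg t b \<kappa> P Q) \<le> Suc m choose 2\<rbrakk> \<Longrightarrow>
    maxrank TYPE('k) m (sz t Q) Z (cfg t b \<kappa> P Q)"
proof (induction m arbitrary: t b \<kappa> P Q Z)
  case (Suc m)
  note cf = Suc.prems(1-5)
  have tm: "2 * t \<le> m" "t \<le> m" using Suc.prems(6) by auto
  have bZ: "b \<notin> Z" using Suc.prems(4,7) by (auto simp: frozen_ok_def)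
  show ?case
  proof (cases "m = 2 * t \<and> 4 \<le> card P + card Q")
    case True
    then show ?thesis
      using covers_imp_maxrank covers_cfg_short[OF inf cf Suc.prems(7)] by blast
  next
    case False
    define \<rho> where "\<rho> = Suc t - \<kappa>"
    have \<rho>: "0 < \<rho>" "\<rho> \<le> Suc t" using cf(5) by (auto simp: \<rho>_def)
    \<comment> \<open>On a line of 2t + 1 monomials with only three other forms, a single form in
      \<open>P\<close> would push the number of products above the triangle. So whenever t is kept
      for the next line, there is room for it.\<close>
    have Pne: "2 * t < m" if "P \<noteq> {}"
    proof (rule ccontr)
      assume "\<not> 2 * t < m"
      with tm have m: "m = 2 * t" by simp
      with False Suc.prems(8) have c: "3 \<le> card P + card Q" "card (cfg t b \<kappa> P Q) \<le> Suc (Suc m) choose 2" by auto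
      have "2 * (Suc (Suc m) choose 2) = Suc m * Suc (Suc m)" by (rule twice_triangle)
      with c(2) have "2 * card (cfg t b \<kappa> P Q) \<le> Suc m * Suc (Suc m)" by linarith
      moreover have "1 \<le> card P" using that cf(1) by (simp add: Suc_le_eq card_gt_0_iff)
      then have "1 * Suc t \<le> card P * Suc t" by (rule mult_right_mono) simp
      moreover have "3 * (t * Suc t) \<le> (card P + card Q) * (t * Suc t)" using c(1) by (rule mult_right_mono) simp
      ultimately show False
        unfolding cfg_Sigma(2)[OF cf] \<rho>_def[symmetric] m using \<rho> by (simp add: algebra_simps)
    qed
    obtain f where f: "f \<notin> insert b (P \<union> Q)" using ex_fresh[of "insert b (P \<union> Q)"] cf by auto
    have nxt: "maxrank TYPE('k) m (sz t1 Q1) Z1 (cfg t1 b1 \<kappa>1 P1 Q1)"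
      if "finite P1" "finite Q1" "P1 \<inter> Q1 = {}" "b1 \<notin> P1 \<union> Q1" "\<kappa>1 \<le> t1" "2 * t1 < m" "frozen_ok P1 Q1 Z1"
        "card P1 + card Q1 = card P + card Q"
        "card (cfg t b \<kappa> P Q) = Suc m + card (cfg t1 b1 \<kappa>1 P1 Q1) \<or> card (cfg t1 b1 \<kappa>1 P1 Q1) \<le> Suc m choose 2"
      for t1 b1 \<kappa>1 P1 Q1 Z1
    proof (rule Suc.IH[OF that(1-7)])
      show "4 \<le> card P1 + card Q1 \<or> 3 \<le> card P1 + card Q1 \<and> card (cfg t1 b1 \<kappa>1 P1 Q1) \<le> Suc m choose 2"
        using Suc.prems(8) that(8,9) triangle_Suc[of m] by linarith
    qed
    have fin0: "finite (P - Z)" "finite (Q - Z)" using cf by auto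
    consider "Suc m \<le> \<rho> + card (P - Z) * Suc t"
      | "\<rho> + card (P - Z) * Suc t < Suc m" "Suc m \<le> \<rho> + card (P - Z) * Suc t + card (Q - Z) * t"
      | "\<rho> + card (P - Z) * Suc t + card (Q - Z) * t < Suc m"
      by linarith
    then show ?thesis
    proof cases
      case 1
      \<comment> \<open>Of the \<open>x\<close> places not taken by \<open>b\<close>, a rows of
        length t + 1 fill all but \<alpha>, which are left to the split form.\<close>
      define x where "x = Suc m - \<rho>"
      define a where "a = x div Suc t"
      define \<alpha> where "\<alpha> = x mod Suc t"
      have x: "x = a * Suc t + \<alpha>" unfolding a_def \<alpha>_def by (rule div_mult_mod_eq[symmetric])
      have X: "\<alpha> + a * Suc t + 0 * t + (Suc t - \<kappa>) = Suc m"
        using x \<rho> tm unfolding x_def \<rho>_def by linarith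
      have \<alpha>: "\<alpha> \<le> t" unfolding \<alpha>_def using mod_less_divisor[of "Suc t" x] by simp
      have "a * Suc t \<le> card (P - Z) * Suc t" using 1 x unfolding x_def by linarith
      then have a: "a \<le> card (P - Z)" by (simp only: mult_le_cancel2 zero_less_Suc simp_thms) 
      show ?thesis
      proof (cases "\<alpha> = 0")
        case True
        obtain P' where P': "P' \<subseteq> P - Z" "card P' = a" "finite P'" using obtain_subset_with_card_n[OF a] .
        have JZ: "Z \<inter> insert b (P' \<union> {}) = {}" "f \<notin> insert b (P' \<union> {})" "P' \<subseteq> P" using P' bZ f by auto
        \<comment> \<open>If a form of \<open>P\<close> is left over, it becomes the new
          \<open>b\<close> with a full row and t stays. If all of \<open>P\<close> is used, every
          multiplier has degree less than t and t drops.\<close>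
        show ?thesis
        proof (cases "P' = P")
          case False
          then obtain b1 where b1: "b1 \<in> P" "b1 \<notin> P'" using JZ(3) by blast
          define P1 where "P1 = P - P' - {b1}"
          define Q1 where "Q1 = Q \<union> P' \<union> {b}"
          have w: "finite P1" "finite Q1" "P1 \<inter> Q1 = {}" "b1 \<notin> P1 \<union> Q1"
            using cf P' b1 unfolding P1_def Q1_def by auto
          have c: "card P1 + card Q1 = card P + card Q"
            by (rule card_exchange[OF cf(1-4)]) (use b1 JZ(3) cf w in \<open>auto simp: P1_def Q1_def\<close>)
          show ?thesis
          proof (rule cfg_step[OF inf cf tm(2) JZ(3) empty_subsetI JZ(2,1)])
            show "residue (insert b (P' \<union> {})) f 0 (cfg t b \<kappa> P Q) = cfg t b1 0 P1 Q1"
              using cf b1 f JZ(3) unfolding P1_def Q1_def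
              by (auto simp: residue_def cfg_def split: if_splits)
            show "0 + card P' * Suc t + card {} * t + (Suc t - \<kappa>) = Suc m" using X True P' by simp
            show "maxrank TYPE('k) m (sz t Q1) {} (cfg t b1 0 P1 Q1)"
              if "card (cfg t b \<kappa> P Q) = Suc m + card (cfg t b1 0 P1 Q1)"
              by (rule nxt) (use w c that b1 Pne in \<open>auto simp: frozen_ok_def\<close>)
          qed (auto simp: sz_def Q1_def)
        next
          case P: True
          show ?thesis
          proof (cases t)
            case 0
            show ?thesis
            proof (rule cfg_step[OF inf cf tm(2) JZ(3) empty_subsetI JZ(2,1)])
              show "residue (insert b (P' \<union> {})) f 0 (cfg t b \<kappa> P Q) = {}"
                using P by (auto simp: residue_def cfg_def 0 split: if_splits)
              show "0 + card P' * Suc t + card {} * t + (Suc t - \<kappa>) = Suc m" using X True P' by simp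
              show "maxrank TYPE('k) m (sz t Q) {} {}" by (rule maxrank_empty)
            qed auto
          next
            case (Suc t')
            show ?thesis
            proof (rule cfg_step[OF inf cf tm(2) JZ(3) empty_subsetI JZ(2,1)])
              show "residue (insert b (P' \<union> {})) f 0 (cfg t b \<kappa> P Q) = cfg t' b 0 (P \<union> Q) {}"
                using P cf f by (auto simp: residue_def cfg_def Suc less_Suc_eq_le split: if_splits)
              show "0 + card P' * Suc t + card {} * t + (Suc t - \<kappa>) = Suc m" using X True P' by simp
              show "maxrank TYPE('k) m (sz t' {}) {} (cfg t' b 0 (P \<union> Q) {})"
                if "card (cfg t b \<kappa> P Q) = Suc m + card (cfg t' b 0 (P \<union> Q) {})"
                by (rule nxt) (use cf that tm Suc in \<open>auto simp: frozen_ok_def card_Un_disjoint\<close>)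
            qed (use P Suc in \<open>auto simp: sz_def\<close>)
          qed
        qed
      next
        case False
        then have "a * Suc t < card (P - Z) * Suc t" using 1 x unfolding x_def by linarith
        then have a1: "Suc a \<le> card (P - Z)" by (simp only: mult_less_cancel2 Suc_le_eq)
        then have "P \<noteq> {}" by auto
        then have "2 * t < m" by (rule Pne)
        \<comment> \<open>The absorbing form must come from \<open>P'\<close>, so at least one full
          row has to fit besides the rest of \<open>b\<close>; 2t < m guarantees this.\<close>
        then have "Suc t \<le> x" using \<rho> unfolding x_def by linarith
        then have a0: "0 < a" unfolding a_def by (simp add: div_greater_zero_iff)
        obtain P2 where P2: "P2 \<subseteq> P - Z" "card P2 = Suc a" "finite P2" using obtain_subset_with_card_n[OF a1] .
        then obtain b1 where b1: "b1 \<in> P2" by fastforce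
        define P' where "P' = P2 - {b1}"
        have P': "P' \<subseteq> P" "P' \<inter> Z = {}" "card P' = a" "finite P'" "b1 \<in> P" "b1 \<notin> Z" "b1 \<notin> P'"
          using P2 b1 by (auto simp: P'_def)
        with a0 obtain c where c: "c \<in> P'" by fastforce
        have JZ: "Z \<inter> insert b (P' \<union> {}) = {}" "b1 \<notin> insert b (P' \<union> {})" using P' bZ cf by auto
        define P1 where "P1 = P - P' - {b1}"
        define Q1 where "Q1 = Q \<union> P' \<union> {b}"
        have w: "finite P1" "finite Q1" "P1 \<inter> Q1 = {}" "b1 \<notin> P1 \<union> Q1"
          using cf P' unfolding P1_def Q1_def by auto
        have cc: "card P1 + card Q1 = card P + card Q"
          by (rule card_exchange[OF cf(1-4)]) (use P' cf w in \<open>auto simp: P1_def Q1_def\<close>)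
        show ?thesis
        proof (rule cfg_step[OF inf cf tm(2) P'(1) empty_subsetI JZ(2,1)])
          show "residue (insert b (P' \<union> {})) b1 \<alpha> (cfg t b \<kappa> P Q) = cfg t b1 \<alpha> P1 Q1"
            using cf P' unfolding P1_def Q1_def
            by (auto simp: residue_def cfg_def split: if_splits)
          show "\<alpha> + card P' * Suc t + card {} * t + (Suc t - \<kappa>) = Suc m" using X P' by simp
          show "maxrank TYPE('k) m (sz t Q1) {c} (cfg t b1 \<alpha> P1 Q1)"
            if "card (cfg t b \<kappa> P Q) = Suc m + card (cfg t b1 \<alpha> P1 Q1)"
            by (rule nxt) (use w cc that \<alpha> c \<open>2 * t < m\<close> in \<open>auto simp: frozen_ok_def Q1_def\<close>)
          show "b1 \<notin> Z \<and> b1 \<in> P \<union> Q \<and> c \<in> P' \<union> {} \<and> c \<in> {c} \<and> \<alpha> \<le> sz t Q b1 \<and> sz t Q b1 \<le> \<alpha> + sz t Q c"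
            using P' c \<alpha> cf(3) by (auto simp: sz_def)
        qed (auto simp: sz_def Q1_def)
      qed
    next
      case 2
      then have "card (Q - Z) * t \<noteq> 0" by linarith
      then have t0: "0 < t" and "card (Q - Z) \<noteq> 0" by simp_all
      then have "Q - Z \<noteq> {}" by (metis card.empty)
      then have PZ: "P \<inter> Z = {}" "Q \<noteq> {}" using Suc.prems(7) cf(3) by (auto simp: frozen_ok_def)
      then have P0: "P - Z = P" by blast
      obtain t' where t': "t = Suc t'" using t0 gr0_implies_Suc by blast
      define x where "x = Suc m - \<rho> - card P * Suc t"
      define a where "a = x div t"
      define \<alpha> where "\<alpha> = x mod t"
      have x: "x = a * t + \<alpha>" unfolding a_def \<alpha>_def by (rule div_mult_mod_eq[symmetric])
      have X: "\<alpha> + card P * Suc t + a * t + (Suc t - \<kappa>) = Suc m"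
        using x 2(1) \<rho> tm unfolding x_def \<rho>_def P0 by linarith
      have \<alpha>: "\<alpha> \<le> t'" unfolding \<alpha>_def using mod_less_divisor[OF t0, of x] t' by simp
      have "a * t \<le> card (Q - Z) * t" using 2 x unfolding x_def P0 by linarith
      then have a: "a \<le> card (Q - Z)" using t0 by simp
      show ?thesis
      proof (cases "\<alpha> = 0")
        case True
        obtain Q' where Q': "Q' \<subseteq> Q - Z" "card Q' = a" "finite Q'" using obtain_subset_with_card_n[OF a] .
        have JZ: "Z \<inter> insert b (P \<union> Q') = {}" "f \<notin> insert b (P \<union> Q')" "Q' \<subseteq> Q" using Q' bZ f PZ by auto
        have "card (P \<union> (Q - Q')) = card P + (card Q - a)"
          using cf Q' JZ(3) by (subst card_Un_disjoint) (auto simp: card_Diff_subset)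
        moreover have "a \<le> card Q" using card_mono[OF cf(2) JZ(3)] Q' by simp
        ultimately have c: "card (P \<union> (Q - Q')) + card Q' = card P + card Q" using Q' by simp
        show ?thesis
        proof (rule cfg_step[OF inf cf tm(2) subset_refl JZ(3) JZ(2,1)])
          show "residue (insert b (P \<union> Q')) f 0 (cfg t b \<kappa> P Q) = cfg t' b 0 (P \<union> (Q - Q')) Q'"
            using cf f JZ(3) by (auto simp: residue_def cfg_def t' split: if_splits)
          show "0 + card P * Suc t + card Q' * t + (Suc t - \<kappa>) = Suc m" using X True Q' by simp
          show "maxrank TYPE('k) m (sz t' Q') {} (cfg t' b 0 (P \<union> (Q - Q')) Q')"
            if "card (cfg t b \<kappa> P Q) = Suc m + card (cfg t' b 0 (P \<union> (Q - Q')) Q')"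
            by (rule nxt) (use cf JZ(3) Q' c that t' tm in \<open>auto simp: frozen_ok_def\<close>)
        qed (use cf JZ(3) in \<open>auto simp: sz_def t'\<close>)
      next
        case False
        then have "a * t < card (Q - Z) * t" using 2 x unfolding x_def P0 by linarith
        then have a1: "Suc a \<le> card (Q - Z)" by (simp add: Suc_le_eq)
        obtain Q2 where Q2: "Q2 \<subseteq> Q - Z" "card Q2 = Suc a" "finite Q2" using obtain_subset_with_card_n[OF a1] .
        then obtain b1 where b1: "b1 \<in> Q2" by fastforce
        define Q' where "Q' = Q2 - {b1}"
        have Q': "Q' \<subseteq> Q" "Q' \<inter> Z = {}" "card Q' = a" "finite Q'" "b1 \<in> Q" "b1 \<notin> Z" "b1 \<notin> Q'"
          using Q2 b1 by (auto simp: Q'_def)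
        \<comment> \<open>The absorbing form is taken from \<open>Q'\<close> if possible, and from
          \<open>P\<close> only if \<open>Q'\<close> is empty, as \<open>frozen_ok\<close> demands
          of the next state. If both were empty, the at least t places besides the rest of
          \<open>b\<close> would be left to \<alpha> < t.\<close>
        have "\<exists>c. c \<in> Q' \<or> c \<in> P \<and> Q' = {}"
        proof (rule ccontr)
          assume "\<not> ?thesis"
          then have "Q' = {}" "P = {}" by auto
          with Q' have "a = 0" "x = Suc m - \<rho>" by (auto simp: x_def)
          with x \<alpha> t' tm \<rho> show False by simp
        qed
        then obtain c where c: "c \<in> Q' \<or> c \<in> P \<and> Q' = {}" by blast
        have JZ: "Z \<inter> insert b (P \<union> Q') = {}" "b1 \<notin> insert b (P \<union> Q')" using Q' bZ PZ cf by auto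
        define P1 where "P1 = insert b (P \<union> (Q - Q' - {b1}))"
        have cc: "card P1 + card Q' = card P + card Q"
          by (rule card_exchange[OF cf(1-4)]) (use Q' cf in \<open>auto simp: P1_def\<close>)
        show ?thesis
        proof (rule cfg_step[OF inf cf tm(2) subset_refl Q'(1) JZ(2,1)])
          show "residue (insert b (P \<union> Q')) b1 \<alpha> (cfg t b \<kappa> P Q) = cfg t' b1 \<alpha> P1 Q'"
          proof -
            have "(j, a, i) \<in> residue (insert b (P \<union> Q')) b1 \<alpha> (cfg t b \<kappa> P Q) \<longleftrightarrow>
              (j, a, i) \<in> cfg t' b1 \<alpha> P1 Q'" for j a i
            proof -
              consider "j = b" | "j \<in> P" | "j \<in> Q'" | "j = b1" | "j \<in> Q - Q' - {b1}" | "j \<notin> insert b (P \<union> Q)"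
                by blast
              then show ?thesis
              proof cases
                case 1
                moreover have "b \<noteq> b1" "b \<in> P1" using JZ(2) by (auto simp: P1_def)
                ultimately show ?thesis by (auto simp: residue_def cfg_def t')
              next
                case 2
                moreover have "j \<noteq> b1" "j \<in> P1" "j \<noteq> b" using 2 JZ(2) cf(4) by (auto simp: P1_def)
                ultimately show ?thesis by (auto simp: residue_def cfg_def t')
              next
                case 3
                moreover have "j \<noteq> b1" "j \<notin> P1" "j \<noteq> b" "j \<notin> P" "j \<in> Q"
                  using 3 Q' cf(3,4) by (auto simp: P1_def)
                ultimately show ?thesis by (simp add: residue_def cfg_def t')
              next
                case 4
                moreover have "j \<noteq> b" "j \<notin> P" "j \<notin> Q'" using 4 JZ(2) by auto
                ultimately show ?thesis using Q'(5) by (auto simp: residue_def cfg_def t')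
              next
                case 5
                moreover have "j \<noteq> b1" "j \<in> P1" "j \<noteq> b" "j \<notin> P" using 5 cf(3,4) by (auto simp: P1_def)
                ultimately show ?thesis by (auto simp: residue_def cfg_def t')
              next
                case 6
                moreover have "j \<noteq> b1" "j \<notin> P1" "j \<notin> Q'" using 6 Q' by (auto simp: P1_def)
                ultimately show ?thesis by (simp add: residue_def cfg_def)
              qed
            qed
            then show ?thesis by (intro equalityI subsetI) auto
          qed
          show "\<alpha> + card P * Suc t + card Q' * t + (Suc t - \<kappa>) = Suc m" using X Q' by simp
          show "maxrank TYPE('k) m (sz t' Q') {c} (cfg t' b1 \<alpha> P1 Q')"
            if "card (cfg t b \<kappa> P Q) = Suc m + card (cfg t' b1 \<alpha> P1 Q')"
            by (rule nxt) (use cf Q' cc that \<alpha> c t' tm in \<open>auto simp: frozen_ok_def P1_def\<close>)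
          show "b1 \<notin> Z \<and> b1 \<in> P \<union> Q \<and> c \<in> P \<union> Q' \<and> c \<in> {c} \<and> \<alpha> \<le> sz t Q b1 \<and> sz t Q b1 \<le> \<alpha> + sz t Q c"
            using Q' c \<alpha> t' by (auto simp: sz_def)
        qed (use cf Q' in \<open>auto simp: sz_def t'\<close>)
      qed
    next
      case 3
      have JZ: "Z \<inter> insert b ((P - Z) \<union> (Q - Z)) = {}" "f \<notin> insert b ((P - Z) \<union> (Q - Z))"
        using bZ f by auto
      show ?thesis
      proof (cases "P \<inter> Z = {}")
        case True
        then have P0: "P - Z = P" by blast
        show ?thesis
        proof (cases t)
          case 0
          show ?thesis
          proof (rule cfg_step[OF inf cf tm(2) Diff_subset Diff_subset JZ(2,1) _ _ _ _ refl])
            show R: "residue (insert b ((P - Z) \<union> (Q - Z))) f 0 (cfg t b \<kappa> P Q) = {}"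
              using P0 by (auto simp: residue_def cfg_def 0 split: if_splits)
            show "0 + card (P - Z) * Suc t + card (Q - Z) * t + (Suc t - \<kappa>) = Suc m \<or>
              0 + card (P - Z) * Suc t + card (Q - Z) * t + (Suc t - \<kappa>) \<le> Suc m \<and> card {} \<le> Suc m choose 2"
              using 3 by (simp add: \<rho>_def)
            show "maxrank TYPE('k) m (sz t Q) {} {}" by (rule maxrank_empty)
          qed auto
        next
          case (Suc t')
          have zc: "card (Q \<inter> Z) \<le> 1" using Suc.prems(7) card_mono[of Z "Q \<inter> Z"] by (auto simp: frozen_ok_def)
          have cP: "card (P \<union> (Q \<inter> Z)) = card P + card (Q \<inter> Z)"
            using cf by (intro card_Un_disjoint) auto
          have cQ: "card (Q \<inter> Z) + card (Q - Z) = card Q"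
            using cf(2) by (metis card_Int_Diff)
          \<comment> \<open>A frozen form in \<open>Q\<close> is skipped and keeps its multipliers
            of degree less than t. After t has dropped these are full, so it counts with
            \<open>P\<close>.\<close>
          have "2 * card (cfg t' b 0 (P \<union> (Q \<inter> Z)) (Q - Z)) =
              Suc (card P + card (Q \<inter> Z)) * (Suc t' * (t' + 2)) + card (Q - Z) * (t' * Suc t')"
            unfolding cP[symmetric] using cf by (intro card_cfg_full) auto
          also have "\<dots> = t * Suc t * Suc (card (Q \<inter> Z)) + card P * (t * Suc t) + card (Q - Z) * ((t - 1) * t)"
            by (simp add: Suc algebra_simps)
          also have "\<dots> \<le> m * Suc m"
            by (rule quadratic_short[where r = \<rho>]) (use 3 P0 \<rho> tm zc in auto)
          finally have le: "card (cfg t' b 0 (P \<union> (Q \<inter> Z)) (Q - Z)) \<le> Suc m choose 2"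
            unfolding twice_triangle[symmetric] by simp
          show ?thesis
          proof (rule cfg_step[OF inf cf tm(2) Diff_subset Diff_subset JZ(2,1) _ _ _ _ refl])
            show "residue (insert b ((P - Z) \<union> (Q - Z))) f 0 (cfg t b \<kappa> P Q) = cfg t' b 0 (P \<union> (Q \<inter> Z)) (Q - Z)"
              using cf True f by (auto simp: residue_def cfg_def Suc less_Suc_eq_le split: if_splits)
            show "0 + card (P - Z) * Suc t + card (Q - Z) * t + (Suc t - \<kappa>) = Suc m \<or>
              0 + card (P - Z) * Suc t + card (Q - Z) * t + (Suc t - \<kappa>) \<le> Suc m \<and>
              card (cfg t' b 0 (P \<union> (Q \<inter> Z)) (Q - Z)) \<le> Suc m choose 2"
              using 3 le by (simp add: \<rho>_def)
            show "maxrank TYPE('k) m (sz t' (Q - Z)) {} (cfg t' b 0 (P \<union> (Q \<inter> Z)) (Q - Z))"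
              by (rule nxt) (use cf le cP cQ tm Suc in \<open>auto simp: frozen_ok_def\<close>)
          qed (use cf True in \<open>auto simp: sz_def Suc\<close>)
        qed
      next
        case False
        then obtain c where c: "Z = {c}" "c \<in> P" "Q = {}" using Suc.prems(7) cf(3) by (auto simp: frozen_ok_def)
        then have "2 * t < m" using Pne by blast
        have cP: "card P = Suc (card (P - {c}))" using c cf by (metis card.remove)
        have cQ: "card (insert b (P - {c})) = Suc (card (P - {c}))" using cf by simp
        have "2 * card (cfg t c 0 {} (insert b (P - {c}))) =
            Suc t * (t + 2) + Suc (card (P - {c})) * (t * Suc t)"
          using cf c cQ by (subst card_cfg_full) auto
        also have "\<dots> \<le> m * Suc m"
          by (rule quadratic_short'[where r = \<rho>]) (use 3 c \<rho> \<open>2 * t < m\<close> in auto)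
        finally have le: "card (cfg t c 0 {} (insert b (P - {c}))) \<le> Suc m choose 2"
          unfolding twice_triangle[symmetric] by simp
        show ?thesis
        proof (rule cfg_step[OF inf cf tm(2) Diff_subset Diff_subset JZ(2,1) _ _ _ _ refl])
          show "residue (insert b ((P - Z) \<union> (Q - Z))) f 0 (cfg t b \<kappa> P Q) = cfg t c 0 {} (insert b (P - {c}))"
            using cf c f by (auto simp: residue_def cfg_def split: if_splits)
          show "0 + card (P - Z) * Suc t + card (Q - Z) * t + (Suc t - \<kappa>) = Suc m \<or>
            0 + card (P - Z) * Suc t + card (Q - Z) * t + (Suc t - \<kappa>) \<le> Suc m \<and>
            card (cfg t c 0 {} (insert b (P - {c}))) \<le> Suc m choose 2"
            using 3 le by (simp add: \<rho>_def)
          show "maxrank TYPE('k) m (sz t (insert b (P - {c}))) {} (cfg t c 0 {} (insert b (P - {c})))"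
            by (rule nxt) (use cf c le cP cQ \<open>2 * t < m\<close> in \<open>auto simp: frozen_ok_def\<close>)
        qed (use cf c in \<open>auto simp: sz_def\<close>)
      qed
    qed
  qed
qed simp


subsection \<open>Products of monomials and forms\<close>

text \<open>The start of the greedy process has form 0 as \<open>b\<close> with a full row and the
  others in \<open>P\<close>; its condition 2t < m amounts to t \<le> d. Four forms are too few if
  the products outnumber the monomials, but then d \<le> t + 1 and \<open>covers_four_large\<close>
  applies.\<close>

lemma ternary_forms:
  assumes inf: "infinite (UNIV :: 'k::field set)" and r: "4 \<le> r" "5 \<le> r \<Longrightarrow> t \<le> d"
  shows "\<exists>(F :: nat \<Rightarrow> nat \<Rightarrow> nat \<Rightarrow> 'k) B. (\<forall>j x y. F j x y \<noteq> 0 \<longrightarrow> x + y \<le> d) \<and>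
    B \<subseteq> {..<r} \<times> {(a, i). a + i \<le> t} \<and> lin_indep B (shift F) \<and>
    min (r * (t + 2 choose 2)) (d + t + 2 choose 2) \<le> card B"
proof -
  define s :: "nat \<Rightarrow> nat" where "s = (\<lambda>_. Suc t)"
  define A where "A = {..<r} \<times> {(a, i). a + i \<le> t}"
  have A: "A = cfg t 0 0 {1..<r} {}" using r(1) by (auto simp: A_def cfg_def)
  have cA: "2 * card A = r * ((t + 1) * (t + 2))"
    using r(1) unfolding A by (subst card_cfg_full) auto
  have tt: "2 * (t + 2 choose 2) = (t + 1) * (t + 2)" using twice_triangle[of "t + 1"] by simp
  have cA': "card A = r * (t + 2 choose 2)" using cA unfolding tt[symmetric] by simp
  have dd: "2 * (d + t + 2 choose 2) = (d + t + 1) * (d + t + 2)" using twice_triangle[of "d + t + 1"] by simp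
  have cfg: "maxrank TYPE('k) (d + Suc t) s {} A"
    if "t \<le> d" "5 \<le> r \<or> card A \<le> Suc (d + Suc t) choose 2"
  proof -
    have "maxrank TYPE('k) (d + Suc t) (sz t {}) {} (cfg t 0 0 {1..<r} {})"
      by (rule maxrank_cfg[OF inf]) (use that r A in \<open>auto simp: frozen_ok_def\<close>)
    moreover have "sz t {} = s" by (auto simp: sz_def s_def)
    ultimately show ?thesis unfolding A by simp
  qed
  have "maxrank TYPE('k) (d + Suc t) s {} A"
  proof (cases "5 \<le> r")
    case True
    then show ?thesis using cfg r(2) by blast
  next
    case False
    then have r4: "r = 4" using r(1) by simp
    show ?thesis
    proof (cases "d \<le> Suc t")
      case True
      have "covers TYPE('k) (d + Suc t) s {} {(j, a, i). j \<in> {0, 1, 2, 3} \<and> a + i < Suc t}"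
        by (rule covers_four_large[OF inf True]) (auto simp: s_def)
      moreover have "{(j, a, i). j \<in> {0, 1, 2, 3} \<and> a + i < Suc t} = A" by (auto simp: A_def r4)
      ultimately show ?thesis using covers_imp_maxrank by metis
    next
      case False
      then obtain e where e: "d = t + 2 + e" by (metis add_2_eq_Suc' le_Suc_ex not_less_eq_eq)
      have "2 * card A \<le> (d + t + 1) * (d + t + 2)"
        unfolding cA e r4 by (simp add: algebra_simps)
      then have "card A \<le> d + t + 2 choose 2" unfolding dd[symmetric] by simp
      then show ?thesis using cfg False by simp
    qed
  qed
  then obtain B where B: "B \<subseteq> A" "good TYPE('k) (d + Suc t) s {} B"
    "min (card A) (Suc (d + Suc t) choose 2) \<le> card B" unfolding maxrank_def by blast
  then obtain F :: "nat \<Rightarrow> nat \<Rightarrow> nat \<Rightarrow> 'k" where F: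
    "\<And>j x y. j \<in> fst ` B \<Longrightarrow> F j x y \<noteq> 0 \<Longrightarrow> x + y + Suc t \<le> d + Suc t" "lin_indep B (shift F)"
    unfolding good_def s_def by blast
  define G where "G = (\<lambda>j x y. if j \<in> fst ` B then F j x y else 0)"
  have "lin_indep B (shift G)"
    using F(2) by (subst lin_indep_cong[where w' = "shift F"]) (force simp: shift_def G_def)+
  moreover have "x + y \<le> d" if "G j x y \<noteq> 0" for j x y
    using that F(1)[of j x y] by (auto simp: G_def split: if_splits)
  moreover have "min (r * (t + 2 choose 2)) (d + t + 2 choose 2) \<le> card B" using B(3) unfolding cA' by simp
  ultimately show ?thesis using B(1) unfolding A_def by blast
qed

section \<open>Monomials in n variables and forms that are monomials\<close>

abbreviation mdeg :: "('n::finite \<Rightarrow>\<^sub>0 nat) \<Rightarrow> nat" where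
  "mdeg m \<equiv> (\<Sum>i\<in>UNIV. lookup m i)"

definition mons :: "nat \<Rightarrow> ('n::finite \<Rightarrow>\<^sub>0 nat) set" where
  "mons t = {m. mdeg m = t}"

lemma mdeg_add: "mdeg (m + k) = mdeg m + mdeg k"
  by (simp add: lookup_add sum.distrib)

lemma mdeg_single: "mdeg (single i c) = c"
  by (simp add: lookup_single when_def)

lemma poly_mapping_of_fun:
  fixes g :: "'n::finite \<Rightarrow> 'b::zero"
  shows "\<exists>m. lookup m = g"
  by (rule exI[of _ "Abs_poly_mapping g"]) simp

lemma card_mons:
  fixes t :: nat
  shows "finite (mons t :: ('n::finite \<Rightarrow>\<^sub>0 nat) set)"
    and "card (mons t :: ('n::finite \<Rightarrow>\<^sub>0 nat) set) = (t + card (UNIV :: 'n set) - 1) choose t"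
proof -
  let ?n = "card (UNIV :: 'n set)" and ?L = "{l :: nat list. length l = card (UNIV :: 'n set) \<and> sum_list l = t}"
  obtain e :: "nat \<Rightarrow> 'n" where e: "bij_betw e {..<?n} UNIV"
    using ex_bij_betw_nat_finite[of "UNIV :: 'n set"] by (auto simp: atLeast0LessThan)
  define \<phi> where "\<phi> = (\<lambda>m :: 'n \<Rightarrow>\<^sub>0 nat. map (\<lambda>i. lookup m (e i)) [0..<?n])"
  have sum: "sum_list (\<phi> m) = mdeg m" for m
  proof -
    have "sum_list (\<phi> m) = (\<Sum>i\<in>{..<?n}. lookup m (e i))"
      by (simp add: \<phi>_def interv_sum_list_conv_sum_set_nat atLeast0LessThan)
    then show ?thesis using sum.reindex_bij_betw[OF e, of "lookup m"] by simp
  qed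
  have bij: "bij_betw \<phi> (mons t) ?L"
  proof (rule bij_betwI')
    fix m m' :: "'n \<Rightarrow>\<^sub>0 nat"
    have "m = m'" if "\<phi> m = \<phi> m'"
    proof (rule poly_mapping_eqI)
      fix v :: 'n
      obtain i where "i < ?n" "v = e i" using e unfolding bij_betw_def by (metis imageE lessThan_iff UNIV_I)
      then show "lookup m v = lookup m' v"
        using arg_cong[OF that, of "\<lambda>l. l ! i"] by (simp add: \<phi>_def)
    qed
    then show "\<phi> m = \<phi> m' \<longleftrightarrow> m = m'" by blast
  next
    show "\<phi> m \<in> ?L" if "m \<in> mons t" for m using that sum by (simp add: mons_def) (simp add: \<phi>_def)
  next
    fix l assume l: "l \<in> ?L"
    obtain m where m: "lookup m = (\<lambda>v. l ! (inv_into {..<?n} e v))"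
      using poly_mapping_of_fun by blast
    have "\<phi> m = l"
      using l e by (intro nth_equalityI) (simp_all add: \<phi>_def m bij_betw_inv_into_left)
    then show "\<exists>m\<in>mons t. l = \<phi> m" using sum[of m] l by (auto simp: mons_def)
  qed
  have "card ?L = (t + ?n - 1) choose t" by (rule card_length_sum_list)
  then show "card (mons t :: ('n \<Rightarrow>\<^sub>0 nat) set) = (t + ?n - 1) choose t"
    using bij_betw_same_card[OF bij] by simp
  have "?L \<subseteq> {l. set l \<subseteq> {..t} \<and> length l = ?n}" using member_le_sum_list by auto
  then have "finite ?L" by (rule finite_subset) (rule finite_lists_length_eq, simp)
  then show "finite (mons t :: ('n \<Rightarrow>\<^sub>0 nat) set)" using bij_betw_finite[OF bij] by simp
qed

lemma sum_single_lookup: "(\<Sum>k\<in>keys f. single k (lookup f k)) = f"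
  by (rule poly_mapping_eqI)
    (simp add: lookup_sum lookup_single when_def in_keys_iff sum.delta)

lemma lookup_single_times:
  fixes f :: "('v \<Rightarrow>\<^sub>0 nat) \<Rightarrow>\<^sub>0 'k::field"
  shows "lookup (single m c * f) s =
    (\<Sum>k\<in>keys f. if m + k = s then c * lookup f k else 0)"
proof -
  have "single m c * f =
      (\<Sum>k\<in>keys f. single (m + k) (c * lookup f k))"
    by (subst sum_single_lookup[symmetric, of f]) (simp add: sum_distrib_left mult_single)
  then show ?thesis by (simp add: lookup_sum lookup_single when_def)
qed

lemma lookup_single_times_add:
  fixes f :: "('v \<Rightarrow>\<^sub>0 nat) \<Rightarrow>\<^sub>0 'k::field"
  shows "lookup (single m c * f) (m + k) = c * lookup f k"
  unfolding lookup_single_times by (simp add: sum.delta in_keys_iff)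

lemma lookup_single_times_eq_0:
  fixes f :: "('v \<Rightarrow>\<^sub>0 nat) \<Rightarrow>\<^sub>0 'k::field"
  assumes "\<And>k. k \<in> keys f \<Longrightarrow> s \<noteq> m + k"
  shows "lookup (single m c * f) s = 0"
  unfolding lookup_single_times using assms by (intro sum.neutral) auto

definition products ::
  "(nat \<Rightarrow> ('n::finite, 'k::field) mpoly) \<Rightarrow> nat \<times> ('n \<Rightarrow>\<^sub>0 nat) \<Rightarrow> ('n \<Rightarrow>\<^sub>0 nat) \<Rightarrow> 'k" where
  "products F = (\<lambda>(j, m). lookup (single m 1 * F j))"

lemma products_single:
  "products (\<lambda>j. single (k j) 1) (j, m) s = (if s = m + k j then 1 else 0)"
  by (simp add: products_def mult_single lookup_single when_def)

definition indep_bound :: "'n::finite itself \<Rightarrow> 'k::field itself \<Rightarrow> nat \<Rightarrow> nat \<Rightarrow> nat \<Rightarrow> nat \<Rightarrow> bool" where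
  "indep_bound TYPE('n) TYPE('k) r d t c \<longleftrightarrow> (\<exists>(F :: nat \<Rightarrow> ('n, 'k) mpoly) B. (\<forall>j. F j \<in> forms d) \<and>
     B \<subseteq> {..<r} \<times> mons t \<and> lin_indep B (products F) \<and> c \<le> card B)"

text \<open>If the forms are monomials, so are the products. One index for each monomial that occurs
  gives an independent set.\<close>

lemma indep_bound_monomials:
  fixes k :: "nat \<Rightarrow> 'n::finite \<Rightarrow>\<^sub>0 nat"
  assumes k: "\<And>j. k j \<in> mons d" and c: "c \<le> card ((\<lambda>(j, m). m + k j) ` ({..<r} \<times> mons t))"
  shows "indep_bound TYPE('n) TYPE('k::field) r d t c"
proof -
  let ?f = "\<lambda>(j, m). m + k j"
  obtain B where B: "B \<subseteq> {..<r} \<times> mons t" "inj_on ?f B" "?f ` ({..<r} \<times> mons t) = ?f ` B"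
    using subset_image_inj[of "?f ` ({..<r} \<times> mons t)" ?f "{..<r} \<times> mons t"] by auto
  have fin: "finite B" using B(1) card_mons(1) finite_subset by blast
  define F :: "nat \<Rightarrow> ('n, 'k) mpoly" where "F = (\<lambda>j. single (k j) 1)"
  have "lin_indep B (products F)"
  proof (rule lin_indepI)
    fix c \<beta> assume h: "\<And>s. (\<Sum>\<beta>\<in>B. c \<beta> * products F \<beta> s) = 0" and \<beta>: "\<beta> \<in> B"
    have "(\<Sum>\<beta>'\<in>B. c \<beta>' * products F \<beta>' (?f \<beta>)) = (\<Sum>\<beta>'\<in>B. if \<beta>' = \<beta> then c \<beta> else 0)"
    proof (rule sum.cong[OF refl])
      fix \<beta>' assume \<beta>': "\<beta>' \<in> B"
      have "products F \<beta>' (?f \<beta>) = (if ?f \<beta> = ?f \<beta>' then 1 else 0)"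
        by (cases \<beta>') (simp add: F_def products_single)
      moreover have "?f \<beta> = ?f \<beta>' \<longleftrightarrow> \<beta>' = \<beta>" using inj_onD[OF B(2) _ \<beta> \<beta>'] by blast
      ultimately show "c \<beta>' * products F \<beta>' (?f \<beta>) = (if \<beta>' = \<beta> then c \<beta> else 0)" by simp
    qed
    with h[of "?f \<beta>"] \<beta> fin show "c \<beta> = 0" by simp
  qed
  moreover have "F j \<in> forms d" for j using k by (auto simp: F_def forms_def mons_def)
  moreover have "c \<le> card B" using c B(2,3) by (simp add: card_image)
  ultimately show ?thesis using B(1) unfolding indep_bound_def by blast
qed

lemma indep_bound_one_variable:
  assumes "card (UNIV :: 'n::finite set) = 1" "0 < r"
  shows "indep_bound TYPE('n) TYPE('k::field) r d t 1"
proof -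
  obtain x :: 'n where True by blast
  show ?thesis
  proof (rule indep_bound_monomials[where k = "\<lambda>_. single x d"])
    have "single x t \<in> mons t" by (simp add: mons_def mdeg_single)
    then have "(\<lambda>(j, m). m + single x d) ` ({..<r} \<times> mons t) \<noteq> {}" using assms(2) by auto
    then show "1 \<le> card ((\<lambda>(j, m). m + single x d) ` ({..<r} \<times> mons t))"
      using card_mons(1)[of t, where 'n = 'n] by (simp add: Suc_le_eq card_gt_0_iff)
  qed (simp add: mons_def mdeg_single)
qed

lemma indep_bound_two_variables:
  assumes n: "card (UNIV :: 'n::finite set) = 2"
  shows "indep_bound TYPE('n) TYPE('k::field) r d t (min (d + t + 1) (r * (t + 1)))"
proof -
  obtain x y :: 'n where xy: "x \<noteq> y" "UNIV = {x, y}" using n card_2_iff by metis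
  define m where "m = (\<lambda>(c::nat) a. single x a + single y (c - a))"
  have mm: "m c a \<in> mons c" if "a \<le> c" for c a using that by (simp add: m_def mons_def mdeg_add mdeg_single)
  have mx: "lookup (m c a) x = a" for c a using xy by (simp add: m_def lookup_add lookup_single when_def)
  have add: "m t a + m d e = m (t + d) (a + e)" if "a \<le> t" "e \<le> d" for a e
    using that by (simp add: m_def single_add[symmetric] algebra_simps flip: add.assoc)
  \<comment> \<open>Multiples of x^(p j) y^(d - p j) occupy a window of t + 1 exponents of x from
    \<open>p j\<close> on. The windows are laid side by side, and those that would stick out are
    moved back to start at d.\<close>
  define p where "p = (\<lambda>j. min (j * (t + 1)) d)"
  define S where "S = (\<lambda>(j, a). a + p j) ` ({..<r} \<times> {..t})"
  have "m (t + d) ` S \<subseteq> (\<lambda>(j, k). k + m d (p j)) ` ({..<r} \<times> mons t)"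
  proof
    fix s assume "s \<in> m (t + d) ` S"
    then obtain j a where "j < r" "a \<le> t" "s = m (t + d) (a + p j)" by (auto simp: S_def)
    then have "s = m t a + m d (p j)" using add[of a "p j"] by (simp add: p_def)
    then show "s \<in> (\<lambda>(j, k). k + m d (p j)) ` ({..<r} \<times> mons t)"
      using \<open>j < r\<close> mm[OF \<open>a \<le> t\<close>] by (auto intro!: image_eqI[of _ _ "(j, m t a)"])
  qed
  moreover have "inj (m (t + d))" by (metis injI mx)
  moreover have "finite ((\<lambda>(j, k). k + m d (p j)) ` ({..<r} \<times> (mons t :: ('n \<Rightarrow>\<^sub>0 nat) set)))"
    using card_mons(1) by (intro finite_imageI finite_cartesian_product) auto
  ultimately have "card S \<le> card ((\<lambda>(j, k). k + m d (p j)) ` ({..<r} \<times> mons t))"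
    by (metis card_image card_mono inj_on_subset subset_UNIV)
  moreover have "min (d + t + 1) (r * (t + 1)) \<le> card S"
  proof (cases "r * (t + 1) \<le> d + t + 1")
    case True
    have p: "p j = j * (t + 1)" if "j < r" for j
    proof -
      have "Suc j * (t + 1) \<le> r * (t + 1)" using that by (intro mult_right_mono) auto
      with True show ?thesis by (simp add: p_def)
    qed
    have "inj_on (\<lambda>(j, a). a + p j) ({..<r} \<times> {..t})"
    proof (rule inj_onI, clarsimp simp: p)
      fix j a j' a' assume h: "a \<le> t" "a' \<le> t" "a + (j + j * t) = a' + (j' + j' * t)"
      have "(a + j * Suc t) div Suc t = j" "(a' + j' * Suc t) div Suc t = j'"
        using h(1,2) by (auto intro!: div_nat_eqI)
      moreover have "a + j * Suc t = a' + j' * Suc t" using h(3) by simp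
      ultimately have "j = j'" by metis
      with h(3) show "j = j' \<and> a = a'" by simp
    qed
    then have "card S = r * (t + 1)" unfolding S_def by (simp add: card_image)
    with True show ?thesis by simp
  next
    case False
    have "{..d + t} \<subseteq> S"
    proof
      fix e assume e: "e \<in> {..d + t}"
      define j where "j = e div (t + 1)"
      have ej: "e = j * (t + 1) + e mod (t + 1)" "e mod (t + 1) \<le> t"
        using mod_less_divisor[of "t + 1" e] by (simp_all only: j_def div_mult_mod_eq) auto
      show "e \<in> S"
      proof (cases "j * (t + 1) \<le> d")
        case True
        have "j < r"
        proof (rule ccontr)
          assume "\<not> j < r"
          then have "r * (t + 1) \<le> j * (t + 1)" by (intro mult_right_mono) auto
          with True False show False by linarith
        qed
        then show ?thesis using ej True unfolding S_def
          by (intro image_eqI[of _ _ "(j, e mod (t + 1))"]) (auto simp: p_def)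
      next
        \<comment> \<open>The regular window of e would start beyond d, so e lies in the last
          window, which starts at d.\<close>
        case F: False
        have "0 < r" using False by (auto intro: gr0I)
        then obtain r' where r': "r = Suc r'" by (cases r) auto
        have "r * (t + 1) = r' * (t + 1) + (t + 1)" by (simp add: r')
        then have "p r' = d" using False unfolding p_def by linarith
        moreover have "d \<le> e" "e - d \<le> t" using F ej e by auto
        ultimately show ?thesis using r' unfolding S_def
          by (intro image_eqI[of _ _ "(r', e - d)"]) auto
      qed
    qed
    then have "card {..d + t} \<le> card S" by (intro card_mono) (auto simp: S_def)
    then show ?thesis by simp
  qed
  ultimately show ?thesis
    by (intro indep_bound_monomials[where k = "\<lambda>j. m d (p j)"]) (auto intro: mm simp: p_def)
qed


subsection \<open>Ternary forms in a polynomial ring\<close>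

lemma shift_eq_0:
  assumes F: "\<And>j x y. F j x y \<noteq> 0 \<Longrightarrow> x + y \<le> d" and "\<not> (a \<le> u \<and> i \<le> v \<and> (u - a) + (v - i) \<le> d)"
  shows "shift F (j, a, i) (u, v) = 0"
proof (cases "a \<le> u \<and> i \<le> v")
  case True
  with assms(2) have "F j (u - a) (v - i) = 0" using F by blast
  then show ?thesis by (simp add: shift_def)
qed (auto simp: shift_def)

locale three_variables =
  fixes x y z :: "'n::finite"
  assumes xyz: "distinct [x, y, z]"
begin

text \<open>The two exponents of a dehomogenized form belong to x and z; y is the homogenizing
  variable.\<close>

definition em :: "nat \<Rightarrow> nat \<Rightarrow> nat \<Rightarrow> 'n \<Rightarrow>\<^sub>0 nat" where
  "em c a i = single x a + single z i + single y (c - a - i)"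

definition homog :: "nat \<Rightarrow> (nat \<Rightarrow> nat \<Rightarrow> 'k::field) \<Rightarrow> ('n, 'k) mpoly" where
  "homog d f = (\<Sum>(a, i)\<in>{(a, i). a + i < Suc d}. single (em d a i) (f a i))"

lemma lookup_em:
  "lookup (em c a i) x = a" "lookup (em c a i) z = i"
  "lookup (em c a i) y = c - a - i"
  "v \<noteq> x \<Longrightarrow> v \<noteq> y \<Longrightarrow> v \<noteq> z \<Longrightarrow> lookup (em c a i) v = 0"
  using xyz by (auto simp: em_def lookup_add lookup_single when_def)

lemma em_eqI:
  assumes "lookup m x = lookup m' x" "lookup m y = lookup m' y"
    "lookup m z = lookup m' z"
    "\<And>v. v \<noteq> x \<Longrightarrow> v \<noteq> y \<Longrightarrow> v \<noteq> z \<Longrightarrow> lookup m v = lookup m' v"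
  shows "m = m'"
proof (rule poly_mapping_eqI)
  show "lookup m v = lookup m' v" for v
    by (cases "v = x \<or> v = y \<or> v = z") (use assms in auto)
qed

lemma mdeg_em: "a + i \<le> c \<Longrightarrow> mdeg (em c a i) = c"
  by (simp add: em_def mdeg_add mdeg_single)

lemma lookup_homog:
  assumes "a + i \<le> d"
  shows "lookup (homog d f) (em d a i) = f a i"
proof -
  have eq: "em d a' i' = em d a i \<longleftrightarrow> a' = a \<and> i' = i" for a' i'
    using lookup_em by metis
  have "lookup (homog d f) (em d a i) =
      (\<Sum>r\<in>{(a, i). a + i < Suc d}. if r = (a, i) then f a i else 0)"
    unfolding homog_def lookup_sum by (intro sum.cong) (auto simp: lookup_single when_def eq split: if_splits)
  also have "\<dots> = f a i" using assms card_tri_region[of "Suc d"] by simp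
  finally show ?thesis .
qed

lemma keys_homog:
  assumes "k \<in> keys (homog d f)"
  shows "\<exists>a i. a + i \<le> d \<and> k = em d a i"
proof -
  have "k \<in> (\<Union>(a, i)\<in>{(a, i). a + i < Suc d}. keys (single (em d a i) (f a i)))"
    using assms keys_sum[of "\<lambda>(a, i). single (em d a i) (f a i)" "{(a, i). a + i < Suc d}"]
    unfolding homog_def by (auto simp: case_prod_unfold)
  then obtain a i where "a + i < Suc d" "k = em d a i" by (auto split: if_splits)
  then show ?thesis by (auto simp: less_Suc_eq_le)
qed

lemma homog_forms: "homog d f \<in> forms d"
  unfolding forms_def
proof (intro CollectI ballI)
  fix k assume "k \<in> keys (homog d f)"
  then obtain a i where "a + i \<le> d" "k = em d a i" using keys_homog by blast
  then show "mdeg k = d" by (simp add: mdeg_em)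
qed

text \<open>Homogenizing turns \<open>shift\<close> into multiplication by monomials. The common
  factor \<mu> will be the part of a multiplier in the variables other than x, y, z.\<close>

lemma product_homog:
  fixes F :: "nat \<Rightarrow> nat \<Rightarrow> nat \<Rightarrow> 'k::field"
  assumes F: "\<And>j x y. F j x y \<noteq> 0 \<Longrightarrow> x + y \<le> d" and "a + i \<le> t" "u + v \<le> d + t"
  shows "lookup (single (\<mu> + em t a i) 1 * homog d (F j)) (\<mu> + em (d + t) u v) =
    shift F (j, a, i) (u, v)"
proof (cases "a \<le> u \<and> i \<le> v \<and> (u - a) + (v - i) \<le> d")
  case True
  have "em (d + t) u v = em t a i + em d (u - a) (v - i)"
    by (rule em_eqI) (use True assms(2,3) in \<open>auto simp: lookup_add lookup_em\<close>)
  then have "\<mu> + em (d + t) u v = (\<mu> + em t a i) + em d (u - a) (v - i)" by (simp add: add.assoc)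
  then show ?thesis using True by (simp only: lookup_single_times_add lookup_homog) (simp add: shift_def)
next
  case False
  have "lookup (single (\<mu> + em t a i) 1 * homog d (F j)) (\<mu> + em (d + t) u v) = 0"
  proof (rule lookup_single_times_eq_0)
    fix k assume "k \<in> keys (homog d (F j))"
    then obtain a' i' where k: "a' + i' \<le> d" "k = em d a' i'" using keys_homog by blast
    show "\<mu> + em (d + t) u v \<noteq> \<mu> + em t a i + k"
    proof
      assume "\<mu> + em (d + t) u v = \<mu> + em t a i + k"
      then have "em (d + t) u v = em t a i + em d a' i'" by (simp add: add.assoc k)
      then have "u = a + a'" "v = i + i'" by (metis lookup_add lookup_em(1), metis lookup_add lookup_em(2))
      with False k show False by auto
    qed
  qed
  moreover have "shift F (j, a, i) (u, v) = 0" by (rule shift_eq_0[OF F False])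
  ultimately show ?thesis by simp
qed

text \<open>The forms involve only x, y, z, so a multiplier and the monomials of its product agree
  in all other variables. Relations therefore split according to \<mu>.\<close>

lemma product_homog_nonzero:
  assumes nz: "lookup (single m 1 * homog d f) (\<mu> + em (d + t) u v) \<noteq> 0"
    and \<mu>: "lookup \<mu> x = 0" "lookup \<mu> y = 0" "lookup \<mu> z = 0"
    and uv: "u + v \<le> d + t"
  shows "\<exists>a i. a + i \<le> t \<and> m = \<mu> + em t a i"
proof -
  obtain k where "k \<in> keys (homog d f)" and e: "\<mu> + em (d + t) u v = m + k"
    using nz lookup_single_times_eq_0 by metis
  then obtain a' i' where k: "a' + i' \<le> d" "k = em d a' i'" using keys_homog by blast
  have l: "lookup \<mu> w + lookup (em (d + t) u v) w =
    lookup m w + lookup (em d a' i') w" for w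
    using arg_cong[OF e, of "\<lambda>m. lookup m w"] by (simp add: lookup_add k)
  define a i where "a = lookup m x" and "i = lookup m z"
  have ai: "u = a + a'" "v = i + i'" "d + t - u - v = lookup m y + (d - a' - i')"
    using l[of x] l[of z] l[of y] \<mu> by (simp_all add: lookup_em a_def i_def)
  then have "a + i \<le> t" "lookup m y = t - a - i" using k(1) uv by linarith+
  moreover have "lookup m w = lookup \<mu> w" if "w \<noteq> x" "w \<noteq> y" "w \<noteq> z" for w
    using l[of w] that by (simp add: lookup_em)
  ultimately have "m = \<mu> + em t a i"
    by (intro em_eqI) (auto simp: lookup_add lookup_em \<mu> a_def i_def)
  with \<open>a + i \<le> t\<close> show ?thesis by blast
qed

lemma inj_em: "inj (\<lambda>(j, a, i). (j, \<mu> + em t a i))"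
proof (rule injI)
  fix p q :: "'a \<times> nat \<times> nat"
  obtain j a i j' a' i' where pq: "p = (j, a, i)" "q = (j', a', i')" by (cases p; cases q) auto
  assume "(\<lambda>(j, a, i). (j, \<mu> + em t a i)) p = (\<lambda>(j, a, i). (j, \<mu> + em t a i)) q"
  then have "j = j'" and e: "em t a i = em t a' i'" by (auto simp: pq)
  moreover have "a = a'" "i = i'"
    using arg_cong[OF e, of "\<lambda>m. lookup m x"] arg_cong[OF e, of "\<lambda>m. lookup m z"]
    by (simp_all add: lookup_em)
  ultimately show "p = q" by (simp add: pq)
qed

lemma lin_indep_homog:
  fixes F :: "nat \<Rightarrow> nat \<Rightarrow> nat \<Rightarrow> 'k::field"
  assumes F: "\<And>j x y. F j x y \<noteq> 0 \<Longrightarrow> x + y \<le> d"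
    and B: "B \<subseteq> UNIV \<times> {(a, i). a + i \<le> t}" "lin_indep B (shift F)"
  shows "lin_indep ((\<lambda>(j, a, i). (j, em t a i)) ` B) (products (\<lambda>j. homog d (F j)))"
proof (rule lin_indepI)
  let ?\<psi> = "\<lambda>(j, a, i). (j, em t a i)" and ?F = "\<lambda>j. homog d (F j)"
  have inj: "inj_on ?\<psi> B" using inj_on_subset[OF inj_em[of 0 t], of B] by simp
  fix c \<beta> assume h: "\<And>s. (\<Sum>\<beta>\<in>?\<psi> ` B. c \<beta> * products ?F \<beta> s) = 0" and "\<beta> \<in> ?\<psi> ` B"
  then obtain \<beta>' where \<beta>': "\<beta>' \<in> B" "\<beta> = ?\<psi> \<beta>'" by blast
  have "c (?\<psi> \<beta>') = 0"
  proof (rule lin_indepD[OF B(2) _ \<beta>'(1), of "\<lambda>\<beta>. c (?\<psi> \<beta>)"])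
    fix s :: "nat \<times> nat"
    obtain u v where s: "s = (u, v)" by (cases s)
    show "(\<Sum>\<beta>\<in>B. c (?\<psi> \<beta>) * shift F \<beta> s) = 0"
    proof (cases "u + v \<le> d + t")
      case True
      have "(\<Sum>\<beta>\<in>B. c (?\<psi> \<beta>) * shift F \<beta> s) = (\<Sum>\<beta>\<in>B. c (?\<psi> \<beta>) * products ?F (?\<psi> \<beta>) (em (d + t) u v))"
      proof (rule sum.cong[OF refl])
        fix \<beta> assume b: "\<beta> \<in> B"
        obtain j a i where \<beta>: "\<beta> = (j, a, i)" by (cases \<beta>)
        with b B(1) have "a + i \<le> t" by auto
        from product_homog[of F d a i t u v 0 j, OF F this True]
        show "c (?\<psi> \<beta>) * shift F \<beta> s = c (?\<psi> \<beta>) * products ?F (?\<psi> \<beta>) (em (d + t) u v)"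
          by (simp add: products_def \<beta> s)
      qed
      also have "\<dots> = (\<Sum>\<beta>\<in>?\<psi> ` B. c \<beta> * products ?F \<beta> (em (d + t) u v))"
        by (simp add: sum.reindex[OF inj])
      finally show ?thesis using h by simp
    next
      case False
      have "shift F \<beta> s = 0" if b: "\<beta> \<in> B" for \<beta>
      proof -
        obtain j a i where \<beta>: "\<beta> = (j, a, i)" by (cases \<beta>)
        with b B(1) have "a + i \<le> t" by auto
        then show ?thesis unfolding \<beta> s using False by (intro shift_eq_0[OF F]) auto
      qed
      then show ?thesis by simp
    qed
  qed
  then show "c \<beta> = 0" using \<beta>' by simp
qed

text \<open>
  In a relation \<open>\<Sum> g\<^sub>j F\<^sub>j + g w\<^sup>d = 0\<close> with \<open>F\<^sub>j \<in> k[x, y, z]\<close> the degree of every \<open>g\<^sub>j\<close> in \<open>w\<close> is less than \<open>d\<close>.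
  So \<open>\<Sum> g\<^sub>j F\<^sub>j = 0\<close>, and this holds for each coefficient in the variables other than \<open>x, y, z\<close>.
\<close>
lemma lin_indep_homog_power:
  fixes F :: "nat \<Rightarrow> nat \<Rightarrow> nat \<Rightarrow> 'k::field"
  assumes F: "\<And>j x y. F j x y \<noteq> 0 \<Longrightarrow> x + y \<le> d"
    and li: "lin_indep ({..<s} \<times> {(a, i). a + i \<le> t}) (shift F)"
    and w: "w \<notin> {x, y, z}" and td: "t < d"
  shows "lin_indep ({..<Suc s} \<times> mons t)
    (products (\<lambda>j. if j < s then homog d (F j) else single (single w d) 1))"
    (is "lin_indep _ (products ?G)")
proof (rule lin_indepI)
  fix c \<beta> assume h: "\<And>S. (\<Sum>\<beta>\<in>{..<Suc s} \<times> mons t. c \<beta> * products ?G \<beta> S) = 0"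
    and \<beta>: "\<beta> \<in> {..<Suc s} \<times> (mons t :: ('n \<Rightarrow>\<^sub>0 nat) set)"
  have finM: "finite ({..<Suc s} \<times> (mons t :: ('n \<Rightarrow>\<^sub>0 nat) set))" using card_mons(1) by auto
  have low: "c (j0, m0) = 0" if j0: "j0 < s" and m0: "m0 \<in> mons t" for j0 m0
  proof -
    obtain \<mu> where \<mu>: "lookup \<mu> = (\<lambda>v. if v \<in> {x, y, z} then 0 else lookup m0 v)"
      using poly_mapping_of_fun by blast
    define t' where "t' = lookup m0 x + lookup m0 y + lookup m0 z"
    define a0 i0 where "a0 = lookup m0 x" and "i0 = lookup m0 z"
    have ai0: "a0 + i0 \<le> t'" by (simp add: t'_def a0_def i0_def)
    have m0_eq: "m0 = \<mu> + em t' a0 i0"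
      by (rule em_eqI) (auto simp: lookup_add lookup_em \<mu> t'_def a0_def i0_def)
    have t: "mdeg \<mu> + t' = t" using m0 mdeg_em[OF ai0] by (simp add: mons_def m0_eq mdeg_add)
    have \<mu>0: "lookup \<mu> x = 0" "lookup \<mu> y = 0" "lookup \<mu> z = 0"
      by (simp_all add: \<mu>)
    have "lookup \<mu> w \<le> mdeg \<mu>" by (intro member_le_sum) auto
    with t td have \<mu>w: "lookup \<mu> w < d" by simp
    let ?\<psi> = "\<lambda>(j, a, i). (j, \<mu> + em t' a i)"
    define A where "A = {..<s} \<times> {(a, i). a + i \<le> t'}"
    \<comment> \<open>The multipliers with outer part \<mu> have degree t' \<le> t in x, y, z.
      Dehomogenized, they are among those of degree t, and the coefficients are extended by
      zero.\<close>
    define c' where "c' = (\<lambda>\<beta>. if \<beta> \<in> A then c (?\<psi> \<beta>) else 0)"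
    have finA: "finite ({..<s} \<times> {(a, i). a + i \<le> t})"
      using card_tri_region[of "Suc t"] by (simp add: less_Suc_eq_le)
    have "c' (j0, a0, i0) = 0"
    proof (rule lin_indepD[OF li])
      show "(j0, a0, i0) \<in> {..<s} \<times> {(a, i). a + i \<le> t}" using j0 ai0 t by auto
      fix S :: "nat \<times> nat"
      obtain u v where S: "S = (u, v)" by (cases S)
      have AA: "A \<subseteq> {..<s} \<times> {(a, i). a + i \<le> t}" using t by (auto simp: A_def)
      have "(\<Sum>\<beta>\<in>{..<s} \<times> {(a, i). a + i \<le> t}. c' \<beta> * shift F \<beta> S) = (\<Sum>\<beta>\<in>A. c (?\<psi> \<beta>) * shift F \<beta> S)"
        using AA finA by (intro sum.mono_neutral_cong_right) (auto simp: c'_def)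
      also have "\<dots> = 0"
      proof (cases "u + v \<le> d + t'")
        case True
        have "(\<Sum>\<beta>\<in>A. c (?\<psi> \<beta>) * shift F \<beta> S) = (\<Sum>\<beta>\<in>A. c (?\<psi> \<beta>) * products ?G (?\<psi> \<beta>) (\<mu> + em (d + t') u v))"
        proof (rule sum.cong[OF refl])
          fix \<beta> assume b: "\<beta> \<in> A"
          obtain j a i where \<beta>: "\<beta> = (j, a, i)" by (cases \<beta>)
          with b have "j < s" "a + i \<le> t'" by (auto simp: A_def)
          with product_homog[of F d a i t' u v \<mu> j, OF F _ True]
          show "c (?\<psi> \<beta>) * shift F \<beta> S = c (?\<psi> \<beta>) * products ?G (?\<psi> \<beta>) (\<mu> + em (d + t') u v)"
            by (simp add: products_def \<beta> S)
        qed
        also have "\<dots> = (\<Sum>\<beta>\<in>?\<psi> ` A. c \<beta> * products ?G \<beta> (\<mu> + em (d + t') u v))"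
          by (subst sum.reindex) (auto intro: inj_on_subset[OF inj_em])
        also have "\<dots> = (\<Sum>\<beta>\<in>{..<Suc s} \<times> mons t. c \<beta> * products ?G \<beta> (\<mu> + em (d + t') u v))"
        proof (rule sum.mono_neutral_left[OF finM])
          show "?\<psi> ` A \<subseteq> {..<Suc s} \<times> mons t"
            using t mdeg_em by (auto simp: A_def mons_def mdeg_add)
          show "\<forall>\<beta>\<in>{..<Suc s} \<times> mons t - ?\<psi> ` A. c \<beta> * products ?G \<beta> (\<mu> + em (d + t') u v) = 0"
          proof
            fix \<beta> assume b: "\<beta> \<in> {..<Suc s} \<times> mons t - ?\<psi> ` A"
            obtain j m where \<beta>: "\<beta> = (j, m)" by (cases \<beta>)
            have "products ?G \<beta> (\<mu> + em (d + t') u v) = 0"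
            proof (rule ccontr)
              assume nz: "products ?G \<beta> (\<mu> + em (d + t') u v) \<noteq> 0"
              show False
              proof (cases "j < s")
                case True
                with nz have "lookup (single m 1 * homog d (F j)) (\<mu> + em (d + t') u v) \<noteq> 0"
                  by (simp add: products_def \<beta>)
                from product_homog_nonzero[OF this \<mu>0 \<open>u + v \<le> d + t'\<close>]
                obtain a i where "a + i \<le> t'" "m = \<mu> + em t' a i" by blast
                then have "\<beta> \<in> ?\<psi> ` A" using True by (auto simp: A_def \<beta> intro!: image_eqI[of _ _ "(j, a, i)"])
                with b show False by blast
              next
                case False
                with nz have "\<mu> + em (d + t') u v = m + single w d"
                  by (simp add: products_def \<beta> mult_single lookup_single when_def split: if_splits)
                from arg_cong[OF this, of "\<lambda>m. lookup m w"] \<mu>w w show False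
                  by (simp add: lookup_add lookup_em)
              qed
            qed
            then show "c \<beta> * products ?G \<beta> (\<mu> + em (d + t') u v) = 0" by simp
          qed
        qed
        also have "\<dots> = 0" by (rule h)
        finally show ?thesis .
      next
        case False
        have "shift F \<beta> S = 0" if b: "\<beta> \<in> A" for \<beta>
        proof -
          obtain j a i where \<beta>: "\<beta> = (j, a, i)" by (cases \<beta>)
          with b have "a + i \<le> t'" by (auto simp: A_def)
          then show ?thesis unfolding \<beta> S using False by (intro shift_eq_0[OF F]) auto
        qed
        then show ?thesis by simp
      qed
      finally show "(\<Sum>\<beta>\<in>{..<s} \<times> {(a, i). a + i \<le> t}. c' \<beta> * shift F \<beta> S) = 0" .
    qed
    then show ?thesis using j0 ai0 by (simp add: c'_def A_def m0_eq)
  qed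
  obtain j m where jm: "\<beta> = (j, m)" "j \<le> s" "m \<in> mons t" using \<beta> by (cases \<beta>) auto
  show "c \<beta> = 0"
  proof (cases "j < s")
    case True
    then show ?thesis using low jm by simp
  next
    case False
    \<comment> \<open>Only multiples of w^d are left, and these are distinct monomials.\<close>
    have "(\<Sum>\<beta>'\<in>{..<Suc s} \<times> mons t. c \<beta>' * products ?G \<beta>' (m + single w d)) =
        (\<Sum>\<beta>'\<in>{..<Suc s} \<times> mons t. if \<beta>' = (s, m) then c (s, m) else 0)"
    proof (rule sum.cong[OF refl])
      fix \<beta>' assume b: "\<beta>' \<in> {..<Suc s} \<times> (mons t :: ('n \<Rightarrow>\<^sub>0 nat) set)"
      obtain j' m' where \<beta>': "\<beta>' = (j', m')" by (cases \<beta>')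
      show "c \<beta>' * products ?G \<beta>' (m + single w d) = (if \<beta>' = (s, m) then c (s, m) else 0)"
      proof (cases "j' < s")
        case True
        then show ?thesis using low b \<beta>' by auto
      next
        case False
        then have "j' = s" using b \<beta>' by auto
        then show ?thesis
          by (auto simp: \<beta>' products_def mult_single lookup_single when_def)
      qed
    qed
    then have "c (s, m) = 0" using h finM jm by simp
    moreover have "j = s" using False jm by simp
    ultimately show ?thesis using jm by simp
  qed
qed

end

lemma obtain_distinct_elements:
  assumes "k \<le> card (UNIV :: 'n::finite set)"
  shows "\<exists>l :: 'n list. distinct l \<and> length l = k"
proof -
  obtain l :: "'n list" where l: "set l = UNIV" "distinct l" using finite_distinct_list[of "UNIV :: 'n set"] by auto
  then have "length l = card (UNIV :: 'n set)" using distinct_card by metis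
  then show ?thesis using l assms by (intro exI[of _ "take k l"]) simp
qed

lemma indep_bound_three_variables:
  assumes inf: "infinite (UNIV :: 'k::field set)" and n: "3 \<le> card (UNIV :: 'n::finite set)"
    and r: "4 \<le> r" "5 \<le> r \<Longrightarrow> t \<le> d"
  shows "indep_bound TYPE('n) TYPE('k) r d t (min (d + t + 2 choose 2) (r * (t + 2 choose 2)))"
proof -
  obtain l :: "'n list" where l: "distinct l" "length l = 3" using obtain_distinct_elements[OF n] by blast
  have "distinct [l ! 0, l ! 1, l ! 2]" using l by (auto simp: nth_eq_iff_index_eq)
  then interpret three_variables "l ! 0" "l ! 1" "l ! 2" by unfold_locales
  obtain F :: "nat \<Rightarrow> nat \<Rightarrow> nat \<Rightarrow> 'k" and B where F: "\<forall>j x y. F j x y \<noteq> 0 \<longrightarrow> x + y \<le> d"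
    and B: "B \<subseteq> {..<r} \<times> {(a, i). a + i \<le> t}" "lin_indep B (shift F)"
      "min (r * (t + 2 choose 2)) (d + t + 2 choose 2) \<le> card B"
    using ternary_forms[OF inf r] by blast
  let ?\<psi> = "\<lambda>(j, a, i). (j, em t a i)"
  have "inj_on ?\<psi> B" using inj_on_subset[OF inj_em[of 0 t], of B] by simp
  then have "card (?\<psi> ` B) = card B" by (rule card_image)
  moreover have "?\<psi> ` B \<subseteq> {..<r} \<times> mons t" using B(1) mdeg_em by (auto simp: mons_def)
  moreover have "lin_indep (?\<psi> ` B) (products (\<lambda>j. homog d (F j)))"
    by (rule lin_indep_homog) (use F B in auto)
  ultimately show ?thesis using B(3) homog_forms unfolding indep_bound_def
    by (intro exI[of _ "\<lambda>j. homog d (F j)"] exI[of _ "?\<psi> ` B"]) (auto simp: min.commute)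
qed

lemma indep_bound_four_variables:
  assumes inf: "infinite (UNIV :: 'k::field set)" and n: "4 \<le> card (UNIV :: 'n::finite set)"
    and s: "4 \<le> s" "s * (t + 2 choose 2) \<le> d + t + 2 choose 2" and td: "t < d"
  shows "indep_bound TYPE('n) TYPE('k) (Suc s) d t (Suc s * card (mons t :: ('n \<Rightarrow>\<^sub>0 nat) set))"
proof -
  obtain l :: "'n list" where l: "distinct l" "length l = 4" using obtain_distinct_elements[OF n] by blast
  have "distinct [l ! 0, l ! 1, l ! 2]" using l by (auto simp: nth_eq_iff_index_eq)
  then interpret three_variables "l ! 0" "l ! 1" "l ! 2" by unfold_locales
  have w: "l ! 3 \<notin> {l ! 0, l ! 1, l ! 2}" using l by (auto simp: nth_eq_iff_index_eq)
  let ?A = "{..<s} \<times> {(a, i). a + i \<le> t}"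
  obtain F :: "nat \<Rightarrow> nat \<Rightarrow> nat \<Rightarrow> 'k" and B where F: "\<forall>j x y. F j x y \<noteq> 0 \<longrightarrow> x + y \<le> d"
    and B: "B \<subseteq> ?A" "lin_indep B (shift F)" "min (s * (t + 2 choose 2)) (d + t + 2 choose 2) \<le> card B"
    using ternary_forms[OF inf s(1), of t d] td by auto
  have A: "finite ?A" "card ?A = s * (t + 2 choose 2)"
    using card_tri_region[of "Suc t"] by (auto simp: less_Suc_eq_le card_cartesian_product)
  \<comment> \<open>By the assumption on s the minimum is the number of all products.\<close>
  then have "B = ?A" using B(1,3) s(2) by (intro card_seteq) auto
  define G where "G = (\<lambda>j. if j < s then homog d (F j) else single (single (l ! 3) d) 1)"
  have "lin_indep ({..<Suc s} \<times> mons t) (products G)" unfolding G_def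
    by (rule lin_indep_homog_power[OF _ _ w td]) (use F B(2) \<open>B = ?A\<close> in auto)
  moreover have "G j \<in> forms d" for j
    unfolding G_def using homog_forms by (auto simp: forms_def mdeg_single)
  ultimately show ?thesis unfolding indep_bound_def
    by (intro exI[of _ G] exI[of _ "{..<Suc s} \<times> mons t"]) (simp add: card_cartesian_product)
qed


subsection \<open>Zariski openness\<close>

lemma lookup_const_times:
  "lookup (const e * f) s = e * lookup (f :: ('v, 'k::field) mpoly) s"
  unfolding const_def using lookup_single_times_add[of 0 e f s] unfolding add_0_left .

lemma products_add_scale:
  fixes F G :: "nat \<Rightarrow> ('n::finite, 'k::field) mpoly"
  shows "products (\<lambda>j. F j + const e * G j) \<beta> s = products F \<beta> s + e * products G \<beta> s"
proof -
  obtain j m where \<beta>: "\<beta> = (j, m)" by (cases \<beta>)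
  have "single m 1 * (F j + const e * G j) =
      single m 1 * F j + const e * (single m 1 * G j)"
    by (simp add: algebra_simps)
  then show ?thesis by (simp add: products_def \<beta> lookup_add lookup_const_times)
qed

lemma keys_const_times: "keys (const e * f) \<subseteq> keys (f :: ('v, 'k::field) mpoly)"
  by (rule subsetI) (simp add: in_keys_iff lookup_const_times)

lemma subspace_forms: "mpoly.subspace (forms d :: ('n::finite, 'k::field) mpoly set)"
proof (rule mpoly.subspaceI)
  fix f g :: "('n, 'k) mpoly" and c
  assume "f \<in> forms d" "g \<in> forms d"
  then show "f + g \<in> forms d" using keys_add[of f g] unfolding forms_def by blast
  show "const c * f \<in> forms d" using \<open>f \<in> forms d\<close> keys_const_times unfolding forms_def by blast
qed (simp add: forms_def)

text \<open>Induction on t0: a tuple F for the degrees up to t0 and a tuple G for the next degree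
  are joined by F + e G. The conditions for F hold at e = 0, the one for G at infinity, so all hold
  for almost every e.\<close>

lemma common_forms:
  assumes inf: "infinite (UNIV :: 'k::field set)"
    and ex: "\<And>t. t \<le> t0 \<Longrightarrow> indep_bound TYPE('n::finite) TYPE('k) r d t (c t)"
  shows "\<exists>F :: nat \<Rightarrow> ('n, 'k) mpoly. (\<forall>j. F j \<in> forms d) \<and>
    (\<forall>t\<le>t0. \<exists>B\<subseteq>{..<r} \<times> mons t. lin_indep B (products F) \<and> c t \<le> card B)"
  using ex
proof (induction t0)
  case 0
  then show ?case unfolding indep_bound_def by (metis le_zero_eq)
next
  case (Suc t0)
  obtain F :: "nat \<Rightarrow> ('n, 'k) mpoly" where F: "\<And>j. F j \<in> forms d"
    "\<forall>t\<le>t0. \<exists>B\<subseteq>{..<r} \<times> mons t. lin_indep B (products F) \<and> c t \<le> card B"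
    using Suc by fastforce
  then obtain B where B: "\<And>t. t \<le> t0 \<Longrightarrow> B t \<subseteq> {..<r} \<times> mons t \<and> lin_indep (B t) (products F) \<and> c t \<le> card (B t)"
    by metis
  obtain G :: "nat \<Rightarrow> ('n, 'k) mpoly" and C where G: "\<And>j. G j \<in> forms d"
    and C: "C \<subseteq> {..<r} \<times> mons (Suc t0)" "lin_indep C (products G)" "c (Suc t0) \<le> card C"
    using Suc.prems[of "Suc t0"] unfolding indep_bound_def by auto
  define H where "H = (\<lambda>e j. F j + const e * G j)"
  have H: "products (H e) = (\<lambda>\<beta> s. products F \<beta> s + e * products G \<beta> s)" for e
    unfolding H_def by (intro ext) (rule products_add_scale)
  have fin: "finite A" if "A \<subseteq> {..<r} \<times> (mons t :: ('n \<Rightarrow>\<^sub>0 nat) set)" for A t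
    using that card_mons(1) finite_subset by blast
  have "finite {e. \<not> lin_indep (B t) (products (H e))}" if "t \<le> t0" for t
    unfolding H using B[OF that] fin by (intro finite_deform_at_0) auto
  moreover have "finite {e. \<not> lin_indep C (products (H e))}"
    unfolding H using C fin by (intro finite_deform_at_infinity) auto
  ultimately have "finite ((\<Union>t\<le>t0. {e. \<not> lin_indep (B t) (products (H e))}) \<union> {e. \<not> lin_indep C (products (H e))})"
    by simp
  from ex_new_if_finite[OF inf this] obtain e where
    "\<And>t. t \<le> t0 \<Longrightarrow> lin_indep (B t) (products (H e))" "lin_indep C (products (H e))" by auto
  then have "\<exists>B\<subseteq>{..<r} \<times> mons t. lin_indep B (products (H e)) \<and> c t \<le> card B" if "t \<le> Suc t0" for t
    using that B C by (cases "t = Suc t0") (auto simp: le_Suc_eq)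
  moreover have "H e j \<in> forms d" for j
    unfolding H_def using F(1) G subspace_forms
    by (intro mpoly.subspace_add mpoly.subspace_scale) auto
  ultimately show ?case by (intro exI[of _ "H e"]) simp
qed

section \<open>Evaluation is a ring homomorphism\<close>

lemma eval_mpoly_superset:
  assumes "finite A" "keys p \<subseteq> A"
  shows "eval_mpoly a p = (\<Sum>m\<in>A. lookup p m *
    (\<Prod>v\<in>keys m. a v ^ lookup m v))"
  unfolding eval_mpoly_def
  by (rule sum.mono_neutral_left[OF assms]) (simp add: not_in_keys_iff_lookup_eq_zero)

lemma eval_mpoly_diff: "eval_mpoly a (p - q) = eval_mpoly a p - eval_mpoly a q"
proof -
  let ?A = "keys p \<union> keys q"
  have "keys (p - q) \<subseteq> ?A" by (rule keys_diff)
  then show ?thesis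
    by (subst (1 2 3) eval_mpoly_superset[of ?A])
      (simp_all add: lookup_minus left_diff_distrib sum_subtractf)
qed

lemma eval_mpoly_0: "eval_mpoly a 0 = 0"
  by (simp add: eval_mpoly_def)

lemma eval_mpoly_add: "eval_mpoly a (p + q) = eval_mpoly a p + eval_mpoly a q"
proof -
  have "eval_mpoly a (- q) = - eval_mpoly a q" for q using eval_mpoly_diff[of a 0 q] by (simp add: eval_mpoly_0)
  then show ?thesis using eval_mpoly_diff[of a p "- q"] by simp
qed

lemma eval_mpoly_sum: "eval_mpoly a (\<Sum>i\<in>I. p i) = (\<Sum>i\<in>I. eval_mpoly a (p i))"
  by (induction I rule: infinite_finite_induct) (simp_all add: eval_mpoly_0 eval_mpoly_add)

lemma eval_mpoly_single:
  "eval_mpoly a (single m c) = c * (\<Prod>v\<in>keys m. a v ^ lookup m v)"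
  by (simp add: eval_mpoly_def)

lemma eval_mpoly_1: "eval_mpoly a 1 = 1"
  using eval_mpoly_single[of a 0 1] by simp

lemma monomial_value_add:
  fixes a :: "'v \<Rightarrow> 'k::field" and m m' :: "'v \<Rightarrow>\<^sub>0 nat"
  shows "(\<Prod>v\<in>keys (m + m'). a v ^ lookup (m + m') v) =
    (\<Prod>v\<in>keys m. a v ^ lookup m v) *
    (\<Prod>v\<in>keys m'. a v ^ lookup m' v)"
proof -
  let ?A = "keys m \<union> keys m'"
  have sup: "(\<Prod>v\<in>keys k. a v ^ lookup k v) = (\<Prod>v\<in>?A. a v ^ lookup k v)"
    if "keys k \<subseteq> ?A" for k :: "'v \<Rightarrow>\<^sub>0 nat"
    using that by (intro prod.mono_neutral_left) (simp_all add: not_in_keys_iff_lookup_eq_zero)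
  show ?thesis
    by (subst (1 2 3) sup) (use keys_add[of m m'] in \<open>auto simp: lookup_add power_add prod.distrib\<close>)
qed

lemma eval_mpoly_mult: "eval_mpoly a (p * q) = eval_mpoly a p * eval_mpoly (a :: 'v \<Rightarrow> 'k::field) q"
proof -
  let ?s = "\<lambda>p m. single m (lookup p m)"
  have "p * q = (\<Sum>m\<in>keys p. ?s p m) * (\<Sum>m\<in>keys q. ?s q m)"
    by (simp add: sum_single_lookup)
  also have "\<dots> = (\<Sum>m\<in>keys p. \<Sum>k\<in>keys q.
      single (m + k) (lookup p m * lookup q k))"
    by (simp add: sum_product mult_single)
  finally have "eval_mpoly a (p * q) = (\<Sum>m\<in>keys p. \<Sum>k\<in>keys q.
      eval_mpoly a (?s p m) * eval_mpoly a (?s q k))"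
    by (simp add: eval_mpoly_sum eval_mpoly_single monomial_value_add mult_ac)
  also have "\<dots> = eval_mpoly a (\<Sum>m\<in>keys p. ?s p m) * eval_mpoly a (\<Sum>m\<in>keys q. ?s q m)"
    by (simp add: eval_mpoly_sum sum_product)
  finally show ?thesis by (simp add: sum_single_lookup)
qed

lemma eval_mpoly_prod: "eval_mpoly a (\<Prod>i\<in>I. p i) = (\<Prod>i\<in>I. eval_mpoly (a :: 'v \<Rightarrow> 'k::field) (p i))"
  by (induction I rule: infinite_finite_induct) (simp_all add: eval_mpoly_1 eval_mpoly_mult)

text \<open>Every coefficient of a product of a monomial and a form is 0 or a coefficient of the
  form, hence a coordinate, so the elimination yields a polynomial in the coordinates.\<close>

lemma lin_indep_products_open:
  fixes F0 :: "nat \<Rightarrow> ('n::finite, 'k::field) mpoly"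
  assumes B: "B \<subseteq> {..<r} \<times> mons t" "lin_indep B (products F0)"
  shows "\<exists>p. eval_mpoly (coeff_coords r F0) p \<noteq> 0 \<and>
    (\<forall>F. eval_mpoly (coeff_coords r F) p \<noteq> 0 \<longrightarrow> lin_indep B (products F))"
proof -
  define \<P> where "\<P> = range (\<lambda>p (F :: nat \<Rightarrow> ('n, 'k) mpoly). eval_mpoly (coeff_coords r F) p)"
  have "\<exists>D\<in>\<P>. D F0 \<noteq> 0 \<and> (\<forall>F. D F \<noteq> 0 \<longrightarrow> lin_indep B (\<lambda>\<beta> s. products F \<beta> s))"
  proof (rule lin_indep_open)
    show "finite B" using B(1) card_mons(1) finite_subset by blast
    have "(\<lambda>_. 1) = (\<lambda>F :: nat \<Rightarrow> ('n, 'k) mpoly. eval_mpoly (coeff_coords r F) 1)"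
      by (simp add: eval_mpoly_1)
    then show "(\<lambda>_. 1) \<in> \<P>" unfolding \<P>_def by blast
    fix f g assume "f \<in> \<P>" "g \<in> \<P>"
    then obtain p q where "f = (\<lambda>F. eval_mpoly (coeff_coords r F) p)" "g = (\<lambda>F. eval_mpoly (coeff_coords r F) q)"
      unfolding \<P>_def by blast
    then have "(\<lambda>x. f x * g x) = (\<lambda>F. eval_mpoly (coeff_coords r F) (p * q))"
      "(\<lambda>x. f x - g x) = (\<lambda>F. eval_mpoly (coeff_coords r F) (p - q))"
      by (simp_all add: eval_mpoly_mult eval_mpoly_diff)
    then show "(\<lambda>x. f x * g x) \<in> \<P>" "(\<lambda>x. f x - g x) \<in> \<P>"
      unfolding \<P>_def by blast+
  next
    fix \<beta> s assume "\<beta> \<in> B"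
    then obtain j m where \<beta>: "\<beta> = (j, m)" "j < r" using B(1) by auto
    show "(\<lambda>F. products F \<beta> s) \<in> \<P>"
    proof (cases "\<exists>k. s = m + k")
      case True
      then obtain k where s: "s = m + k" by blast
      have "products F \<beta> s = eval_mpoly (coeff_coords r F) (single (single (j, k) 1) 1)" for F
        by (simp add: products_def \<beta> s lookup_single_times_add eval_mpoly_single coeff_coords_def)
      then show ?thesis unfolding \<P>_def by blast
    next
      case False
      then have "products F \<beta> s = eval_mpoly (coeff_coords r F) 0" for F
        by (simp add: products_def \<beta> lookup_single_times_eq_0 eval_mpoly_0)
      then show ?thesis unfolding \<P>_def by blast
    qed
  qed (use B(2) in simp)
  then show ?thesis unfolding \<P>_def by auto
qed

lemma for_general_forms_indep:
  assumes inf: "infinite (UNIV :: 'k::field set)"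
    and ex: "\<And>t. t \<le> t0 \<Longrightarrow> indep_bound TYPE('n::finite) TYPE('k) r d t (c t)"
    and P: "\<And>F :: nat \<Rightarrow> ('n, 'k) mpoly. (\<And>j. j < r \<Longrightarrow> F j \<in> forms d) \<Longrightarrow>
      (\<And>t. t \<le> t0 \<Longrightarrow> \<exists>B\<subseteq>{..<r} \<times> mons t. lin_indep B (products F) \<and> c t \<le> card B) \<Longrightarrow> P F"
  shows "for_general_forms r d P"
proof -
  obtain F0 :: "nat \<Rightarrow> ('n, 'k) mpoly" where F0: "\<And>j. F0 j \<in> forms d"
    "\<forall>t\<le>t0. \<exists>B\<subseteq>{..<r} \<times> mons t. lin_indep B (products F0) \<and> c t \<le> card B"
    using common_forms[OF inf ex] by blast
  then obtain B where B: "\<And>t. t \<le> t0 \<Longrightarrow> B t \<subseteq> {..<r} \<times> mons t \<and> lin_indep (B t) (products F0) \<and> c t \<le> card (B t)"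
    by metis
  then have "\<forall>t\<le>t0. \<exists>p. eval_mpoly (coeff_coords r F0) p \<noteq> 0 \<and>
      (\<forall>F. eval_mpoly (coeff_coords r F) p \<noteq> 0 \<longrightarrow> lin_indep (B t) (products F))"
    using lin_indep_products_open by blast
  then obtain p where p: "\<And>t. t \<le> t0 \<Longrightarrow> eval_mpoly (coeff_coords r F0) (p t) \<noteq> 0 \<and>
      (\<forall>F. eval_mpoly (coeff_coords r F) (p t) \<noteq> 0 \<longrightarrow> lin_indep (B t) (products F))"
    by metis
  \<comment> \<open>Finitely many open conditions are joined by multiplying their
    polynomials.\<close>
  define U where "U = {F \<in> form_tuples r d. \<exists>q\<in>{\<Prod>t\<le>t0. p t}. eval_mpoly (coeff_coords r F) q \<noteq> 0}"
  have "zariski_open r d U" unfolding zariski_open_def U_def by blast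
  \<comment> \<open>Tuples in \<open>form_tuples\<close> are undefined outside the first r indices,
    and the coordinates do not see this change.\<close>
  moreover have "restrict F0 {..<r} \<in> U"
  proof -
    have "coeff_coords r (restrict F0 {..<r}) = coeff_coords r F0" by (auto simp: coeff_coords_def fun_eq_iff)
    then show ?thesis using p F0(1) by (auto simp: U_def form_tuples_def eval_mpoly_prod)
  qed
  moreover have "P F" if F: "F \<in> U" for F
  proof (rule P)
    show "F j \<in> forms d" if "j < r" for j using F that by (auto simp: U_def form_tuples_def)
    fix t assume t: "t \<le> t0"
    have "eval_mpoly (coeff_coords r F) (p t) \<noteq> 0" using F t by (auto simp: U_def eval_mpoly_prod)
    then show "\<exists>B\<subseteq>{..<r} \<times> mons t. lin_indep B (products F) \<and> c t \<le> card B" using p[OF t] B[OF t] by blast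
  qed
  ultimately show ?thesis unfolding for_general_forms_def by blast
qed


subsection \<open>Dimensions\<close>

lemma lin_indep_imp_independent:
  fixes v :: "'b \<Rightarrow> ('n, 'k::field) mpoly"
  assumes fin: "finite B" and li: "lin_indep B (\<lambda>\<beta>. lookup (v \<beta>))"
  shows "inj_on v B" "mpoly.independent (v ` B)"
proof -
  show inj: "inj_on v B"
  proof (rule inj_onI, rule ccontr)
    fix \<beta> \<beta>' assume b: "\<beta> \<in> B" "\<beta>' \<in> B" "v \<beta> = v \<beta>'" "\<beta> \<noteq> \<beta>'"
    define c :: "'b \<Rightarrow> 'k" where "c = (\<lambda>\<gamma>. if \<gamma> = \<beta> then 1 else if \<gamma> = \<beta>' then - 1 else 0)"
    have "(\<Sum>\<gamma>\<in>B. c \<gamma> * lookup (v \<gamma>) s) = 0" for s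
    proof -
      have "(\<Sum>\<gamma>\<in>B. c \<gamma> * lookup (v \<gamma>) s) = (\<Sum>\<gamma>\<in>{\<beta>, \<beta>'}. c \<gamma> * lookup (v \<gamma>) s)"
        using fin b by (intro sum.mono_neutral_right) (auto simp: c_def)
      then show ?thesis using b by (simp add: c_def)
    qed
    from lin_indepD[OF li this b(1)] show False by (simp add: c_def)
  qed
  show "mpoly.independent (v ` B)"
  proof (rule mpoly.independent_if_scalars_zero)
    fix u f assume u: "(\<Sum>f\<in>v ` B. const (u f) * f) = 0" and "f \<in> v ` B"
    then obtain \<beta> where \<beta>: "\<beta> \<in> B" "f = v \<beta>" by blast
    have "(\<Sum>\<beta>\<in>B. u (v \<beta>) * lookup (v \<beta>) s) = 0" for s
      using arg_cong[OF u, of "\<lambda>f. lookup f s"]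
      by (simp add: sum.reindex[OF inj] lookup_sum lookup_const_times)
    from lin_indepD[OF li this \<beta>(1)] \<beta>(2) show "u f = 0" by simp
  qed (use fin in simp)
qed

lemma scale_single: "const c * single m 1 = single m (c :: 'k::field)"
  by (simp add: const_def mult_single)

lemma span_monomials:
  "mpoly.span ((\<lambda>m. single m 1) ` mons t) = (forms t :: ('n::finite, 'k::field) mpoly set)"
proof (intro equalityI subsetI)
  fix f :: "('n, 'k) mpoly" assume "f \<in> mpoly.span ((\<lambda>m. single m 1) ` mons t)"
  moreover have "mpoly.span ((\<lambda>m. single m 1) ` mons t) \<subseteq> (forms t :: ('n, 'k) mpoly set)"
    by (rule mpoly.span_minimal[OF _ subspace_forms]) (auto simp: forms_def mons_def)
  ultimately show "f \<in> forms t" by blast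
next
  fix f :: "('n, 'k) mpoly" assume f: "f \<in> forms t"
  have "(\<Sum>m\<in>keys f. const (lookup f m) * single m 1)
      \<in> mpoly.span ((\<lambda>m. single m 1) ` mons t)"
    using f by (intro mpoly.span_sum mpoly.span_scale mpoly.span_base) (auto simp: forms_def mons_def)
  then show "f \<in> mpoly.span ((\<lambda>m. single m 1) ` mons t)"
    by (simp add: scale_single sum_single_lookup)
qed

lemma monomials_independent:
  "inj_on (\<lambda>m. single m (1 :: 'k::field)) (mons t :: ('n::finite \<Rightarrow>\<^sub>0 nat) set)"
  "mpoly.independent ((\<lambda>m. single m (1 :: 'k::field)) ` (mons t :: ('n::finite \<Rightarrow>\<^sub>0 nat) set))"
proof -
  let ?M = "mons t :: ('n \<Rightarrow>\<^sub>0 nat) set"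
  have fin: "finite ?M" by (rule card_mons)
  have "lin_indep ?M (\<lambda>m. lookup (single m (1 :: 'k)))"
  proof (rule lin_indepI)
    fix c \<beta> assume h: "\<And>s. (\<Sum>\<beta>\<in>?M. c \<beta> * lookup (single \<beta> (1 :: 'k)) s) = 0" "\<beta> \<in> ?M"
    have "(\<Sum>\<beta>'\<in>?M. c \<beta>' * lookup (single \<beta>' (1 :: 'k)) \<beta>) =
        (\<Sum>\<beta>'\<in>?M. if \<beta>' = \<beta> then c \<beta> else 0)"
      by (intro sum.cong) (auto simp: lookup_single when_def)
    with h fin show "c \<beta> = 0" by simp
  qed
  from lin_indep_imp_independent[OF fin this]
  show "inj_on (\<lambda>m. single m (1 :: 'k)) ?M"
    "mpoly.independent ((\<lambda>m. single m (1 :: 'k)) ` ?M)" by auto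
qed

definition multiples :: "nat \<Rightarrow> (nat \<Rightarrow> ('n::finite, 'k::field) mpoly) \<Rightarrow> nat \<Rightarrow> ('n, 'k) mpoly set" where
  "multiples r F t = {g * F j | g j. g \<in> forms t \<and> j < r}"

lemma times_forms:
  assumes "f \<in> forms a" "g \<in> forms b"
  shows "f * g \<in> (forms (a + b) :: ('n::finite, 'k::field) mpoly set)"
proof -
  have "mdeg m = a + b" if m: "m \<in> keys (f * g)" for m
  proof -
    obtain x y where "m = x + y" "x \<in> keys f" "y \<in> keys g"
      using m keys_mult[of f g] by auto
    with assms show ?thesis by (simp add: forms_def mdeg_add)
  qed
  then show ?thesis by (simp add: forms_def)
qed

lemma multiples_subset_forms:
  assumes "\<And>j. j < r \<Longrightarrow> F j \<in> forms d"
  shows "multiples r F t \<subseteq> forms (d + t)"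
  using times_forms[of _ t _ d] assms unfolding multiples_def by (auto simp: add.commute)

lemma multiples_subset_span:
  fixes F :: "nat \<Rightarrow> ('n::finite, 'k::field) mpoly"
  shows "multiples r F t \<subseteq> mpoly.span ((\<lambda>(j, m). single m 1 * F j) ` ({..<r} \<times> mons t))"
proof
  fix f assume "f \<in> multiples r F t"
  then obtain g j where f: "f = g * F j" "g \<in> forms t" "j < r" by (auto simp: multiples_def)
  have "f = (\<Sum>m\<in>keys g. single m (lookup g m)) * F j"
    by (simp add: f(1) sum_single_lookup)
  also have "\<dots> = (\<Sum>m\<in>keys g. const (lookup g m) * (single m 1 * F j))"
    unfolding sum_distrib_right mult.assoc[symmetric] scale_single ..
  also have "\<dots> \<in> mpoly.span ((\<lambda>(j, m). single m 1 * F j) ` ({..<r} \<times> mons t))"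
  proof (intro mpoly.span_sum mpoly.span_scale mpoly.span_base)
    fix m assume "m \<in> keys g"
    then have "m \<in> mons t" using f(2) by (simp add: forms_def mons_def)
    then show "single m 1 * F j \<in> (\<lambda>(j, m). single m 1 * F j) ` ({..<r} \<times> mons t)"
      using f(3) by (auto intro!: image_eqI[of _ _ "(j, m)"])
  qed
  finally show "f \<in> mpoly.span ((\<lambda>(j, m). single m 1 * F j) ` ({..<r} \<times> mons t))" .
qed

lemma dim_multiples:
  fixes F :: "nat \<Rightarrow> ('n::finite, 'k::field) mpoly"
  assumes F: "\<And>j. j < r \<Longrightarrow> F j \<in> forms d"
    and B: "B \<subseteq> {..<r} \<times> mons t" "lin_indep B (products F)"
  shows "card B \<le> mpoly.dim (multiples r F t)"
    and "mpoly.dim (multiples r F t) \<le> card (mons (d + t) :: ('n \<Rightarrow>\<^sub>0 nat) set)"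
    and "mpoly.dim (multiples r F t) \<le> r * card (mons t :: ('n \<Rightarrow>\<^sub>0 nat) set)"
proof -
  let ?M = "mons (d + t) :: ('n \<Rightarrow>\<^sub>0 nat) set" and ?T = "mons t :: ('n \<Rightarrow>\<^sub>0 nat) set"
  let ?e = "(\<lambda>m. single m 1) ` ?M :: ('n, 'k) mpoly set"
  let ?v = "\<lambda>(j, m). single m 1 * F j"
  have fin: "finite ?e" "finite ({..<r} \<times> ?T)" using card_mons(1) by auto
  have sub: "multiples r F t \<subseteq> mpoly.span ?e"
    unfolding span_monomials by (rule multiples_subset_forms[OF F])
  have "mpoly.dim (multiples r F t) \<le> card ?e" using sub fin(1) by (rule mpoly.dim_le_card)
  also have "\<dots> \<le> card ?M" using card_mons(1) by (rule card_image_le)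
  finally show "mpoly.dim (multiples r F t) \<le> card ?M" .
  have "mpoly.dim (multiples r F t) \<le> card (?v ` ({..<r} \<times> ?T))"
    using multiples_subset_span fin(2) by (intro mpoly.dim_le_card) auto
  also have "\<dots> \<le> card ({..<r} \<times> ?T)" using fin(2) by (rule card_image_le)
  finally show "mpoly.dim (multiples r F t) \<le> r * card ?T" by (simp add: card_cartesian_product)
  have finB: "finite B" using B(1) fin(2) by (rule finite_subset)
  have "products F = (\<lambda>\<beta>. lookup (?v \<beta>))" by (auto simp: products_def)
  with B(2) have "lin_indep B (\<lambda>\<beta>. lookup (?v \<beta>))" by simp
  note ind = lin_indep_imp_independent[OF finB this]
  have "?v ` B \<subseteq> multiples r F t"
    using B(1) by (force simp: multiples_def forms_def mons_def)
  from mpoly.maximal_independent_subset_extend[OF this ind(2)]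
  obtain C where C: "?v ` B \<subseteq> C" "C \<subseteq> multiples r F t" "mpoly.independent C" "multiples r F t \<subseteq> mpoly.span C" .
  have "finite C" using mpoly.independent_span_bound[OF fin(1) C(3)] C(2) sub by blast
  then have "card (?v ` B) \<le> card C" using C(1) by (rule card_mono)
  also have "card C = mpoly.dim (multiples r F t)" using C(2,4,3) by (rule mpoly.basis_card_eq_dim)
  finally show "card B \<le> mpoly.dim (multiples r F t)" by (simp add: card_image[OF ind(1)])
qed

section \<open>Homogeneous components\<close>

definition form_part :: "nat \<Rightarrow> ('n::finite, 'k::field) mpoly \<Rightarrow> ('n, 'k) mpoly" where
  "form_part t f = (\<Sum>m\<in>keys f \<inter> mons t. single m (lookup f m))"

lemma lookup_form_part:
  "lookup (form_part t f) m = (if mdeg m = t then lookup f m else 0)"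
proof -
  have "lookup (form_part t f) m =
      (\<Sum>k\<in>keys f \<inter> mons t. if k = m then lookup f m else 0)"
    unfolding form_part_def lookup_sum by (intro sum.cong) (auto simp: lookup_single when_def)
  then show ?thesis by (simp add: mons_def in_keys_iff)
qed

lemma form_part_forms: "form_part t f \<in> forms t"
  by (auto simp: forms_def in_keys_iff lookup_form_part split: if_splits)

lemma form_part_id: "f \<in> forms t \<Longrightarrow> form_part t f = f"
  by (rule poly_mapping_eqI) (auto simp: forms_def in_keys_iff lookup_form_part)

lemma form_part_0: "f \<in> forms s \<Longrightarrow> s \<noteq> t \<Longrightarrow> form_part t f = 0"
  by (rule poly_mapping_eqI) (auto simp: forms_def in_keys_iff lookup_form_part)

lemma form_part_sum: "form_part t (\<Sum>i\<in>I. f i) = (\<Sum>i\<in>I. form_part t (f i))"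
  by (rule poly_mapping_eqI) (simp add: lookup_form_part lookup_sum)

lemma form_part_times:
  fixes F :: "('n::finite, 'k::field) mpoly"
  assumes "F \<in> forms d"
  shows "form_part (d + t) (h * F) = form_part t h * F"
proof -
  let ?s = "\<lambda>m. single m (lookup h m)"
  have s: "?s m \<in> forms (mdeg m)" for m by (simp add: forms_def)
  have "form_part (d + t) (?s m * F) = form_part t (?s m) * F" for m
  proof (cases "mdeg m = t")
    case True
    then show ?thesis using form_part_id[OF s] form_part_id[OF times_forms[OF s assms]] 
      by (metis add.commute)
  next
    case False
    then have "mdeg m + d \<noteq> d + t" by simp
    from form_part_0[OF times_forms[OF s assms] this] form_part_0[OF s False] show ?thesis by simp
  qed
  then have "form_part (d + t) ((\<Sum>m\<in>keys h. ?s m) * F) =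
      form_part t (\<Sum>m\<in>keys h. ?s m) * F"
    by (simp add: sum_distrib_right form_part_sum)
  then show ?thesis by (simp only: sum_single_lookup)
qed

section \<open>The ideal of the forms and the dimension of a component of the quotient\<close>

abbreviation polyring :: "('n::finite, 'k::field) mpoly ring" where
  "polyring \<equiv> ring_of_type_algebra"

lemma polyring_simps:
  "carrier polyring = UNIV" "x \<oplus>\<^bsub>polyring\<^esub> y = x + y" "x \<otimes>\<^bsub>polyring\<^esub> y = x * y"
  "\<zero>\<^bsub>polyring\<^esub> = 0" "\<one>\<^bsub>polyring\<^esub> = 1"
  by (simp_all add: ring_of_type_algebra_def)

lemma polyring_ring: "ring (polyring :: ('n::finite, 'k::field) mpoly ring)"
  by (rule ring_from_type_algebra)

lemma polyring_minus: "\<ominus>\<^bsub>polyring\<^esub> x = - (x :: ('n::finite, 'k::field) mpoly)"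
proof -
  interpret ring "polyring :: ('n, 'k) mpoly ring" by (rule polyring_ring)
  show ?thesis by (rule minus_equality) (simp_all add: polyring_simps)
qed

lemma form_ideal_ideal: "ideal (form_ideal r F) polyring"
  unfolding form_ideal_def by (rule ring.genideal_ideal[OF polyring_ring]) (simp add: polyring_simps)

lemma form_ideal_closed:
  fixes F :: "nat \<Rightarrow> ('n::finite, 'k::field) mpoly"
  shows "f \<in> form_ideal r F \<Longrightarrow> g \<in> form_ideal r F \<Longrightarrow> f + g \<in> form_ideal r F"
    and "f \<in> form_ideal r F \<Longrightarrow> h * f \<in> form_ideal r F"
    and "0 \<in> form_ideal r F"
proof -
  have I: "ideal (form_ideal r F) polyring" by (rule form_ideal_ideal)
  then have A: "additive_subgroup (form_ideal r F) polyring" by (rule ideal.axioms(1))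
  show "f \<in> form_ideal r F \<Longrightarrow> g \<in> form_ideal r F \<Longrightarrow> f + g \<in> form_ideal r F"
    using additive_subgroup.a_closed[OF A, of f g] by (simp add: polyring_simps)
  show "f \<in> form_ideal r F \<Longrightarrow> h * f \<in> form_ideal r F"
    using ideal.I_l_closed[OF I, of f h] by (simp add: polyring_simps)
  show "0 \<in> form_ideal r F" using additive_subgroup.zero_closed[OF A] by (simp add: polyring_simps)
qed

lemma form_ideal_minus:
  assumes "f \<in> form_ideal r F" "g \<in> form_ideal r F"
  shows "f - g \<in> form_ideal r F"
  using form_ideal_closed(1)[OF assms(1) form_ideal_closed(2)[OF assms(2), of "- 1"]] by simp

lemma form_in_form_ideal: "j < r \<Longrightarrow> F j \<in> form_ideal r F"
  unfolding form_ideal_def using ring.genideal_self[OF polyring_ring, of "F ` {..<r}"]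
  by (auto simp: polyring_simps)

lemma form_ideal_subset: "form_ideal r F \<subseteq> range (\<lambda>h. \<Sum>j<r. h j * F j)"
proof -
  let ?T = "range (\<lambda>h. \<Sum>j<r. h j * F j)"
  have add: "f + g \<in> ?T" if "f \<in> ?T" "g \<in> ?T" for f g
  proof -
    obtain h h' where "f = (\<Sum>j<r. h j * F j)" "g = (\<Sum>j<r. h' j * F j)" using \<open>f \<in> ?T\<close> \<open>g \<in> ?T\<close> by blast
    then have "f + g = (\<Sum>j<r. (h j + h' j) * F j)" by (simp add: distrib_right sum.distrib)
    then show ?thesis by (rule range_eqI[where x = "\<lambda>j. h j + h' j"])
  qed
  have mult: "x * f \<in> ?T" if "f \<in> ?T" for x f
  proof -
    obtain h where "f = (\<Sum>j<r. h j * F j)" using \<open>f \<in> ?T\<close> by blast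
    then have "x * f = (\<Sum>j<r. (x * h j) * F j)" by (simp add: sum_distrib_left mult.assoc)
    then show ?thesis by (rule range_eqI[where x = "\<lambda>j. x * h j"])
  qed
  have "ideal ?T polyring"
  proof (rule idealI[OF polyring_ring])
    show "subgroup ?T (add_monoid polyring)"
    proof (rule group.subgroupI)
      show "group (add_monoid (polyring :: ('a, 'b) mpoly ring))"
        using polyring_ring ring.is_abelian_group abelian_group.a_group by blast
      show "inv\<^bsub>add_monoid polyring\<^esub> f \<in> ?T" if "f \<in> ?T" for f
        using mult[OF that, of "- 1"] polyring_minus[of f] unfolding a_inv_def by simp
    qed (use add in \<open>auto simp: polyring_simps\<close>)
    show "x \<otimes>\<^bsub>polyring\<^esub> a \<in> ?T" "a \<otimes>\<^bsub>polyring\<^esub> x \<in> ?T" if "a \<in> ?T" for a x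
      using mult[OF that, of x] by (simp_all add: polyring_simps mult.commute)
  qed
  moreover have "F ` {..<r} \<subseteq> ?T"
  proof
    fix f assume "f \<in> F ` {..<r}"
    then obtain j where j: "j < r" "f = F j" by blast
    then have "f = (\<Sum>i<r. if i = j then F j else 0)" by simp
    also have "\<dots> = (\<Sum>i<r. (if i = j then 1 else 0) * F i)" by (intro sum.cong) auto
    finally show "f \<in> ?T" by (rule range_eqI[where x = "\<lambda>i. if i = j then 1 else 0"])
  qed
  ultimately show ?thesis unfolding form_ideal_def by (rule ring.genideal_minimal[OF polyring_ring])
qed

text \<open>In a combination of the F_j only the component of degree d + t matters, and as the F_j
  are homogeneous of degree d, it is obtained by replacing the multipliers by their components of
  degree t.\<close>

lemma form_ideal_forms:
  fixes F :: "nat \<Rightarrow> ('n::finite, 'k::field) mpoly"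
  assumes F: "\<And>j. j < r \<Longrightarrow> F j \<in> forms d" and f: "f \<in> form_ideal r F" "f \<in> forms (d + t)"
  shows "f \<in> mpoly.span (multiples r F t)"
proof -
  obtain h where h: "f = (\<Sum>j<r. h j * F j)" using f(1) form_ideal_subset by blast
  have "f = form_part (d + t) f" using form_part_id[OF f(2)] by simp
  also have "\<dots> = (\<Sum>j<r. form_part t (h j) * F j)"
    unfolding h form_part_sum using F by (intro sum.cong) (auto simp: form_part_times)
  also have "\<dots> \<in> mpoly.span (multiples r F t)"
    using form_part_forms by (intro mpoly.span_sum mpoly.span_base) (auto simp: multiples_def)
  finally show ?thesis .
qed

lemma span_multiples_subset: "mpoly.span (multiples r F t) \<subseteq> form_ideal r F"
proof (rule mpoly.span_minimal)
  show "multiples r F t \<subseteq> form_ideal r F"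
    using form_ideal_closed(2) form_in_form_ideal unfolding multiples_def by blast
  show "mpoly.subspace (form_ideal r F)" by (rule mpoly.subspaceI) (rule form_ideal_closed; assumption?)+
qed

lemma residue_class_eq: "residue_class r F f = {h + f | h. h \<in> form_ideal r F}"
  unfolding residue_class_def a_r_coset_def r_coset_def by (auto simp: polyring_simps)

lemma residue_class_eq_iff: "residue_class r F f = residue_class r F g \<longleftrightarrow> f - g \<in> form_ideal r F"
proof
  assume "residue_class r F f = residue_class r F g"
  moreover have "f \<in> residue_class r F f" unfolding residue_class_eq using form_ideal_closed(3) by force
  ultimately show "f - g \<in> form_ideal r F" unfolding residue_class_eq by auto
next
  have sub: "residue_class r F f \<subseteq> residue_class r F g" if fg: "f - g \<in> form_ideal r F" for f g
  proof
    fix x assume "x \<in> residue_class r F f"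
    then obtain h where "h \<in> form_ideal r F" "x = h + f" unfolding residue_class_eq by blast
    then have "h + (f - g) \<in> form_ideal r F" "x = (h + (f - g)) + g" using form_ideal_closed(1) fg by auto
    then show "x \<in> residue_class r F g" unfolding residue_class_eq by blast
  qed
  assume fg: "f - g \<in> form_ideal r F"
  have "g - f \<in> form_ideal r F" using form_ideal_minus[OF form_ideal_closed(3) fg] by simp
  with fg show "residue_class r F f = residue_class r F g" using sub by blast
qed

lemma quot_alg_simps:
  shows "residue_class r F f \<in> carrier (quot_alg r F)"
    and "residue_class r F f \<oplus>\<^bsub>quot_alg r F\<^esub> residue_class r F g = residue_class r F (f + g)"
    and "residue_class r F f \<otimes>\<^bsub>quot_alg r F\<^esub> residue_class r F g = residue_class r F (f * g)"
    and "\<zero>\<^bsub>quot_alg r F\<^esub> = residue_class r F 0"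
proof -
  interpret ideal "form_ideal r F" "polyring :: ('a, 'b) mpoly ring" by (rule form_ideal_ideal)
  have hom: "residue_class r F \<in> ring_hom polyring (quot_alg r F)"
    using rcos_ring_hom unfolding residue_class_def quot_alg_def .
  show "residue_class r F f \<in> carrier (quot_alg r F)"
    using ring_hom_closed[OF hom, of f] by (simp add: polyring_simps)
  show "residue_class r F f \<oplus>\<^bsub>quot_alg r F\<^esub> residue_class r F g = residue_class r F (f + g)"
    using ring_hom_add[OF hom, of f g] by (simp add: polyring_simps)
  show "residue_class r F f \<otimes>\<^bsub>quot_alg r F\<^esub> residue_class r F g = residue_class r F (f * g)"
    using ring_hom_mult[OF hom, of f g] by (simp add: polyring_simps)
  show "\<zero>\<^bsub>quot_alg r F\<^esub> = residue_class r F 0"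
    by (simp add: quot_alg_def FactRing_def residue_class_eq)
qed

text \<open>A basis \<open>A\<close> of the degree d + t part of the ideal is extended to a basis
  \<open>C\<close> of all forms of that degree, and the classes of \<open>C - A\<close> are a basis
  of the component. The inductive \<open>dimension\<close> grows by one vector outside the space
  reached so far, hence the induction over parts \<open>D\<close> of \<open>C - A\<close>, with
  \<open>A\<close> kept in the span.\<close>

lemma quot_component_dim:
  fixes F :: "nat \<Rightarrow> ('n::finite, 'k::field) mpoly"
  assumes F: "\<And>j. j < r \<Longrightarrow> F j \<in> forms d"
  shows "quot_component_dim r F (d + t)
    (card (mons (d + t) :: ('n \<Rightarrow>\<^sub>0 nat) set) - mpoly.dim (multiples r F t))"
proof -
  let ?M = "mons (d + t) :: ('n \<Rightarrow>\<^sub>0 nat) set"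
  let ?e = "(\<lambda>m. single m 1) ` ?M :: ('n, 'k) mpoly set"
  let ?V = "forms (d + t) :: ('n, 'k) mpoly set" and ?W = "multiples r F t" and ?rc = "residue_class r F"
  let ?K = "?rc ` (const ` UNIV)"
  have fin: "finite ?e" using card_mons(1) by auto
  have WV: "?W \<subseteq> ?V" by (rule multiples_subset_forms[OF F])
  obtain A where A: "A \<subseteq> ?W" "mpoly.independent A" "?W \<subseteq> mpoly.span A" "card A = mpoly.dim ?W"
    using mpoly.basis_exists[of ?W] by blast
  from A(1) WV have "A \<subseteq> ?V" by blast
  from mpoly.maximal_independent_subset_extend[OF this A(2)]
  obtain C where C: "A \<subseteq> C" "C \<subseteq> ?V" "mpoly.independent C" "?V \<subseteq> mpoly.span C" .
  have "finite C" using mpoly.independent_span_bound[OF fin C(3)] C(2) unfolding span_monomials by blast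
  have "card C = mpoly.dim ?V" using C(2,4,3) by (rule mpoly.basis_card_eq_dim)
  also have "\<dots> = card ?e"
    by (rule mpoly.basis_card_eq_dim[symmetric])
      (use span_monomials[of "d + t"] mpoly.span_superset[of ?e] monomials_independent(2) in auto)
  also have "\<dots> = card ?M" by (rule card_image[OF monomials_independent(1)])
  finally have cC: "card C = card ?M" .
  have spanC: "mpoly.span C = ?V" using C(2,4) mpoly.span_minimal[OF _ subspace_forms] by blast
  have spanA: "mpoly.span A = mpoly.span ?W"
    using A(1,3) by (metis mpoly.span_mono mpoly.span_span subset_antisym)
  have AI: "mpoly.span A \<subseteq> form_ideal r F" unfolding spanA by (rule span_multiples_subset)
  interpret I: ideal "form_ideal r F" "polyring :: ('n, 'k) mpoly ring" by (rule form_ideal_ideal)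
  interpret Q: ring "quot_alg r F" unfolding quot_alg_def by (rule I.quotient_is_ring)
  have dim: "Q.dimension (card D) ?K (?rc ` mpoly.span (A \<union> D))" if "finite D" "D \<subseteq> C - A" for D
    using that
  proof (induction D)
    case empty
    have z: "?rc f = ?rc 0" if f: "f \<in> mpoly.span A" for f
      unfolding residue_class_eq_iff using AI f by auto
    have "?rc ` mpoly.span A = {?rc 0}"
    proof (rule equalityI)
      show "?rc ` mpoly.span A \<subseteq> {?rc 0}" using z by blast
      show "{?rc 0} \<subseteq> ?rc ` mpoly.span A" using mpoly.span_zero[of A] by blast
    qed
    then show ?case unfolding quot_alg_simps(4)[symmetric] by simp
  next
    case (insert v D)
    let ?S = "mpoly.span (A \<union> D)"
    have v: "v \<in> C" "v \<notin> A" using insert.prems by auto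
    have AD: "A \<union> D \<subseteq> C - {v}" using insert v C(1) by auto
    have nv: "v \<notin> ?S"
      using C(3) v(1) mpoly.span_mono[OF AD] unfolding mpoly.dependent_def by blast
    have SV: "?S \<subseteq> ?V" unfolding spanC[symmetric] by (rule mpoly.span_mono) (use AD in blast)
    \<comment> \<open>Equal classes would give a homogeneous element v - w of the ideal, which lies
      in the span of \<open>A\<close> and brings v into \<open>?S\<close>.\<close>
    have "?rc v \<notin> ?rc ` ?S"
    proof
      assume "?rc v \<in> ?rc ` ?S"
      then obtain w where w: "w \<in> ?S" "v - w \<in> form_ideal r F" by (auto simp: residue_class_eq_iff)
      have "v - w \<in> ?V" using mpoly.subspace_diff[OF subspace_forms] v(1) C(2) w(1) SV by blast
      then have "v - w \<in> mpoly.span A" unfolding spanA using F w(2) by (intro form_ideal_forms)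
      then have "v - w \<in> ?S" using mpoly.span_mono[of A "A \<union> D"] by blast
      then have "(v - w) + w \<in> ?S" using w(1) by (rule mpoly.span_add)
      with nv show False by simp
    qed
    from Q.Suc_dim[OF quot_alg_simps(1) this insert.IH] insert.prems
    have "Q.dimension (Suc (card D)) ?K (Q.line_extension ?K (?rc v) (?rc ` ?S))" by simp
    moreover have "Q.line_extension ?K (?rc v) (?rc ` ?S) = ?rc ` mpoly.span (insert v (A \<union> D))"
    proof (intro equalityI subsetI)
      fix u assume "u \<in> Q.line_extension ?K (?rc v) (?rc ` ?S)"
      then obtain c w where "w \<in> ?S" "u = ?rc (const c) \<otimes>\<^bsub>quot_alg r F\<^esub> ?rc v \<oplus>\<^bsub>quot_alg r F\<^esub> ?rc w"
        unfolding Q.line_extension_mem_iff by blast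
      then have "u = ?rc (const c * v + w)" "const c * v + w - const c * v \<in> ?S" by (simp_all add: quot_alg_simps)
      then show "u \<in> ?rc ` mpoly.span (insert v (A \<union> D))" unfolding mpoly.span_insert by blast
    next
      fix u assume "u \<in> ?rc ` mpoly.span (insert v (A \<union> D))"
      then obtain x c where x: "u = ?rc x" "x - const c * v \<in> ?S" unfolding mpoly.span_insert by blast
      have "u = ?rc (const c) \<otimes>\<^bsub>quot_alg r F\<^esub> ?rc v \<oplus>\<^bsub>quot_alg r F\<^esub> ?rc (x - const c * v)"
        by (simp add: quot_alg_simps x(1))
      with x(2) show "u \<in> Q.line_extension ?K (?rc v) (?rc ` ?S)"
        unfolding Q.line_extension_mem_iff by blast
    qed
    ultimately show ?case using insert.hyps by simp
  qed
  have "A \<union> (C - A) = C" using C(1) by blast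
  with dim[of "C - A"] \<open>finite C\<close> spanC
  have "Q.dimension (card (C - A)) ?K (?rc ` ?V)" by simp
  moreover have "card (C - A) = card ?M - mpoly.dim ?W"
    using C(1) \<open>finite C\<close> cC A(4) by (simp add: card_Diff_subset finite_subset)
  ultimately show ?thesis unfolding quot_component_dim_def quot_component_def by simp
qed

text \<open>The ratio (d + t + 1)(d + t + 2) / ((t + 1)(t + 2)) decreases in t. From t + 1 to t this
  is (t + 1)(d + t + 3) \<le> (t + 3)(d + t + 1), with difference 2d.\<close>

lemma triangle_ratio_antimono:
  assumes "t \<le> t0" "s * (t0 + 2 choose 2) \<le> d + t0 + 2 choose 2"
  shows "s * (t + 2 choose 2) \<le> d + t + 2 choose 2"
proof -
  have tri: "2 * (a + 2 choose 2) = (a + 1) * (a + 2)" for a using twice_triangle[of "a + 1"] by simp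
  have iff: "s * (t + 2 choose 2) \<le> d + t + 2 choose 2 \<longleftrightarrow> s * ((t + 1) * (t + 2)) \<le> (d + t + 1) * (d + t + 2)" for t
    unfolding tri[symmetric] by simp
  have "s * ((t + 1) * (t + 2)) \<le> (d + t + 1) * (d + t + 2)"
    using assms(1)
  proof (induction rule: inc_induct)
    case base
    then show ?case using assms(2) unfolding iff .
  next
    case (step t)
    have "(t + 3) * (s * ((t + 1) * (t + 2))) = (t + 1) * (s * ((Suc t + 1) * (Suc t + 2)))"
      by (simp add: algebra_simps)
    also have "\<dots> \<le> (t + 1) * ((d + Suc t + 1) * (d + Suc t + 2))" using step.IH by (rule mult_left_mono) simp
    also have "\<dots> = (d + t + 2) * ((t + 1) * (d + t + 3))" by (simp add: algebra_simps)
    also have "\<dots> \<le> (d + t + 2) * ((t + 3) * (d + t + 1))" by (rule mult_left_mono) (simp_all add: algebra_simps)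
    also have "\<dots> = (t + 3) * ((d + t + 1) * (d + t + 2))" by (simp add: algebra_simps)
    finally have "(t + 3) * (s * ((t + 1) * (t + 2))) \<le> (t + 3) * ((d + t + 1) * (d + t + 2))" .
    moreover have "0 < t + 3" by simp
    ultimately show ?case by (simp only: nat_mult_le_cancel1)
  qed
  then show ?thesis unfolding iff .
qed

text \<open>If d \<le> t, the right side is at most half of (2t + 1)(2t + 2), less than four
  triangles of side t + 1. For n >= 4 this supplies the inequality t < d that separates w^d from the
  ternary forms.\<close>

lemma degree_bound:
  assumes "4 \<le> s" "s * (t + 2 choose 2) \<le> d + t + 2 choose 2"
  shows "t < d"
proof (rule ccontr)
  assume "\<not> t < d"
  have tri: "2 * (a + 2 choose 2) = (a + 1) * (a + 2)" for a using twice_triangle[of "a + 1"] by simp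
  have "4 * (t + 2 choose 2) \<le> s * (t + 2 choose 2)" using assms(1) by (rule mult_right_mono) simp
  with assms(2) have "2 * (4 * (t + 2 choose 2)) \<le> 2 * (d + t + 2 choose 2)" by linarith
  then have "4 * ((t + 1) * (t + 2)) \<le> (d + t + 1) * (d + t + 2)"
    unfolding tri[symmetric] by simp
  also have "\<dots> \<le> (2 * t + 1) * (2 * t + 2)" using \<open>\<not> t < d\<close> by (intro mult_mono) auto
  finally show False by (simp add: algebra_simps)
qed

text \<open>For n >= 4 all products are independent and \<open>expected_dim\<close> is nonnegative.
  For n \<le> 3 it can be negative, as 1 - r for n = 1; the products then span all forms and the
  component is zero, which is what maximal dimension means there.\<close>

theorem proposition2p2:
  fixes n r d t0 :: nat
  assumes "infinite (UNIV :: 'k::field set)"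
    and "n = card (UNIV :: 'n::finite set)"
    and "r > n"
    and "int ((d + t0 + 2) choose (d + t0)) - (int r - 1) * int ((t0 + 2) choose t0) \<ge> 0"
  shows "for_general_forms r d (\<lambda>F :: nat \<Rightarrow> ('n, 'k) mpoly. \<forall>t\<le>t0.
           (\<exists>m. quot_component_dim r F (d + t) m \<and>
                int m = max 0 (expected_dim n r d t) \<and>
                (n \<ge> 4 \<longrightarrow> int m = expected_dim n r d t)) \<and>
           mpoly.dim {g * F j | g j. g \<in> forms t \<and> j < r} =
             min ((n + d + t - 1) choose (d + t)) (r * ((t + n - 1) choose t)))"
proof -
  define N where "N = (\<lambda>t. (n + d + t - 1) choose (d + t))"
  define T where "T = (\<lambda>t. (t + n - 1) choose t)"
  define c where "c = (\<lambda>t. if 4 \<le> n then r * T t else min (N t) (r * T t))"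
  have T: "card (mons t :: ('n \<Rightarrow>\<^sub>0 nat) set) = T t" for t
    using card_mons(2)[of t, where 'n = 'n] assms(2) by (simp add: T_def)
  have N: "card (mons (d + t) :: ('n \<Rightarrow>\<^sub>0 nat) set) = N t" for t
    using card_mons(2)[of "d + t", where 'n = 'n] assms(2) by (simp add: N_def add_ac)
  have choose: "(a + 2) choose a = (a + 2) choose 2" for a :: nat
    using binomial_symmetric[of a "a + 2"] by simp
  obtain s where s: "r = Suc s" using assms(3) by (cases r) auto
  have "int (s * (t0 + 2 choose 2)) \<le> int (d + t0 + 2 choose 2)"
    using assms(4) unfolding choose s by simp
  then have hyp0: "s * (t0 + 2 choose 2) \<le> d + t0 + 2 choose 2" by linarith
  have hyp: "s * (t + 2 choose 2) \<le> d + t + 2 choose 2" if "t \<le> t0" for t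
    using triangle_ratio_antimono[OF that hyp0] .
  have n0: "0 < n" using assms(2) by (simp add: card_gt_0_iff)
  show ?thesis
  proof (rule for_general_forms_indep[OF assms(1), where c = c and ?t0.0 = t0])
    fix t assume t: "t \<le> t0"
    consider "n = 1" | "n = 2" | "n = 3" | "4 \<le> n" using n0 by linarith
    then show "indep_bound TYPE('n) TYPE('k) r d t (c t)"
    proof cases
      case 1
      then have "c t = 1" using assms(3) by (simp add: c_def N_def T_def)
      then show ?thesis using indep_bound_one_variable[where 'n = 'n and 'k = 'k and r = r and d = d and t = t] 1 assms(2,3) by simp
    next
      case 2
      then have "c t = min (d + t + 1) (r * (t + 1))" by (simp add: c_def N_def T_def)
      then show ?thesis using indep_bound_two_variables[where 'n = 'n and 'k = 'k and r = r and d = d and t = t] 2 assms(2) by simp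
    next
      case 3
      then have "c t = min (d + t + 2 choose 2) (r * (t + 2 choose 2))"
        using choose[of t] choose[of "d + t"] by (simp add: c_def N_def T_def add_ac)
      moreover have "indep_bound TYPE('n) TYPE('k) r d t (min (d + t + 2 choose 2) (r * (t + 2 choose 2)))"
      proof (rule indep_bound_three_variables[OF assms(1)])
        show "t \<le> d" if "5 \<le> r" using degree_bound[OF _ hyp[OF t]] that s by simp
      qed (use 3 assms(2,3) in auto)
      ultimately show ?thesis by simp
    next
      case 4
      then have "4 \<le> s" using assms(3) s by simp
      then show ?thesis
        using indep_bound_four_variables[where 'n = 'n, OF assms(1) _ _ hyp[OF t] degree_bound[OF _ hyp[OF t]]] 4 assms(2) s
        by (simp add: c_def T)
    qed
  next
    fix F :: "nat \<Rightarrow> ('n, 'k) mpoly"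
    assume F: "\<And>j. j < r \<Longrightarrow> F j \<in> forms d"
      and B: "\<And>t. t \<le> t0 \<Longrightarrow> \<exists>B\<subseteq>{..<r} \<times> mons t. lin_indep B (products F) \<and> c t \<le> card B"
    show "\<forall>t\<le>t0. (\<exists>m. quot_component_dim r F (d + t) m \<and>
                int m = max 0 (expected_dim n r d t) \<and>
                (n \<ge> 4 \<longrightarrow> int m = expected_dim n r d t)) \<and>
           mpoly.dim {g * F j | g j. g \<in> forms t \<and> j < r} =
             min ((n + d + t - 1) choose (d + t)) (r * ((t + n - 1) choose t))"
    proof (intro allI impI conjI)
      fix t assume t: "t \<le> t0"
      obtain B where B: "B \<subseteq> {..<r} \<times> mons t" "lin_indep B (products F)" "c t \<le> card B" using B[OF t] by blast
      have dim: "card B \<le> mpoly.dim (multiples r F t)" "mpoly.dim (multiples r F t) \<le> N t"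
        "mpoly.dim (multiples r F t) \<le> r * T t"
        unfolding N[symmetric] T[symmetric] by (rule dim_multiples[OF _ B(1,2)], rule F, assumption)+
      have c: "min (N t) (r * T t) \<le> c t" by (simp add: c_def)
      have D: "mpoly.dim (multiples r F t) = min (N t) (r * T t)" using dim B(3) c by linarith
      have N4: "r * T t \<le> N t" if "4 \<le> n" using dim B(3) that by (simp add: c_def)
      show "mpoly.dim {g * F j | g j. g \<in> forms t \<and> j < r} =
          min ((n + d + t - 1) choose (d + t)) (r * ((t + n - 1) choose t))"
        using D unfolding multiples_def N_def T_def .
      have e: "expected_dim n r d t = int (N t) - int (r * T t)" by (simp add: expected_dim_def N_def T_def)
      have "quot_component_dim r F (d + t)
          (card (mons (d + t) :: ('n \<Rightarrow>\<^sub>0 nat) set) - mpoly.dim (multiples r F t))"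
        by (rule quot_component_dim) (rule F)
      then have "quot_component_dim r F (d + t) (N t - min (N t) (r * T t))" unfolding N D .
      moreover have "int (N t - min (N t) (r * T t)) = max 0 (expected_dim n r d t)" unfolding e by linarith
      moreover have "int (N t - min (N t) (r * T t)) = expected_dim n r d t" if "4 \<le> n"
        unfolding e using N4[OF that] by linarith
      ultimately show "\<exists>m. quot_component_dim r F (d + t) m \<and> int m = max 0 (expected_dim n r d t) \<and>
          (n \<ge> 4 \<longrightarrow> int m = expected_dim n r d t)" by blast
    qed
  qed
qed

end
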